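(* Let $X$ be a smooth projective hypersurface in $\mathbb{P}^N$. Then $$H^0(X,S^m[\Omega^1_X(1)])=0\quad\text{for all } m\ge1$$ if and only if $C_XX=\mathbb{P}^N$, i.e. $X$ is not a quadric.
   Context: Varieties are over $\mathbb{C}$; $\Omega^1_X(1)=\Omega^1_X\otimes\mathcal{O}_X(1)$ and $S^m$ is the $m$-th symmetric power. For an irreducible subvariety $X\subset\mathbb{P}^N$ with smooth locus $X_{sm}$ and a subvariety $Y\subset\mathbb{P}^N$, let $\mathcal{C}_XY$ be the closure in $X\times\mathbb{P}^N$ of $$\{(x,z)\in X_{sm}\times\mathbb{P}^N \mid z\in\overline{xy}\ \text{for some}\ y\in Y\cap T_xX,\ y\ne x\},$$ where $T_xX\subset\mathbb{P}^N$ is the embedded projective tangent space to $X$ at $x$ and $\overline{xy}$ is the line through $x$ and $y$. Put $C_XY=p_2(\mathcal{C}_XY)\subset\mathbb{P}^N$, where $p_2$ is the projection to $\mathbb{P}^N$. $C_XX$ is called the t-trisecant variety of $X$.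
   Formalization: Proved for N ≥ 3 and X not a hyperplane: for a hyperplane all H^0 vanish but C_XX = X ≠ P^N and X is not a quadric; for a smooth plane curve of degree d ≥ 3, C_XX = P^2 but Ω^1_X(1) = O_X(d−2) has nonzero sections. *)

theory Defs
  imports "HOL-Analysis.Analysis"
begin

section \<open>Projective space and the Zariski topology\<close>

text \<open>
  Throughout, V = complex^'n with CARD('n) = N + 1. A point of P^N = P(V) is a line through the
  origin of V, represented as the set of its vectors.
\<close>

definition proj_space :: "(complex^'n) set set" where
  "proj_space = {vec.span {v} | v. v \<noteq> 0}"

text \<open>The complex algebra of functions generated by a set of functions.\<close>

inductive_set alg_gen :: "('a \<Rightarrow> complex) set \<Rightarrow> ('a \<Rightarrow> complex) set"
  for B :: "('a \<Rightarrow> complex) set" where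
  const: "(\<lambda>_. c) \<in> alg_gen B"
| gen: "f \<in> B \<Longrightarrow> f \<in> alg_gen B"
| add: "f \<in> alg_gen B \<Longrightarrow> g \<in> alg_gen B \<Longrightarrow> (\<lambda>v. f v + g v) \<in> alg_gen B"
| mult: "f \<in> alg_gen B \<Longrightarrow> g \<in> alg_gen B \<Longrightarrow> (\<lambda>v. f v * g v) \<in> alg_gen B"

text \<open>
  Polynomials are identified with polynomial functions (the field is infinite). The zero
  polynomial is homogeneous of every degree.
\<close>

definition polys :: "(complex^'n \<Rightarrow> complex) set" where
  "polys = alg_gen (range (\<lambda>i v. v $ i))"

definition homog :: "nat \<Rightarrow> (complex^'n \<Rightarrow> complex) \<Rightarrow> bool" where
  "homog d F \<longleftrightarrow> F \<in> polys \<and> (\<forall>c v. F (c *s v) = c ^ d * F v)"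

definition bihomog :: "nat \<Rightarrow> nat \<Rightarrow> ((complex^'n) \<times> (complex^'n) \<Rightarrow> complex) \<Rightarrow> bool" where
  "bihomog d e G \<longleftrightarrow>
     G \<in> alg_gen (range (\<lambda>i p. fst p $ i) \<union> range (\<lambda>i p. snd p $ i)) \<and>
     (\<forall>b c v w. G (b *s v, c *s w) = b ^ d * c ^ e * G (v, w))"

definition vanishes_on :: "(complex^'n \<Rightarrow> complex) \<Rightarrow> (complex^'n) set set \<Rightarrow> bool" where
  "vanishes_on F X \<longleftrightarrow> (\<forall>x\<in>X. \<forall>v\<in>x. F v = 0)"

definition zariski_closed :: "(complex^'n) set set \<Rightarrow> bool" where
  "zariski_closed Z \<longleftrightarrow>
     (\<exists>S. (\<forall>F\<in>S. \<exists>d. homog d F) \<and> Z = {x \<in> proj_space. \<forall>F\<in>S. vanishes_on F {x}})"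

definition irreducible_variety :: "(complex^'n) set set \<Rightarrow> bool" where
  "irreducible_variety X \<longleftrightarrow> zariski_closed X \<and> X \<noteq> {} \<and>
     (\<forall>A B. zariski_closed A \<and> zariski_closed B \<and> X \<subseteq> A \<union> B \<longrightarrow> X \<subseteq> A \<or> X \<subseteq> B)"

definition open_in :: "(complex^'n) set set \<Rightarrow> (complex^'n) set set \<Rightarrow> bool" where
  "open_in X U \<longleftrightarrow> (\<exists>Z. zariski_closed Z \<and> U = X - Z)"

definition prod_closure ::
  "((complex^'n) set \<times> (complex^'n) set) set \<Rightarrow> ((complex^'n) set \<times> (complex^'n) set) set" where
  "prod_closure S = {(x, z) \<in> proj_space \<times> proj_space.
     \<forall>d e G. bihomog d e G \<and> (\<forall>(x', z')\<in>S. \<forall>v\<in>x'. \<forall>w\<in>z'. G (v, w) = 0)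
       \<longrightarrow> (\<forall>v\<in>x. \<forall>w\<in>z. G (v, w) = 0)}"

section \<open>Tangent spaces and smoothness\<close>

definition dir_deriv :: "(complex^'n \<Rightarrow> complex) \<Rightarrow> complex^'n \<Rightarrow> complex^'n \<Rightarrow> complex" where
  "dir_deriv F v w = deriv (\<lambda>t. F (v + t *s w)) 0"

text \<open>
  The linear subspace of V lying over the embedded projective tangent space at x, cut out by the
  differentials of all homogeneous polynomials in the ideal of X.
\<close>

definition tangent_cone :: "(complex^'n) set set \<Rightarrow> (complex^'n) set \<Rightarrow> (complex^'n) set" where
  "tangent_cone X x =
     {w. \<forall>d F. homog d F \<and> vanishes_on F X \<longrightarrow> (\<forall>v\<in>x - {0}. dir_deriv F v w = 0)}"

definition proj_tangent :: "(complex^'n) set set \<Rightarrow> (complex^'n) set \<Rightarrow> (complex^'n) set set" where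
  "proj_tangent X x = {y \<in> proj_space. y \<subseteq> tangent_cone X x}"

text \<open>
  For irreducible X, the minimum over X of the dimension of the Zariski tangent space is dim X;
  the points where it is attained are the smooth (nonsingular) points.
\<close>

definition smooth_locus :: "(complex^'n) set set \<Rightarrow> (complex^'n) set set" where
  "smooth_locus X =
     {x \<in> X. \<forall>y\<in>X. vec.dim (tangent_cone X x) \<le> vec.dim (tangent_cone X y)}"

definition smooth_variety :: "(complex^'n) set set \<Rightarrow> bool" where
  "smooth_variety X \<longleftrightarrow> irreducible_variety X \<and> smooth_locus X = X"

section \<open>Hypersurfaces\<close>

text \<open>
  The equation F is reduced: it generates the homogeneous ideal of X. Thus a double hyperplane,
  for instance, counts as a hyperplane and not as a quadric. Since F is nonzero, d is unique.
\<close>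

definition hypersurface_deg :: "nat \<Rightarrow> (complex^'n) set set \<Rightarrow> bool" where
  "hypersurface_deg d X \<longleftrightarrow> (\<exists>F. homog d F \<and> F \<noteq> (\<lambda>_. 0) \<and>
     X = {x \<in> proj_space. vanishes_on F {x}} \<and>
     (\<forall>e H. homog e H \<and> vanishes_on H X \<longrightarrow> (\<exists>G\<in>polys. \<forall>v. H v = F v * G v)))"

definition hypersurface :: "(complex^'n) set set \<Rightarrow> bool" where
  "hypersurface X \<longleftrightarrow> (\<exists>d\<ge>1. hypersurface_deg d X)"

definition hyperplane :: "(complex^'n) set set \<Rightarrow> bool" where
  "hyperplane X \<longleftrightarrow> hypersurface_deg 1 X"

definition quadric :: "(complex^'n) set set \<Rightarrow> bool" where
  "quadric X \<longleftrightarrow> hypersurface_deg 2 X"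

section \<open>The t-trisecant variety\<close>

definition proj_line :: "(complex^'n) set \<Rightarrow> (complex^'n) set \<Rightarrow> (complex^'n) set set" where
  "proj_line x y = {z \<in> proj_space. z \<subseteq> vec.span (x \<union> y)}"

definition tangent_secant_pairs ::
  "(complex^'n) set set \<Rightarrow> (complex^'n) set set \<Rightarrow> ((complex^'n) set \<times> (complex^'n) set) set" where
  "tangent_secant_pairs X Y = prod_closure
     {(x, z). x \<in> smooth_locus X \<and> (\<exists>y \<in> Y \<inter> proj_tangent X x. y \<noteq> x \<and> z \<in> proj_line x y)}
     \<inter> (X \<times> proj_space)"

definition tangent_secant_variety ::
  "(complex^'n) set set \<Rightarrow> (complex^'n) set set \<Rightarrow> (complex^'n) set set" where
  "tangent_secant_variety X Y = snd ` tangent_secant_pairs X Y"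

definition t_trisecant_variety :: "(complex^'n) set set \<Rightarrow> (complex^'n) set set" where
  "t_trisecant_variety X = tangent_secant_variety X X"

section \<open>Twisted symmetric differentials\<close>

text \<open>
  Sections of O_X(k) over U are functions on the punctured cone over U that are locally quotients
  of homogeneous polynomials with degree difference k; values elsewhere are irrelevant.
\<close>

definition O_sections ::
  "nat \<Rightarrow> (complex^'n) set set \<Rightarrow> (complex^'n) set set \<Rightarrow> (complex^'n \<Rightarrow> complex) set" where
  "O_sections k X U = {s. \<forall>x\<in>U. \<exists>W d p q. open_in X W \<and> x \<in> W \<and> W \<subseteq> U \<and>
     homog (d + k) p \<and> homog d q \<and>
     (\<forall>y\<in>W. \<forall>v\<in>y - {0}. q v \<noteq> 0 \<and> s v = p v / q v)}"

text \<open>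
  Let pi be the projection from V - 0 to P(V). For x in X, a nonzero v in x and w in the tangent
  cone at x, the pair (v, w) represents the tangent vector of X at x that is the image of w under
  the differential of pi at v, and v trivialises the fibre of O(1) at x. The value at (v, w) of
  an element of the fibre of S^m[Omega^1_X(1)] at x is obtained by regarding it as a homogeneous
  polynomial function of degree m on the tangent space (X smooth, characteristic 0), with values
  in the fibre of O(m). In particular, f dg tensor l with f, g regular and l a section of O(1)
  has the value f(v) l(v) (D_w g)(v).

  Sections are such functions on \<open>tangent_pairs X U\<close>, extended by 0, which are locally of the
  required algebraic form.
\<close>

definition tangent_pairs ::
  "(complex^'n) set set \<Rightarrow> (complex^'n) set set \<Rightarrow> ((complex^'n) \<times> (complex^'n)) set" where
  "tangent_pairs X U = {(v, w). \<exists>x\<in>U. v \<in> x - {0} \<and> w \<in> tangent_cone X x}"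

text \<open>
  Sections of Omega^1_X(1) over U: locally finite sums of a dg, with a a section of O_X(1) and
  g = p / q a regular function.
\<close>

definition Omega1_sections ::
  "(complex^'n) set set \<Rightarrow> (complex^'n) set set \<Rightarrow> (complex^'n \<Rightarrow> complex^'n \<Rightarrow> complex) set" where
  "Omega1_sections X U = {\<omega>.
     (\<forall>v w. (v, w) \<notin> tangent_pairs X U \<longrightarrow> \<omega> v w = 0) \<and>
     (\<forall>x\<in>U. \<exists>W r a d p q. open_in X W \<and> x \<in> W \<and> W \<subseteq> U \<and>
        (\<forall>k<r::nat. a k \<in> O_sections 1 X W \<and> homog (d k) (p k) \<and> homog (d k) (q k) \<and>
           (\<forall>y\<in>W. \<forall>v\<in>y - {0}. q k v \<noteq> 0)) \<and>
        (\<forall>(v, w)\<in>tangent_pairs X W.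
           \<omega> v w = (\<Sum>k<r. a k v * dir_deriv (\<lambda>u. p k u / q k u) v w)))}"

text \<open>
  Sections of S^m[Omega^1_X(1)] over U: locally finite sums of symmetric products of m sections
  of Omega^1_X(1), with regular coefficients.
\<close>

definition Sym_Omega1_sections ::
  "nat \<Rightarrow> (complex^'n) set set \<Rightarrow> (complex^'n) set set
     \<Rightarrow> (complex^'n \<Rightarrow> complex^'n \<Rightarrow> complex) set" where
  "Sym_Omega1_sections m X U = {\<sigma>.
     (\<forall>v w. (v, w) \<notin> tangent_pairs X U \<longrightarrow> \<sigma> v w = 0) \<and>
     (\<forall>x\<in>U. \<exists>W r f \<omega>. open_in X W \<and> x \<in> W \<and> W \<subseteq> U \<and>
        (\<forall>k<r::nat. f k \<in> O_sections 0 X W \<and> (\<forall>i<m. \<omega> k i \<in> Omega1_sections X W)) \<and>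
        (\<forall>(v, w)\<in>tangent_pairs X W. \<sigma> v w = (\<Sum>k<r. f k v * (\<Prod>i<m. \<omega> k i v w))))}"

definition H0_Sym_Omega1 ::
  "nat \<Rightarrow> (complex^'n) set set \<Rightarrow> (complex^'n \<Rightarrow> complex^'n \<Rightarrow> complex) set" where
  "H0_Sym_Omega1 m X = Sym_Omega1_sections m X X"

end

theory Submission
  imports Defs "HOL-Library.Function_Algebras" "HOL-Computational_Algebra.Fundamental_Theorem_Algebra"
begin

text \<open>
  Let \<open>F\<close> be the equation of \<open>X\<close>, of degree \<open>d\<close>. If \<open>d = 2\<close>, then \<open>F\<close>, as a quadratic form on
  tangent vectors, is a nonzero section for \<open>m = 2\<close>, and a tangent line that meets \<open>X\<close> in a
  second point lies on \<open>X\<close>, so the t-trisecant variety is contained in \<open>X\<close>.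

  Let \<open>d \<ge> 3\<close>. A section \<open>\<sigma>\<close> is a function on the pairs \<open>(v, w)\<close> with \<open>F v = 0\<close> and
  \<open>DF v w = 0\<close>. Coordinates \<open>x1, x2, x3\<close> form a regular sequence modulo \<open>F\<close>, so
  \<open>X\<close> has enough depth for \<open>\<sigma>\<close> to be a polynomial in \<open>(v, w)\<close>; being of degree \<open>0\<close>
  in \<open>v\<close>, it is a polynomial \<open>p w\<close>. Then \<open>p\<close> vanishes on \<open>X\<close> because \<open>\<sigma> v v = 0\<close>. If the
  second fundamental form at \<open>v\<close> is nonzero on \<open>w\<close>, the line through \<open>v\<close> and \<open>w\<close> meets \<open>X\<close>
  in another point \<open>y = w + s v\<close>, whence \<open>\<sigma> v w = \<sigma> v y = p y = 0\<close>. These pairs are dense among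
  the tangent pairs, so \<open>\<sigma> = 0\<close>; they also show that \<open>(x, z)\<close> lies in the closure that defines
  the t-trisecant variety whenever \<open>z\<close> is tangent to \<open>X\<close> at \<open>x\<close>, and every \<open>z\<close> is
  tangent to \<open>X\<close> somewhere.
\<close>

section \<open>Algebras of functions\<close>

text \<open>The twist by \<open>1\<close> is what makes the degree in \<open>v\<close> zero:
  rescaling \<open>v\<close> by \<open>c\<close> multiplies a section of O(1) by \<open>c\<close>
  and divides a differential by \<open>c\<close>. Local denominators of a section are arbitrary
  forms. The Nullstellensatz replaces them by powers of linear coordinates, for which regularity can
  be proved by hand: as \<open>F\<close> is monic up to a constant along \<open>e\<close>, the
  polynomials modulo \<open>F\<close> are free over those constant along \<open>e\<close>, with
  basis the powers of \<open>v $ i0\<close> below \<open>d\<close>, and all questions become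
  coefficientwise ones in a polynomial ring. Since polynomials are functions here, coefficients are
  recovered by restriction to lines. The obstacle is that numerators on tangent pairs are determined
  only modulo \<open>DF\<close>. Hence functions vanishing on tangent pairs must first be shown to
  be multiples of \<open>DF\<close>, and the multipliers must then be split. The direction
  \<open>e\<close> and three further coordinates account for the four dimensions. A smooth plane
  cubic has trivial cotangent bundle, so its twisted differentials do have sections. A hyperplane
  contains its t-trisecant variety without being a quadric, which is why it is set apart.\<close>

lemma alg_gen_subst:
  assumes "p \<in> alg_gen B" and "\<And>b. b \<in> B \<Longrightarrow> (\<lambda>s. b (h s)) \<in> alg_gen C"
  shows "(\<lambda>s. p (h s)) \<in> alg_gen C"
  using assms(1) by induction (auto intro: alg_gen.intros assms(2))

lemma alg_gen_scale: "p \<in> alg_gen B \<Longrightarrow> (\<lambda>s. c * p s) \<in> alg_gen B"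
  by (intro alg_gen.mult alg_gen.const)

lemma alg_gen_uminus: "p \<in> alg_gen B \<Longrightarrow> (\<lambda>s. - p s) \<in> alg_gen B"
  using alg_gen_scale[of p B "-1"] by simp

lemma alg_gen_diff:
  "p \<in> alg_gen B \<Longrightarrow> q \<in> alg_gen B \<Longrightarrow> (\<lambda>s. p s - q s) \<in> alg_gen B"
  using alg_gen.add[of p B "\<lambda>s. - q s"] alg_gen_uminus[of q B] by simp

lemma alg_gen_power: "p \<in> alg_gen B \<Longrightarrow> (\<lambda>s. p s ^ k) \<in> alg_gen B"
  by (induction k) (auto intro: alg_gen.intros)

lemma alg_gen_sum:
  assumes "\<And>i. i \<in> I \<Longrightarrow> p i \<in> alg_gen B"
  shows "(\<lambda>s. \<Sum>i\<in>I. p i s) \<in> alg_gen B"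
  using assms by (induction I rule: infinite_finite_induct) (auto intro: alg_gen.intros)

lemmas alg_gen_intros =
  alg_gen.const alg_gen.add alg_gen.mult alg_gen_uminus alg_gen_diff alg_gen_power alg_gen_sum

abbreviation (input) pair_coords :: "((complex^'n) \<times> (complex^'n) \<Rightarrow> complex) set" where
  "pair_coords \<equiv> range (\<lambda>i p. fst p $ i) \<union> range (\<lambda>i p. snd p $ i)"

definition pair_polys :: "((complex^'n) \<times> (complex^'n) \<Rightarrow> complex) set" where
  "pair_polys = alg_gen pair_coords"

lemmas polys_intros = alg_gen_intros[where B = "range (\<lambda>i v. v $ i)", folded polys_def]
lemmas pair_polys_intros = alg_gen_intros[where B = pair_coords, folded pair_polys_def]

lemma polys_coord: "(\<lambda>v. v $ i) \<in> polys"
  unfolding polys_def by (rule alg_gen.gen) auto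

lemma pair_polys_fst: "(\<lambda>s. fst s $ i) \<in> pair_polys"
  unfolding pair_polys_def by (rule alg_gen.gen) auto

lemma polys_subst:
  assumes "p \<in> polys" and "\<And>i. (\<lambda>s. h s $ i) \<in> alg_gen C"
  shows "(\<lambda>s. p (h s)) \<in> alg_gen C"
  using assms(1) unfolding polys_def by (rule alg_gen_subst) (use assms(2) in auto)

lemma pair_polys_subst:
  assumes "p \<in> pair_polys"
    and "\<And>i. (\<lambda>s. h s $ i) \<in> alg_gen C" and "\<And>i. (\<lambda>s. g s $ i) \<in> alg_gen C"
  shows "(\<lambda>s. p (h s, g s)) \<in> alg_gen C"
  using assms(1) unfolding pair_polys_def by (rule alg_gen_subst) (use assms(2,3) in auto)

lemma polys_comp_fst: "p \<in> polys \<Longrightarrow> (\<lambda>s. p (fst s)) \<in> pair_polys"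
  unfolding pair_polys_def by (rule polys_subst) (auto intro: alg_gen.gen)

lemma pair_polys_at: "p \<in> pair_polys \<Longrightarrow> (\<lambda>v. p (v, w)) \<in> polys"
  unfolding polys_def by (rule pair_polys_subst) (auto intro: alg_gen.intros)

lemma pair_polys_at_fst: "p \<in> pair_polys \<Longrightarrow> (\<lambda>w. p (v, w)) \<in> polys"
  unfolding polys_def by (rule pair_polys_subst) (auto intro: alg_gen.intros)

section \<open>Families of one-variable polynomials\<close>

text \<open>This encodes a polynomial in one new variable over the algebra \<open>alg_gen B\<close>.
  The bound on the degree is uniform in the parameter; without it the coefficients would only
  describe a formal series over the algebra.\<close>

definition pfam :: "('a \<Rightarrow> complex) set \<Rightarrow> ('a \<Rightarrow> complex poly) \<Rightarrow> bool" where
  "pfam B P \<longleftrightarrow> (\<exists>M. \<forall>s. degree (P s) \<le> M) \<and> (\<forall>k. (\<lambda>s. coeff (P s) k) \<in> alg_gen B)"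

lemma pfamD: "pfam B P \<Longrightarrow> (\<lambda>s. coeff (P s) k) \<in> alg_gen B"
  by (simp add: pfam_def)

lemma pfam_const: "p \<in> alg_gen B \<Longrightarrow> pfam B (\<lambda>s. [:p s:])"
  unfolding pfam_def
proof (intro conjI allI)
  fix k assume "p \<in> alg_gen B"
  then show "(\<lambda>s. coeff [:p s:] k) \<in> alg_gen B"
    by (cases k) (auto simp: alg_gen.const)
qed auto

lemma pfam_linear:
  assumes "p \<in> alg_gen B" and "q \<in> alg_gen B"
  shows "pfam B (\<lambda>s. [:p s, q s:])"
  unfolding pfam_def
proof (intro conjI allI exI)
  fix s show "degree [:p s, q s:] \<le> 1"
    using degree_pCons_le[of "p s" "[:q s:]"] by simp
next
  fix k
  have "(\<lambda>s. coeff [:p s, q s:] k) = (if k = 0 then p else if k = 1 then q else (\<lambda>_. 0))"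
    by (auto simp: fun_eq_iff coeff_pCons split: nat.splits)
  then show "(\<lambda>s. coeff [:p s, q s:] k) \<in> alg_gen B"
    using assms by (simp add: alg_gen.const)
qed

lemma pfam_add: assumes "pfam B P" "pfam B Q" shows "pfam B (\<lambda>s. P s + Q s)"
proof -
  obtain M N where "\<forall>s. degree (P s) \<le> M" "\<forall>s. degree (Q s) \<le> N"
    using assms by (auto simp: pfam_def)
  then have "\<forall>s. degree (P s + Q s) \<le> max M N"
    by (meson degree_add_le max.coboundedI1 max.coboundedI2)
  with assms show ?thesis by (auto simp: pfam_def intro: alg_gen.add)
qed

lemma pfam_mult: assumes "pfam B P" "pfam B Q" shows "pfam B (\<lambda>s. P s * Q s)"
proof -
  obtain M N where "\<forall>s. degree (P s) \<le> M" "\<forall>s. degree (Q s) \<le> N"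
    using assms by (auto simp: pfam_def)
  then have "\<forall>s. degree (P s * Q s) \<le> M + N"
    by (meson add_mono degree_mult_le order_trans)
  moreover have "(\<lambda>s. coeff (P s * Q s) k) \<in> alg_gen B" for k
    unfolding coeff_mult using assms by (intro alg_gen_sum alg_gen.mult) (auto simp: pfam_def)
  ultimately show ?thesis by (auto simp: pfam_def)
qed

lemma pfam_diff: assumes "pfam B P" "pfam B Q" shows "pfam B (\<lambda>s. P s - Q s)"
  using pfam_add[OF assms(1) pfam_mult[OF pfam_const[OF alg_gen.const[of "-1"]] assms(2)]] by simp

lemma pfam_monom: assumes "p \<in> alg_gen B" shows "pfam B (\<lambda>s. monom (p s) k)"
  unfolding pfam_def
proof (intro conjI allI exI)
  fix s show "degree (monom (p s) k) \<le> k" by (rule degree_monom_le)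
next
  fix j show "(\<lambda>s. coeff (monom (p s) k) j) \<in> alg_gen B"
    using assms by (cases "k = j") (auto simp: alg_gen.const)
qed

lemma poly_eq_sum:
  fixes P :: "'a::comm_semiring_1 poly"
  assumes "degree P \<le> M"
  shows "poly P x = (\<Sum>i\<le>M. coeff P i * x ^ i)"
proof -
  have "(\<Sum>i\<le>degree P. coeff P i * x ^ i) = (\<Sum>i\<le>M. coeff P i * x ^ i)"
    using assms by (intro sum.mono_neutral_left) (auto simp: coeff_eq_0)
  then show ?thesis by (simp add: poly_altdef)
qed

text \<open>Generators that become affine in \<open>t\<close> yield polynomials in \<open>t\<close>
  under sums and products. The substitutions \<open>h\<close> used later move a vector along a line:
  in a variable direction, to a prescribed coordinate value, or along an axis.\<close>

lemma alg_gen_pfam: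
  assumes "p \<in> alg_gen B"
    and "\<And>b. b \<in> B \<Longrightarrow> \<exists>f g. f \<in> alg_gen C \<and> g \<in> alg_gen C \<and> (\<forall>t s. b (h t s) = f s + t * g s)"
  shows "\<exists>P. pfam C P \<and> (\<forall>t s. poly (P s) t = p (h t s))"
  using assms(1)
proof induction
  case (const c)
  show ?case by (rule exI[of _ "\<lambda>s. [:c:]"]) (auto intro: pfam_const alg_gen.const)
next
  case (gen b)
  then obtain f g where "f \<in> alg_gen C" "g \<in> alg_gen C" "\<forall>t s. b (h t s) = f s + t * g s"
    using assms(2) by blast
  then show ?case by (intro exI[of _ "\<lambda>s. [:f s, g s:]"]) (auto intro: pfam_linear)
next
  case (add f g)
  then obtain P Q where "pfam C P" "\<forall>t s. poly (P s) t = f (h t s)"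
    "pfam C Q" "\<forall>t s. poly (Q s) t = g (h t s)" by blast
  then show ?case by (intro exI[of _ "\<lambda>s. P s + Q s"]) (auto intro: pfam_add)
next
  case (mult f g)
  then obtain P Q where "pfam C P" "\<forall>t s. poly (P s) t = f (h t s)"
    "pfam C Q" "\<forall>t s. poly (Q s) t = g (h t s)" by blast
  then show ?case by (intro exI[of _ "\<lambda>s. P s * Q s"]) (auto intro: pfam_mult)
qed

lemma poly_eq_if_eq_nonzero:
  fixes P Q :: "complex poly"
  assumes "\<And>t. t \<noteq> 0 \<Longrightarrow> poly P t = poly Q t"
  shows "P = Q"
proof -
  have "poly ([:0, 1:] * P) t = poly ([:0, 1:] * Q) t" for t
    by (cases "t = 0") (auto simp: assms)
  then have "[:0, 1:] * P = [:0, 1:] * Q"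
    by (metis poly_eq_poly_eq_iff ext)
  then show ?thesis by simp
qed

lemma polyI: 
  fixes P Q :: "complex poly"
  assumes "\<And>t. poly P t = poly Q t"
  shows "P = Q"
  using assms by (metis poly_eq_poly_eq_iff ext)

section \<open>A homogeneous Nullstellensatz\<close>

interpretation fv: vector_space "\<lambda>(c::complex) (f::'a \<Rightarrow> complex) x. c * f x"
  by unfold_locales (auto simp: fun_eq_iff algebra_simps)

section \<open>Filtration of the polynomials by degree\<close>

definition mon :: "'n list \<Rightarrow> complex^'n \<Rightarrow> complex" where
  "mon xs = (\<lambda>v. prod_list (map (\<lambda>i. v $ i) xs))"

text \<open>Each of these spaces is spanned by finitely many monomials, and together they exhaust
  the polynomials; this is the countable dimension needed for the Nullstellensatz.\<close>

definition deg_span :: "nat \<Rightarrow> (complex^'n \<Rightarrow> complex) set" where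
  "deg_span M = fv.span (mon ` {xs. length xs \<le> M})"

lemma deg_span_mono: "M \<le> N \<Longrightarrow> deg_span M \<subseteq> deg_span N"
  unfolding deg_span_def by (rule fv.span_mono) auto

lemma deg_span_add: "f \<in> deg_span M \<Longrightarrow> g \<in> deg_span M \<Longrightarrow> (\<lambda>v. f v + g v) \<in> deg_span M"
  using fv.span_add[of f _ g] by (simp add: deg_span_def plus_fun_def)

lemma deg_span_mon: "length xs \<le> M \<Longrightarrow> mon xs \<in> deg_span M"
  unfolding deg_span_def by (rule fv.span_base) auto

lemma deg_span_mult_mon:
  assumes "g \<in> deg_span N"
  shows "(\<lambda>v. mon xs v * g v) \<in> deg_span (length xs + N)"
  using assms unfolding deg_span_def
proof (induction rule: fv.span_induct_alt)
  case base
  show ?case using fv.span_zero by (simp add: zero_fun_def)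
next
  case (step c x y)
  then obtain ys where ys: "x = mon ys" "length ys \<le> N" by auto
  have "(\<lambda>v. mon xs v * ((\<lambda>v. c * x v) + y) v)
    = (\<lambda>v. c * mon (xs @ ys) v) + (\<lambda>v. mon xs v * y v)"
    by (auto simp: fun_eq_iff ys mon_def algebra_simps)
  moreover have "mon (xs @ ys) \<in> fv.span (mon ` {xs'. length xs' \<le> length xs + N})"
    using ys(2) by (intro fv.span_base) auto
  ultimately show ?case by (simp only: fv.span_add fv.span_scale step.IH)
qed

lemma deg_span_mult:
  assumes "f \<in> deg_span M" "g \<in> deg_span N"
  shows "(\<lambda>v. f v * g v) \<in> deg_span (M + N)"
  using assms(1) unfolding deg_span_def
proof (induction rule: fv.span_induct_alt)
  case base
  show ?case using fv.span_zero by (simp add: zero_fun_def)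
next
  case (step c x y)
  then obtain xs where xs: "x = mon xs" "length xs \<le> M" by auto
  have "(\<lambda>v. ((\<lambda>v. c * x v) + y) v * g v)
    = (\<lambda>v. c * (mon xs v * g v)) + (\<lambda>v. y v * g v)"
    by (auto simp: fun_eq_iff xs algebra_simps)
  moreover have "(\<lambda>v. mon xs v * g v) \<in> deg_span (M + N)"
    using deg_span_mult_mon[OF assms(2), of xs] deg_span_mono[of "length xs + N" "M + N"] xs(2)
    by auto
  ultimately show ?case
    unfolding deg_span_def by (simp only: fv.span_add fv.span_scale step.IH)
qed

lemma polys_deg_span: "p \<in> polys \<Longrightarrow> \<exists>M. p \<in> deg_span M"
  unfolding polys_def
proof (induction rule: alg_gen.induct)
  case (const c)
  have "(\<lambda>v. c * mon [] v) \<in> deg_span 0"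
    unfolding deg_span_def by (intro fv.span_scale fv.span_base) auto
  then show ?case by (auto simp: mon_def)
next
  case (gen f)
  then obtain i where "f = mon [i]" by (auto simp: mon_def)
  then show ?case using deg_span_mon[of "[i]" 1] by auto
next
  case (add f g)
  then obtain M N where "f \<in> deg_span M" "g \<in> deg_span N" by auto
  then have "f \<in> deg_span (max M N)" "g \<in> deg_span (max M N)"
    using deg_span_mono[of M "max M N"] deg_span_mono[of N "max M N"] by auto
  then show ?case using deg_span_add by blast
next
  case (mult f g)
  then show ?case using deg_span_mult by blast
qed

section \<open>Ideals of polynomial functions and their maximal ideals\<close>

definition pideal :: "(complex^'n \<Rightarrow> complex) set \<Rightarrow> bool" where
  "pideal I \<longleftrightarrow> I \<subseteq> polys \<and> (\<lambda>_. 0) \<in> I \<and> (\<forall>p\<in>I. \<forall>q\<in>I. (\<lambda>v. p v + q v) \<in> I) \<and>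
     (\<forall>a\<in>polys. \<forall>p\<in>I. (\<lambda>v. a v * p v) \<in> I)"

lemma pidealI:
  assumes "\<And>p. p \<in> I \<Longrightarrow> p \<in> polys" "(\<lambda>_. 0) \<in> I"
    "\<And>p q. p \<in> I \<Longrightarrow> q \<in> I \<Longrightarrow> (\<lambda>v. p v + q v) \<in> I"
    "\<And>a p. a \<in> polys \<Longrightarrow> p \<in> I \<Longrightarrow> (\<lambda>v. a v * p v) \<in> I"
  shows "pideal I"
  using assms by (auto simp: pideal_def)

lemma pideal_add: "pideal I \<Longrightarrow> p \<in> I \<Longrightarrow> q \<in> I \<Longrightarrow> (\<lambda>v. p v + q v) \<in> I"
  by (auto simp: pideal_def)

lemma pideal_mult: "pideal I \<Longrightarrow> a \<in> polys \<Longrightarrow> p \<in> I \<Longrightarrow> (\<lambda>v. a v * p v) \<in> I"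
  by (auto simp: pideal_def)

lemma pideal_polys: "pideal I \<Longrightarrow> p \<in> I \<Longrightarrow> p \<in> polys"
  by (auto simp: pideal_def)

lemma pideal_diff:
  assumes "pideal I" "p \<in> I" "q \<in> I" shows "(\<lambda>v. p v - q v) \<in> I"
proof -
  have "(\<lambda>v. (\<lambda>_. -1) v * q v) \<in> I"
    using assms by (intro pideal_mult) (auto intro: polys_intros)
  from pideal_add[OF assms(1,2) this] show ?thesis by simp
qed

lemma pideal_sum:
  assumes "pideal I" "\<And>c. c \<in> C \<Longrightarrow> p c \<in> I"
  shows "(\<lambda>v. \<Sum>c\<in>C. p c v) \<in> I"
  using assms(2)
  by (induction C rule: infinite_finite_induct)
     (use assms(1) in \<open>auto simp: pideal_def\<close>)

lemma pideal_one:
  assumes "pideal I" "(\<lambda>_. c) \<in> I" "c \<noteq> 0"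
  shows "(\<lambda>_. 1) \<in> I"
  using pideal_mult[OF assms(1) _ assms(2), of "\<lambda>_. 1 / c"] assms(3)
  by (auto intro: polys_intros)

lemma maximal_pideal_exists:
  fixes I :: "(complex^'n \<Rightarrow> complex) set"
  assumes "pideal I" "(\<lambda>_. 1) \<notin> I"
  shows "\<exists>m. pideal m \<and> I \<subseteq> m \<and> (\<lambda>_. 1) \<notin> m \<and>
    (\<forall>m'. pideal m' \<and> m \<subseteq> m' \<and> (\<lambda>_. 1) \<notin> m' \<longrightarrow> m' = m)"
proof -
  define A where "A = {m. pideal m \<and> I \<subseteq> m \<and> (\<lambda>_. 1) \<notin> m}"
  have "\<exists>M\<in>A. \<forall>X\<in>A. M \<subseteq> X \<longrightarrow> X = M"
  proof (rule subset_Zorn_nonempty)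
    show "A \<noteq> {}" using assms by (auto simp: A_def)
  next
    fix C assume C: "C \<noteq> {}" "subset.chain A C"
    have sub: "m \<in> A" if "m \<in> C" for m
      using C(2) that by (auto simp: subset.chain_def)
    have "pideal (\<Union>C)"
    proof (rule pidealI)
      fix p assume "p \<in> \<Union>C"
      then show "p \<in> polys" using sub pideal_polys by (fastforce simp: A_def)
    next
      show "(\<lambda>_. 0) \<in> \<Union>C" using C(1) sub by (auto simp: A_def pideal_def)
    next
      fix p q :: "complex^'n \<Rightarrow> complex" assume "p \<in> \<Union>C" "q \<in> \<Union>C"
      then obtain m m' where m: "m \<in> C" "m' \<in> C" "p \<in> m" "q \<in> m'" by auto
      then have "m \<subseteq> m' \<or> m' \<subseteq> m" using C(2) by (auto simp: subset.chain_def)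
      then obtain k where "k \<in> C" "p \<in> k" "q \<in> k" using m by auto
      then show "(\<lambda>v. p v + q v) \<in> \<Union>C"
        using sub[of k] by (auto simp: A_def intro: pideal_add)
    next
      fix a p :: "complex^'n \<Rightarrow> complex" assume "a \<in> polys" "p \<in> \<Union>C"
      then show "(\<lambda>v. a v * p v) \<in> \<Union>C"
        using sub pideal_mult by (auto simp: A_def) blast
    qed
    then show "\<Union>C \<in> A" using C(1) sub by (auto simp: A_def)
  qed
  then obtain M where "M \<in> A" "\<And>X. X \<in> A \<Longrightarrow> M \<subseteq> X \<Longrightarrow> X = M" by blast
  then show ?thesis unfolding A_def by (intro exI[of _ M]) blast
qed

text \<open>The ideal \<open>m'\<close> below is \<open>m + (p)\<close>. It is strictly larger than
  \<open>m\<close>, so it contains \<open>1\<close>: the quotient by a maximal ideal is a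
  field.\<close>

lemma maximal_pideal_inverse:
  fixes m :: "(complex^'n \<Rightarrow> complex) set"
  assumes m: "pideal m" "(\<lambda>_. 1) \<notin> m"
    and max: "\<And>m'. pideal m' \<Longrightarrow> m \<subseteq> m' \<Longrightarrow> (\<lambda>_. 1) \<notin> m' \<Longrightarrow> m' = m"
    and p: "p \<in> polys" "p \<notin> m"
  shows "\<exists>h\<in>polys. (\<lambda>v. 1 - h v * p v) \<in> m"
proof -
  define m' :: "(complex^'n \<Rightarrow> complex) set" where "m' = {f. \<exists>g\<in>m. \<exists>h\<in>polys. f = (\<lambda>v. g v + h v * p v)}"
  have 0: "(\<lambda>_. 0) \<in> m" "(\<lambda>_. 0) \<in> polys" "(\<lambda>_. 1) \<in> polys"
    using m by (auto simp: pideal_def intro: polys_intros)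
  have "pideal m'"
  proof (rule pidealI)
    fix f assume "f \<in> m'"
    then show "f \<in> polys"
      using p pideal_polys[OF m(1)] by (auto simp: m'_def intro!: polys_intros)
  next
    show "(\<lambda>_. 0) \<in> m'"
      using 0 by (auto simp: m'_def intro!: bexI[of _ "\<lambda>_. 0"])
  next
    fix f f' assume "f \<in> m'" "f' \<in> m'"
    then obtain g h g' h' where "g \<in> m" "g' \<in> m" "h \<in> polys" "h' \<in> polys"
      "f = (\<lambda>v. g v + h v * p v)" "f' = (\<lambda>v. g' v + h' v * p v)"
      by (auto simp: m'_def)
    then show "(\<lambda>v. f v + f' v) \<in> m'"
      unfolding m'_def
      by (intro CollectI bexI[of _ "\<lambda>v. g v + g' v"] bexI[of _ "\<lambda>v. h v + h' v"])
         (auto simp: algebra_simps intro: polys_intros pideal_add[OF m(1)])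
  next
    fix a f :: "complex^'n \<Rightarrow> complex" assume "a \<in> polys" "f \<in> m'"
    then obtain g h where "a \<in> polys" "g \<in> m" "h \<in> polys" "f = (\<lambda>v. g v + h v * p v)"
      by (auto simp: m'_def)
    then show "(\<lambda>v. a v * f v) \<in> m'"
      unfolding m'_def
      by (intro CollectI bexI[of _ "\<lambda>v. a v * g v"] bexI[of _ "\<lambda>v. a v * h v"])
         (auto simp: algebra_simps intro: polys_intros pideal_mult[OF m(1)])
  qed
  moreover have "m \<subseteq> m'"
  proof
    fix g assume "g \<in> m"
    then show "g \<in> m'"
      unfolding m'_def using 0 by (intro CollectI bexI[of _ g] bexI[of _ "\<lambda>_. 0"]) auto
  qed
  moreover have "p \<in> m'"
    unfolding m'_def using 0 by (intro CollectI bexI[of _ "\<lambda>_. 0"] bexI[of _ "\<lambda>_. 1"]) auto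
  ultimately have "(\<lambda>_. 1) \<in> m'" using max p by auto
  then obtain g h where gh: "g \<in> m" "h \<in> polys" "(\<lambda>_. 1) = (\<lambda>v. g v + h v * p v)"
    by (auto simp: m'_def)
  then have "g = (\<lambda>v. 1 - h v * p v)" by (metis add_diff_cancel_right')
  with gh show ?thesis by blast
qed

text \<open>
  Otherwise every \<open>v $ i - c\<close> has an inverse \<open>h c\<close> modulo the ideal. The polynomials have countable
  dimension, so these uncountably many inverses are linearly dependent, and clearing
  denominators in a dependency gives a nonzero polynomial in \<open>v $ i\<close> alone that lies in the ideal;
  it splits into linear factors.
\<close>

lemma maximal_pideal_coord:
  fixes m :: "(complex^'n::finite \<Rightarrow> complex) set"
  assumes m: "pideal m" "(\<lambda>_. 1) \<notin> m"
    and max: "\<And>m'. pideal m' \<Longrightarrow> m \<subseteq> m' \<Longrightarrow> (\<lambda>_. 1) \<notin> m' \<Longrightarrow> m' = m"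
  shows "\<exists>c. (\<lambda>v. v $ i - c) \<in> m"
proof (rule ccontr)
  assume "\<not> ?thesis"
  then have notin: "(\<lambda>v. v $ i - c) \<notin> m" for c by auto
  have "\<exists>h. h \<in> polys \<and> (\<lambda>v. 1 - h v * (v $ i - c)) \<in> m" for c
  proof -
    have "(\<lambda>v. v $ i - c) \<in> polys" by (intro polys_intros polys_coord)
    then show ?thesis using maximal_pideal_inverse[OF m max _ notin[of c]] by blast
  qed
  then obtain h where h: "\<And>c. h c \<in> polys" "\<And>c. (\<lambda>v. 1 - h c v * (v $ i - c)) \<in> m" by metis
  have cancel: "q \<in> m" if "q \<in> polys" "(\<lambda>v. (v $ i - c) * q v) \<in> m" for q c
  proof -
    have "(\<lambda>v. q v * (1 - h c v * (v $ i - c)) + h c v * ((v $ i - c) * q v)) \<in> m"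
      by (rule pideal_add[OF m(1) pideal_mult[OF m(1) that(1) h(2)] pideal_mult[OF m(1) h(1) that(2)]])
    then show ?thesis by (simp add: algebra_simps)
  qed
  have no_poly: "(\<lambda>v. poly Q (v $ i)) \<notin> m" if "Q \<noteq> 0" for Q
    using that
  proof (induction "degree Q" arbitrary: Q)
    case 0
    then obtain a where "Q = [:a:]" by (metis degree_eq_zeroE)
    then show ?case using pideal_one[OF m(1)] m(2) 0 by auto
  next
    case (Suc n)
    then have "\<not> constant (poly Q)" by (simp add: constant_degree)
    then obtain a where "poly Q a = 0" using fundamental_theorem_of_algebra by blast
    then obtain Q' where Q': "Q = [:-a, 1:] * Q'" by (metis poly_eq_0_iff_dvd dvdE)
    then have "Q' \<noteq> 0" using Suc by auto
    then have "degree Q' = n" using Suc.hyps(2) Q' degree_mult_eq[of "[:-a,1:]" Q'] by simp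
    then have *: "(\<lambda>v. poly Q' (v $ i)) \<notin> m" using Suc \<open>Q' \<noteq> 0\<close> by auto
    have "(\<lambda>v. poly Q' (v $ i)) \<in> polys"
      by (simp add: poly_altdef) (intro polys_intros polys_coord)
    then show ?case using * cancel[of "\<lambda>v. poly Q' (v $ i)" a] by (auto simp: Q' algebra_simps)
  qed
  \<comment> \<open>Injectivity turns infinitely many \<open>c\<close> into infinitely many
    different vectors. A common inverse of \<open>v $ i - c\<close> and \<open>v $ i - c'\<close>
    would satisfy \<open>(c - c') * h c \<in> m\<close>, and an invertible element cannot lie in
    \<open>m\<close>.\<close>
  have inj: "inj h"
  proof (rule injI, rule ccontr)
    fix c c' assume cc: "h c = h c'" "c \<noteq> c'"
    have "(\<lambda>v. (1 - h c v * (v $ i - c)) - (1 - h c' v * (v $ i - c'))) \<in> m"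
      by (rule pideal_diff[OF m(1) h(2) h(2)])
    then have *: "(\<lambda>v. (c - c') * h c v) \<in> m" using cc by (simp add: algebra_simps)
    have "(\<lambda>v. (v $ i - c) / (c - c')) \<in> polys"
      unfolding divide_inverse by (intro polys_intros polys_coord)
    from pideal_add[OF m(1) pideal_mult[OF m(1) this *] h(2)[of c]]
    have "(\<lambda>v. (v $ i - c) / (c - c') * ((c - c') * h c v) + (1 - h c v * (v $ i - c))) \<in> m" .
    moreover have "(v $ i - c) / (c - c') * ((c - c') * h c v) + (1 - h c v * (v $ i - c)) = 1" for v
      using cc(2) by simp
    ultimately show False using m(2) by simp
  qed
  \<comment> \<open>Pigeonhole: countably many finite sets cannot cover the complex numbers. More
    inverses than the dimension then lie in one space of bounded degree.\<close>
  have "\<exists>M. infinite {c. h c \<in> deg_span M}"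
  proof (rule ccontr)
    assume "\<not> ?thesis"
    then have "countable (\<Union>M. {c. h c \<in> deg_span M})" by (auto intro: countable_finite)
    moreover have "(\<Union>M. {c. h c \<in> deg_span M}) = UNIV"
      using polys_deg_span h(1) by blast
    ultimately show False using uncountable_UNIV_complex by simp
  qed
  then obtain M where M: "infinite {c. h c \<in> deg_span M}" ..
  define S where "S = (mon ` {xs. length xs \<le> M} :: (complex^'n \<Rightarrow> complex) set)"
  have finS: "finite S"
    using finite_lists_length_le[of "UNIV::'n set" M] by (simp add: S_def)
  obtain C where C: "C \<subseteq> {c. h c \<in> deg_span M}" "card C = Suc (card S)" "finite C"
    using infinite_arbitrarily_large[OF M] by metis
  have "card (h ` C) = Suc (card S)"
    using C inj by (simp add: card_image inj_on_subset)
  then have "fv.dependent (h ` C)"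
    using fv.independent_span_bound[OF finS, of "h ` C"] C(1)
    by (auto simp: deg_span_def S_def)
  then obtain u where u: "\<exists>c\<in>C. u (h c) \<noteq> 0" "(\<Sum>f\<in>h ` C. (\<lambda>v. u f * f v)) = 0"
    using fv.dependent_finite[of "h ` C"] C(3) by auto
  define b where "b = (\<lambda>c. u (h c))"
  obtain c0 where c0: "c0 \<in> C" "b c0 \<noteq> 0" using u by (auto simp: b_def)
  have sum_fun: "(\<Sum>f\<in>A. g f) v = (\<Sum>f\<in>A. g f v)"
    for A :: "complex set" and g :: "complex \<Rightarrow> complex^'n \<Rightarrow> complex" and v
    by (induction A rule: infinite_finite_induct) auto
  have b: "(\<Sum>c\<in>C. b c * h c v) = 0" for v
  proof -
    have "(\<Sum>f\<in>h ` C. (\<lambda>v. u f * f v)) = (\<Sum>c\<in>C. (\<lambda>v. b c * h c v))"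
      by (subst sum.reindex[OF inj_on_subset[OF inj subset_UNIV]]) (simp add: b_def comp_def)
    then have "(\<Sum>c\<in>C. (\<lambda>v. b c * h c v)) v = 0" using u(2) by simp
    then show ?thesis by (simp only: sum_fun)
  qed
  \<comment> \<open>\<open>Q\<close> is the numerator of the partial fraction sum of
    \<open>b c / (X - c)\<close>. At \<open>c0\<close> all summands but one contain a zero factor,
    so \<open>Q\<close> is nonzero.\<close>
  define Q where "Q = (\<Sum>c\<in>C. smult (b c) (\<Prod>c'\<in>C - {c}. [:-c', 1:]))"
  have "poly Q c0 = (\<Sum>c\<in>C. b c * (\<Prod>c'\<in>C - {c}. c0 - c'))"
    by (simp add: Q_def poly_sum poly_prod)
  also have "\<dots> = (\<Sum>c\<in>{c0}. b c * (\<Prod>c'\<in>C - {c}. c0 - c'))"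
    using c0 C(3) by (intro sum.mono_neutral_right) (auto simp: prod_zero_iff)
  finally have "poly Q c0 = b c0 * (\<Prod>c'\<in>C - {c0}. c0 - c')" by simp
  moreover have "(\<Prod>c'\<in>C - {c0}. c0 - c') \<noteq> 0" using C(3) by (simp add: prod_zero_iff)
  ultimately have "poly Q c0 \<noteq> 0" using c0 by simp
  then have "Q \<noteq> 0" by auto
  moreover have "(\<lambda>v. poly Q (v $ i)) \<in> m"
  proof -
    have fin: "(\<lambda>v. (b c * (\<Prod>c'\<in>C - {c}. v $ i - c')) * (1 - h c v * (v $ i - c))) \<in> m" for c
    proof (rule pideal_mult[OF m(1) _ h(2)])
      have "(\<lambda>v. \<Prod>c'\<in>A. v $ i - c') \<in> polys" for A
        by (induction A rule: infinite_finite_induct) (auto intro!: polys_intros polys_coord)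
      then show "(\<lambda>v. b c * (\<Prod>c'\<in>C - {c}. v $ i - c')) \<in> polys"
        by (intro polys_intros)
    qed
    have "poly Q (v $ i) = (\<Sum>c\<in>C. (b c * (\<Prod>c'\<in>C - {c}. v $ i - c')) * (1 - h c v * (v $ i - c)))" for v
    proof -
      have "(\<Sum>c\<in>C. (b c * (\<Prod>c'\<in>C - {c}. v $ i - c')) * (h c v * (v $ i - c)))
        = (\<Sum>c\<in>C. (\<Prod>c'\<in>C. v $ i - c') * (b c * h c v))"
        using C(3) by (intro sum.cong) (auto simp: prod.remove)
      also have "\<dots> = 0" using b by (simp flip: sum_distrib_left)
      finally show ?thesis
        by (simp add: Q_def poly_sum poly_prod right_diff_distrib sum_subtractf)
    qed
    then show ?thesis using pideal_sum[OF m(1) fin, where C = C] by simp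
  qed
  ultimately show False using no_poly by blast
qed

text \<open>Modulo a maximal ideal each coordinate is a constant \<open>c i\<close>, so every
  polynomial is congruent to its value at the point \<open>a\<close> with these coordinates. For a
  member of the ideal that value is a constant in \<open>m\<close>, hence zero.\<close>

lemma weak_nullstellensatz:
  fixes I :: "(complex^'n::finite \<Rightarrow> complex) set"
  assumes "pideal I" "(\<lambda>_. 1) \<notin> I"
  shows "\<exists>a. \<forall>p\<in>I. p a = 0"
proof -
  obtain m where m: "pideal m" "I \<subseteq> m" "(\<lambda>_. 1) \<notin> m"
    and max: "\<And>m'. pideal m' \<Longrightarrow> m \<subseteq> m' \<Longrightarrow> (\<lambda>_. 1) \<notin> m' \<Longrightarrow> m' = m"
    using maximal_pideal_exists[OF assms] by blast
  have "\<forall>i. \<exists>c. (\<lambda>v. v $ i - c) \<in> m"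
    using maximal_pideal_coord[OF m(1,3) max] by blast
  then obtain c where c: "\<And>i. (\<lambda>v. v $ i - c i) \<in> m" by metis
  define a where "a = (\<chi> i. c i)"
  have "p \<in> polys \<and> (\<lambda>v. p v - p a) \<in> m" if "p \<in> polys" for p
    using that unfolding polys_def
  proof (induction rule: alg_gen.induct)
    case (const c)
    then show ?case using m(1) by (auto simp: pideal_def intro: alg_gen.intros)
  next
    case (gen f)
    then show ?case using c by (auto simp: a_def intro: alg_gen.intros)
  next
    case (add f g)
    then have "(\<lambda>v. (f v - f a) + (g v - g a)) \<in> m" by (intro pideal_add[OF m(1)]) auto
    with add show ?case by (auto simp: algebra_simps intro: alg_gen.add)
  next
    case (mult f g)
    then have "(\<lambda>v. g v * (f v - f a) + f a * (g v - g a)) \<in> m"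
      by (intro pideal_add[OF m(1)] pideal_mult[OF m(1)]) (auto simp: polys_def intro: alg_gen.const)
    with mult show ?case by (auto simp: algebra_simps intro: alg_gen.mult)
  qed
  note * = this
  have "p a = 0" if "p \<in> I" for p
  proof (rule ccontr)
    assume "p a \<noteq> 0"
    have "p \<in> m" using that m by auto
    have "(\<lambda>v. p v - p a) \<in> m" using *[OF pideal_polys[OF m(1) \<open>p \<in> m\<close>]] by simp
    then have "(\<lambda>v. p v - (p v - p a)) \<in> m"
      by (rule pideal_diff[OF m(1) \<open>p \<in> m\<close>])
    then have "(\<lambda>v. p a) \<in> m" by simp
    then show False using pideal_one[OF m(1)] m(3) \<open>p a \<noteq> 0\<close> by auto
  qed
  then show ?thesis by blast
qed

text \<open>The finite combinations of generators in inductive form, so that a relation can be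
  rewritten one summand at a time.\<close>

inductive_set gen_ideal :: "(complex^'n \<Rightarrow> complex) set \<Rightarrow> (complex^'n \<Rightarrow> complex) set"
  for G :: "(complex^'n \<Rightarrow> complex) set" where
  zero: "(\<lambda>_. 0) \<in> gen_ideal G"
| step: "a \<in> polys \<Longrightarrow> g \<in> G \<Longrightarrow> p \<in> gen_ideal G \<Longrightarrow> (\<lambda>v. a v * g v + p v) \<in> gen_ideal G"

lemma gen_ideal_add:
  assumes "p \<in> gen_ideal G" "q \<in> gen_ideal G"
  shows "(\<lambda>v. p v + q v) \<in> gen_ideal G"
  using assms(1)
proof induction
  case (step a g p)
  then show ?case
    using gen_ideal.step[OF step(1,2,4)] by (simp add: algebra_simps)
qed (use assms(2) in auto)

lemma gen_ideal_mult:
  assumes "p \<in> gen_ideal G" "b \<in> polys"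
  shows "(\<lambda>v. b v * p v) \<in> gen_ideal G"
  using assms(1)
proof induction
  case (step a g p)
  have "(\<lambda>v. b v * a v) \<in> polys" using assms(2) step by (intro polys_intros)
  then show ?case
    using gen_ideal.step[OF _ step(2,4)] by (fastforce simp: algebra_simps)
qed (auto intro: gen_ideal.zero)

lemma pideal_gen_ideal:
  assumes "G \<subseteq> polys" shows "pideal (gen_ideal G)"
proof (rule pidealI)
  fix p assume "p \<in> gen_ideal G"
  then show "p \<in> polys" by induction (use assms in \<open>auto intro!: polys_intros\<close>)
qed (auto intro: gen_ideal_add gen_ideal_mult gen_ideal.zero)

lemma gen_ideal_subset: "pideal J \<Longrightarrow> G \<subseteq> J \<Longrightarrow> gen_ideal G \<subseteq> J"
proof
  fix p assume J: "pideal J" "G \<subseteq> J" and "p \<in> gen_ideal G"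
  from this(3) show "p \<in> J"
    by induction (use J in \<open>auto simp: pideal_def\<close>)
qed

text \<open>Each factor of degree one contributes at most one denominator \<open>x v\<close>, so a
  power \<open>K\<close> bounded independently of \<open>v\<close> clears all of them. Sums are
  brought to the common exponent \<open>K + L\<close>.\<close>

lemma polys_dehomogenise:
  assumes p: "p \<in> polys" and x: "x \<in> polys"
  shows "\<exists>K. \<exists>q\<in>polys. \<forall>v. x v \<noteq> 0 \<longrightarrow> x v ^ K * p ((1 / x v) *s v) = q v"
  using p unfolding polys_def
proof (induction rule: alg_gen.induct)
  case (const c)
  then show ?case by (intro exI[of _ 0] bexI[of _ "\<lambda>_. c"]) (auto intro: alg_gen.intros)
next
  case (gen f)
  then show ?case by (intro exI[of _ 1] bexI[of _ f]) (auto intro: alg_gen.gen)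
next
  case (add f g)
  then obtain K L q r where *: "q \<in> polys" "r \<in> polys"
    "\<forall>v. x v \<noteq> 0 \<longrightarrow> x v ^ K * f ((1 / x v) *s v) = q v"
    "\<forall>v. x v \<noteq> 0 \<longrightarrow> x v ^ L * g ((1 / x v) *s v) = r v" by (auto simp: polys_def)
  have "(\<lambda>v. x v ^ L * q v + x v ^ K * r v) \<in> polys"
    using * x by (intro polys_intros)
  moreover have "x v ^ (K + L) * (f ((1 / x v) *s v) + g ((1 / x v) *s v))
      = x v ^ L * q v + x v ^ K * r v" if "x v \<noteq> 0" for v
  proof -
    have "x v ^ L * q v + x v ^ K * r v
      = x v ^ L * (x v ^ K * f ((1 / x v) *s v)) + x v ^ K * (x v ^ L * g ((1 / x v) *s v))"
      using *(3,4) that by simp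
    then show ?thesis by (simp add: algebra_simps power_add)
  qed
  ultimately show ?case
    unfolding polys_def by (intro exI[of _ "K + L"] bexI[of _ "\<lambda>v. x v ^ L * q v + x v ^ K * r v"]) auto
next
  case (mult f g)
  then obtain K L q r where *: "q \<in> polys" "r \<in> polys"
    "\<forall>v. x v \<noteq> 0 \<longrightarrow> x v ^ K * f ((1 / x v) *s v) = q v"
    "\<forall>v. x v \<noteq> 0 \<longrightarrow> x v ^ L * g ((1 / x v) *s v) = r v" by (auto simp: polys_def)
  have "(\<lambda>v. q v * r v) \<in> polys" using * by (intro polys_intros)
  moreover have "x v ^ (K + L) * (f ((1 / x v) *s v) * g ((1 / x v) *s v)) = q v * r v"
    if "x v \<noteq> 0" for v
  proof -
    have "q v * r v = (x v ^ K * f ((1 / x v) *s v)) * (x v ^ L * g ((1 / x v) *s v))"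
      using *(3,4) that by simp
    then show ?thesis by (simp add: power_add)
  qed
  ultimately show ?case
    unfolding polys_def by (intro exI[of _ "K + L"] bexI[of _ "\<lambda>v. q v * r v"]) auto
qed

text \<open>A homogeneous generator reproduces itself under \<open>v / x v\<close> up to a power of
  \<open>x v\<close>. Clearing denominators therefore keeps a combination of the generators inside
  their ideal.\<close>

lemma gen_ideal_dehomogenise:
  assumes p: "p \<in> gen_ideal G" and x: "x \<in> polys" and G: "\<And>g. g \<in> G \<Longrightarrow> \<exists>D. homog D g"
  shows "\<exists>K. \<exists>q\<in>gen_ideal G. \<forall>v. x v \<noteq> 0 \<longrightarrow> x v ^ K * p ((1 / x v) *s v) = q v"
  using p
proof induction
  case zero
  then show ?case by (intro exI[of _ 0] bexI[of _ "\<lambda>_. 0"]) (auto intro: gen_ideal.zero)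
next
  case (step a g p)
  obtain K q where q: "q \<in> gen_ideal G" "\<And>v. x v \<noteq> 0 \<Longrightarrow> x v ^ K * p ((1 / x v) *s v) = q v"
    using step.IH by auto
  obtain L b where b: "b \<in> polys" "\<And>v. x v \<noteq> 0 \<Longrightarrow> x v ^ L * a ((1 / x v) *s v) = b v"
    using polys_dehomogenise[OF step(1) x] by auto
  obtain D where D: "homog D g" using G step(2) by auto
  have g: "x v ^ D * g ((1 / x v) *s v) = g v" if "x v \<noteq> 0" for v
    using D that by (simp add: homog_def power_divide)
  let ?q = "\<lambda>v. (x v ^ K * b v) * g v + x v ^ (L + D) * q v"
  have "?q \<in> gen_ideal G"
    using b q x step by (intro gen_ideal.step gen_ideal_mult polys_intros)
  moreover have "x v ^ (K + L + D) * (a ((1 / x v) *s v) * g ((1 / x v) *s v) + p ((1 / x v) *s v)) = ?q v"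
    if "x v \<noteq> 0" for v
  proof -
    have "?q v = x v ^ K * (x v ^ L * a ((1 / x v) *s v)) * (x v ^ D * g ((1 / x v) *s v))
      + x v ^ (L + D) * (x v ^ K * p ((1 / x v) *s v))"
      by (simp only: b(2)[OF that] q(2)[OF that] g[OF that])
    then show ?thesis by (simp add: algebra_simps power_add)
  qed
  ultimately show ?case by (intro exI[of _ "K + L + D"] bexI[of _ ?q]) auto
qed

text \<open>
  The generators and \<open>x - 1\<close> have no common zero; a relation between them is turned into a
  homogeneous one by substituting \<open>v / x v\<close>.
\<close>

lemma homogeneous_nullstellensatz:
  fixes J :: "(complex^'n::finite \<Rightarrow> complex) set"
  assumes G: "\<And>g. g \<in> G \<Longrightarrow> \<exists>D. homog D g" "\<And>v. v \<noteq> 0 \<Longrightarrow> \<exists>g\<in>G. g v \<noteq> 0"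
    and J: "pideal J" "G \<subseteq> J" and x: "homog 1 x"
  shows "\<exists>K. (\<lambda>v. x v ^ K) \<in> J"
proof -
  have xp: "x \<in> polys" using x by (simp add: homog_def)
  have x0: "x 0 = 0" using x by (auto simp: homog_def dest: spec[of _ 0])
  have Gp: "G \<subseteq> polys" using G(1) by (auto simp: homog_def)
  define I where "I = {f. \<exists>p\<in>gen_ideal G. \<exists>b\<in>polys. f = (\<lambda>v. p v + b v * (x v - 1))}"
  have 0: "(\<lambda>_. 0) \<in> gen_ideal G" "(\<lambda>_. 0) \<in> polys" "(\<lambda>_. 1) \<in> polys"
    by (auto intro: polys_intros gen_ideal.zero)
  have I_mem: "(\<lambda>v. p v + b v * (x v - 1)) \<in> I" if "p \<in> gen_ideal G" "b \<in> polys" for p b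
    unfolding I_def using that by auto
  have I: "pideal I"
  proof (rule pidealI)
    fix f assume "f \<in> I"
    then show "f \<in> polys"
      using xp pideal_polys[OF pideal_gen_ideal[OF Gp]] by (auto simp: I_def intro!: polys_intros)
  next
    show "(\<lambda>_. 0) \<in> I" using 0 by (auto simp: I_def intro!: bexI[of _ "\<lambda>_. 0"])
  next
    fix f f' assume "f \<in> I" "f' \<in> I"
    then obtain g h g' h' where "g \<in> gen_ideal G" "g' \<in> gen_ideal G" "h \<in> polys" "h' \<in> polys"
      "f = (\<lambda>v. g v + h v * (x v - 1))" "f' = (\<lambda>v. g' v + h' v * (x v - 1))"
      by (auto simp: I_def)
    then show "(\<lambda>v. f v + f' v) \<in> I"
      unfolding I_def
      by (intro CollectI bexI[of _ "\<lambda>v. g v + g' v"] bexI[of _ "\<lambda>v. h v + h' v"])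
         (auto simp: algebra_simps intro: polys_intros gen_ideal_add)
  next
    fix a f :: "complex^'n \<Rightarrow> complex" assume "a \<in> polys" "f \<in> I"
    then obtain g h where "a \<in> polys" "g \<in> gen_ideal G" "h \<in> polys" "f = (\<lambda>v. g v + h v * (x v - 1))"
      by (auto simp: I_def)
    then show "(\<lambda>v. a v * f v) \<in> I"
      unfolding I_def
      by (intro CollectI bexI[of _ "\<lambda>v. a v * g v"] bexI[of _ "\<lambda>v. a v * h v"])
         (auto simp: algebra_simps intro: polys_intros gen_ideal_mult)
  qed
  have "(\<lambda>_. 1) \<in> I"
  proof (rule ccontr)
    assume "(\<lambda>_. 1) \<notin> I"
    then obtain a where a: "\<And>p. p \<in> I \<Longrightarrow> p a = 0" using weak_nullstellensatz[OF I] by blast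
    have "(\<lambda>v. 0 + 1 * (x v - 1)) \<in> I" using I_mem 0 by blast
    then have "x a = 1" using a by force
    then have "a \<noteq> 0" using x0 by auto
    then obtain g where g: "g \<in> G" "g a \<noteq> 0" using G by auto
    have "(\<lambda>v. 1 * g v + 0) \<in> gen_ideal G" using g 0 by (intro gen_ideal.step) 
    then have "(\<lambda>v. (1 * g v + 0) + 0 * (x v - 1)) \<in> I" by (intro I_mem \<open>(\<lambda>v. 1 * g v + 0) \<in> gen_ideal G\<close> 0)
    then show False using a g by force
  qed
  then obtain p b where p: "p \<in> gen_ideal G" "(\<lambda>_. 1) = (\<lambda>v. p v + b v * (x v - 1))"
    by (auto simp: I_def)
  obtain K q where q: "q \<in> gen_ideal G" "\<And>v. x v \<noteq> 0 \<Longrightarrow> x v ^ K * p ((1 / x v) *s v) = q v"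
    using gen_ideal_dehomogenise[OF p(1) xp G(1)] by blast
  \<comment> \<open>The extra factor makes both sides zero where \<open>x v = 0\<close>; there the
    substitution \<open>v / x v\<close> gives no information.\<close>
  have "x v ^ Suc K = x v * q v" for v
  proof (cases "x v = 0")
    case False
    let ?v = "(1 / x v) *s v"
    have "x ?v = 1" using x False by (simp add: homog_def)
    then have "p ?v = 1" using fun_cong[OF p(2), of ?v] by simp
    then show ?thesis using q(2)[OF False] by simp
  qed auto
  then have "(\<lambda>v. x v ^ Suc K) = (\<lambda>v. x v * q v)" by auto
  also have "\<dots> \<in> J"
    using gen_ideal_subset[OF J] q(1) xp by (intro pideal_mult[OF J(1)]) auto
  finally show ?thesis by blast
qed

section \<open>Restriction of polynomials to lines\<close>

text \<open>Its coefficients are the Taylor coefficients of \<open>p\<close> at \<open>v\<close> in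
  direction \<open>w\<close>: index \<open>1\<close> is the differential, index \<open>2\<close> is
  half the second derivative. The description is meaningful for polynomial \<open>p\<close>, by
  \<open>polyI\<close> and \<open>line_poly_pfam\<close>.\<close>

definition line_poly :: "(complex^'n \<Rightarrow> complex) \<Rightarrow> complex^'n \<Rightarrow> complex^'n \<Rightarrow> complex poly" where
  "line_poly p v w = (THE P. \<forall>t. poly P t = p (v + t *s w))"

lemma line_poly_eqI:
  assumes "\<And>t. poly P t = p (v + t *s w)"
  shows "line_poly p v w = P"
  unfolding line_poly_def using assms by (intro the_equality) (auto intro: polyI)

lemma line_poly_pfam:
  assumes "p \<in> polys"
  shows "pfam pair_coords (\<lambda>s. line_poly p (fst s) (snd s))" and "poly (line_poly p v w) t = p (v + t *s w)"
proof -
  have "\<exists>P. pfam pair_coords P \<and> (\<forall>t s. poly (P s) t = p (fst s + t *s snd s))"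
    using assms unfolding polys_def
  proof (rule alg_gen_pfam)
    fix b :: "complex^'n \<Rightarrow> complex" assume "b \<in> range (\<lambda>i v. v $ i)"
    then obtain i where "b = (\<lambda>v. v $ i)" by auto
    then show "\<exists>f g. f \<in> alg_gen pair_coords \<and> g \<in> alg_gen pair_coords \<and>
        (\<forall>t s. b (fst s + t *s snd s) = f s + t * g s)"
      by (intro exI[of _ "\<lambda>s. fst s $ i"] exI[of _ "\<lambda>s. snd s $ i"]) (auto intro: alg_gen.gen)
  qed
  then obtain P where P: "pfam pair_coords P" "\<And>t s. poly (P s) t = p (fst s + t *s snd s)" by blast
  have eq: "line_poly p (fst s) (snd s) = P s" for s by (rule line_poly_eqI) (use P in simp)
  then show "pfam pair_coords (\<lambda>s. line_poly p (fst s) (snd s))" using P(1) by simp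
  show "poly (line_poly p v w) t = p (v + t *s w)" using eq[of "(v, w)"] P(2)[of "(v, w)"] by simp
qed

lemmas poly_line_poly = line_poly_pfam(2)

lemma coeff_line_poly_pair_polys:
  "p \<in> polys \<Longrightarrow> (\<lambda>s. coeff (line_poly p (fst s) (snd s)) k) \<in> pair_polys"
  unfolding pair_polys_def by (rule pfamD[OF line_poly_pfam(1)])

lemma dir_deriv_line_poly:
  assumes "p \<in> polys"
  shows "dir_deriv p v w = coeff (line_poly p v w) 1"
proof -
  have "((\<lambda>t. poly (line_poly p v w) t) has_field_derivative poly (pderiv (line_poly p v w)) 0) (at 0)"
    by (rule poly_DERIV)
  then have "deriv (\<lambda>t. p (v + t *s w)) 0 = poly (pderiv (line_poly p v w)) 0"
    by (simp add: DERIV_imp_deriv poly_line_poly[OF assms])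
  then show ?thesis by (simp add: dir_deriv_def poly_0_coeff_0 coeff_pderiv)
qed

lemma line_poly_add: "p \<in> polys \<Longrightarrow> q \<in> polys \<Longrightarrow> line_poly (\<lambda>v. p v + q v) v w = line_poly p v w + line_poly q v w"
  by (rule line_poly_eqI) (simp add: poly_line_poly)

lemma line_poly_mult: "p \<in> polys \<Longrightarrow> q \<in> polys \<Longrightarrow> line_poly (\<lambda>v. p v * q v) v w = line_poly p v w * line_poly q v w"
  by (rule line_poly_eqI) (simp add: poly_line_poly)

lemma coeff_line_poly_0: "p \<in> polys \<Longrightarrow> coeff (line_poly p v w) 0 = p v"
  by (simp add: poly_line_poly flip: poly_0_coeff_0)

text \<open>Linearity of the derivative in the direction is read off from this form. The induction
  follows the sum and product rules, carrying polynomiality of the partial derivatives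
  along.\<close>

lemma dir_deriv_gradient:
  fixes p :: "complex^'n::finite \<Rightarrow> complex"
  assumes "p \<in> polys"
  shows "\<exists>G. (\<forall>j. G j \<in> polys) \<and> (\<forall>v w. dir_deriv p v w = (\<Sum>j\<in>UNIV. G j v * w $ j))"
proof -
  have "p \<in> polys \<and> (\<exists>G. (\<forall>j. G j \<in> polys) \<and> (\<forall>v w. coeff (line_poly p v w) 1 = (\<Sum>j\<in>UNIV. G j v * w $ j)))"
    using assms unfolding polys_def
  proof (induction rule: alg_gen.induct)
    case (const c)
    have "line_poly (\<lambda>_. c) v w = [:c:]" for v w :: "complex^'n" by (rule line_poly_eqI) simp
    then show ?case by (auto intro!: exI[of _ "\<lambda>_ _. 0"] intro: alg_gen.const)
  next
    case (gen f)
    then obtain i where f: "f = (\<lambda>v. v $ i)" by auto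
    have "line_poly f v w = [:v $ i, w $ i:]" for v w by (rule line_poly_eqI) (simp add: f)
    moreover have "w $ i = (\<Sum>j\<in>UNIV. (if j = i then 1 else 0) * w $ j)" for w :: "complex^'n"
      by (simp add: if_distrib[of "\<lambda>a. a * _"] cong: if_cong)
    ultimately show ?case using gen
      by (auto intro!: exI[of _ "\<lambda>j _. if j = i then 1 else 0"] intro: alg_gen.intros)
  next
    case (add f g)
    then obtain G H where *: "\<forall>j. G j \<in> polys" "\<forall>j. H j \<in> polys"
      "\<forall>v w. coeff (line_poly f v w) 1 = (\<Sum>j\<in>UNIV. G j v * w $ j)"
      "\<forall>v w. coeff (line_poly g v w) 1 = (\<Sum>j\<in>UNIV. H j v * w $ j)" "f \<in> polys" "g \<in> polys"
      unfolding polys_def by auto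
    then have "coeff (line_poly (\<lambda>v. f v + g v) v w) 1 = (\<Sum>j\<in>UNIV. (G j v + H j v) * w $ j)" for v w
      by (simp add: line_poly_add algebra_simps sum.distrib)
    moreover have "(\<lambda>v. G j v + H j v) \<in> polys" for j using * by (intro polys_intros) auto
    ultimately show ?case using add unfolding polys_def
      by (auto intro!: exI[of _ "\<lambda>j v. G j v + H j v"] intro: alg_gen.add)
  next
    case (mult f g)
    then obtain G H where *: "\<forall>j. G j \<in> polys" "\<forall>j. H j \<in> polys"
      "\<forall>v w. coeff (line_poly f v w) 1 = (\<Sum>j\<in>UNIV. G j v * w $ j)"
      "\<forall>v w. coeff (line_poly g v w) 1 = (\<Sum>j\<in>UNIV. H j v * w $ j)" "f \<in> polys" "g \<in> polys"
      unfolding polys_def by auto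
    then have "coeff (line_poly (\<lambda>v. f v * g v) v w) 1 = (\<Sum>j\<in>UNIV. (f v * H j v + g v * G j v) * w $ j)" for v w
      by (simp add: line_poly_mult coeff_mult coeff_line_poly_0 algebra_simps sum.distrib sum_distrib_left)
    moreover have "(\<lambda>v. f v * H j v + g v * G j v) \<in> polys" for j using * by (intro polys_intros) auto
    ultimately show ?case using mult unfolding polys_def
      by (auto intro!: exI[of _ "\<lambda>j v. f v * H j v + g v * G j v"] intro: alg_gen.mult)
  qed
  then show ?thesis by (simp add: dir_deriv_line_poly)
qed

lemma dir_deriv_add:
  assumes "p \<in> polys" shows "dir_deriv p v (w + w') = dir_deriv p v w + dir_deriv p v w'"
proof -
  obtain G where "\<And>v w. dir_deriv p v w = (\<Sum>j\<in>UNIV. G j v * w $ j)"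
    using dir_deriv_gradient[OF assms] by auto
  then show ?thesis by (simp add: algebra_simps sum.distrib)
qed

lemma dir_deriv_scale:
  assumes "p \<in> polys" shows "dir_deriv p v (c *s w) = c * dir_deriv p v w"
proof -
  obtain G where "\<And>v w. dir_deriv p v w = (\<Sum>j\<in>UNIV. G j v * w $ j)"
    using dir_deriv_gradient[OF assms] by auto
  then show ?thesis by (simp add: algebra_simps sum_distrib_left)
qed

lemma dir_deriv_diff:
  assumes "p \<in> polys" shows "dir_deriv p v (w - w') = dir_deriv p v w - dir_deriv p v w'"
proof -
  obtain G where "\<And>v w. dir_deriv p v w = (\<Sum>j\<in>UNIV. G j v * w $ j)"
    using dir_deriv_gradient[OF assms] by auto
  then show ?thesis by (simp add: algebra_simps sum_subtractf)
qed

lemma dir_deriv_sum_axis: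
  assumes "p \<in> polys" shows "dir_deriv p v w = (\<Sum>j\<in>UNIV. dir_deriv p v (axis j 1) * w $ j)"
proof -
  obtain G where G: "\<And>v w. dir_deriv p v w = (\<Sum>j\<in>UNIV. G j v * w $ j)"
    using dir_deriv_gradient[OF assms] by auto
  have "dir_deriv p v (axis j 1) = G j v" for j
    by (simp add: G axis_def if_distrib[of "\<lambda>a. _ * a"] cong: if_cong)
  then show ?thesis by (simp add: G)
qed

lemma dir_deriv_pair_polys: "p \<in> polys \<Longrightarrow> (\<lambda>s. dir_deriv p (fst s) (snd s)) \<in> pair_polys"
  using coeff_line_poly_pair_polys[of p 1] by (simp add: dir_deriv_line_poly)

lemma dir_deriv_polys: "p \<in> polys \<Longrightarrow> (\<lambda>v. dir_deriv p v w) \<in> polys"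
  using pair_polys_at[OF dir_deriv_pair_polys] by simp

lemma dir_deriv_mult:
  assumes "p \<in> polys" "q \<in> polys"
  shows "dir_deriv (\<lambda>v. p v * q v) v w = dir_deriv p v w * q v + p v * dir_deriv q v w"
proof -
  have "(\<lambda>v. p v * q v) \<in> polys" using assms by (intro polys_intros)
  then show ?thesis using assms by (simp add: dir_deriv_line_poly line_poly_mult coeff_mult coeff_line_poly_0)
qed

section \<open>Homogeneous polynomials: Taylor coefficients, Euler's formula, components\<close>

lemma homogI:
  assumes p: "p \<in> polys" and "\<And>c v. c \<noteq> 0 \<Longrightarrow> p (c *s v) = c ^ k * p v"
  shows "homog k p"
  unfolding homog_def
proof (intro conjI allI)
  fix c v
  have "line_poly p 0 v = smult (p v) (monom 1 k)"
    by (rule poly_eq_if_eq_nonzero) (use assms in \<open>simp add: poly_line_poly[OF p] poly_monom\<close>)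
  then have "poly (line_poly p 0 v) c = p v * c ^ k" by (simp add: poly_monom)
  then show "p (c *s v) = c ^ k * p v" by (simp add: poly_line_poly[OF p])
qed (use p in auto)

lemma homog_polys: "homog k p \<Longrightarrow> p \<in> polys"
  by (simp add: homog_def)

lemma homog_scale: "homog k p \<Longrightarrow> p (c *s v) = c ^ k * p v"
  by (simp add: homog_def)

lemma homog_mult: "homog k p \<Longrightarrow> homog l q \<Longrightarrow> homog (k + l) (\<lambda>v. p v * q v)"
  by (auto simp: homog_def power_add intro: polys_intros)

lemma homog_const: "homog 0 (\<lambda>_. c)"
  by (auto simp: homog_def intro: polys_intros)

lemma homog_coord: "homog 1 (\<lambda>v. v $ i)"
  by (auto simp: homog_def intro: polys_coord)

lemma line_poly_homog_scale:
  assumes "homog k p"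
  shows "line_poly p (c *s v) (c *s w) = smult (c ^ k) (line_poly p v w)"
proof (rule line_poly_eqI)
  fix t
  have "c *s v + t *s (c *s w) = c *s (v + t *s w)"
    by (simp add: vec_eq_iff algebra_simps)
  then show "poly (smult (c ^ k) (line_poly p v w)) t = p (c *s v + t *s (c *s w))"
    using assms by (simp only: poly_smult poly_line_poly homog_polys homog_scale)
qed

lemma coeff_line_poly_scale_snd:
  assumes "p \<in> polys"
  shows "coeff (line_poly p v (c *s w)) k = c ^ k * coeff (line_poly p v w) k"
proof -
  have "line_poly p v (c *s w) = pcompose (line_poly p v w) [:0, c:]"
    by (rule line_poly_eqI) (simp add: poly_pcompose poly_line_poly[OF assms] mult.commute)
  then show ?thesis by (simp add: coeff_pcompose_linear)
qed

text \<open>Scaling \<open>v\<close> and \<open>w\<close> together gives the factor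
  \<open>c ^ d\<close>, scaling \<open>w\<close> alone gives \<open>c ^ k\<close>; the quotient is
  the degree in \<open>v\<close>. The cancellation needs \<open>c \<noteq> 0\<close>, and
  \<open>homogI\<close> recovers \<open>c = 0\<close>, as both sides are polynomial in
  \<open>c\<close>.\<close>

lemma coeff_line_poly_scale_fst:
  fixes p :: "complex^'n \<Rightarrow> complex"
  assumes p: "homog d p" and k: "k \<le> d"
  shows "coeff (line_poly p (c *s v) w) k = c ^ (d - k) * coeff (line_poly p v w) k"
proof -
  have "homog (d - k) (\<lambda>v. coeff (line_poly p v w) k)"
  proof (rule homogI)
    show "(\<lambda>v. coeff (line_poly p v w) k) \<in> polys"
      using pair_polys_at[OF coeff_line_poly_pair_polys[OF homog_polys[OF p]]] by simp
  next
    fix c :: complex and v :: "complex^'n" assume "c \<noteq> 0"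
    have "coeff (line_poly p (c *s v) (c *s w)) k = c ^ d * coeff (line_poly p v w) k"
      using line_poly_homog_scale[OF p] by simp
    then have "c ^ k * coeff (line_poly p (c *s v) w) k = c ^ k * (c ^ (d - k) * coeff (line_poly p v w) k)"
      using k by (simp add: coeff_line_poly_scale_snd homog_polys[OF p] flip: mult.assoc power_add)
    then show "coeff (line_poly p (c *s v) w) k = c ^ (d - k) * coeff (line_poly p v w) k"
      using \<open>c \<noteq> 0\<close> by simp
  qed
  then show ?thesis by (rule homog_scale)
qed

lemma homog_dir_deriv:
  assumes "homog d p" "d \<ge> 1" shows "homog (d - 1) (\<lambda>v. dir_deriv p v w)"
  unfolding homog_def
proof (intro conjI allI)
  show "(\<lambda>v. dir_deriv p v w) \<in> polys" by (rule dir_deriv_polys[OF homog_polys[OF assms(1)]])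
  show "dir_deriv p (c *s v) w = c ^ (d - 1) * dir_deriv p v w" for c v
    using coeff_line_poly_scale_fst[OF assms] by (simp only: dir_deriv_line_poly homog_polys[OF assms(1)])
qed

lemma coeff_monom_one_mult: "coeff (monom 1 a * p) n = (if n < a then 0 else coeff (p::complex poly) (n - a))"
  by (simp add: coeff_monom_mult)

text \<open>Since \<open>p (v + t w) = t ^ d * p (w + (1/t) v)\<close>, the coefficients come in reverse order.\<close>

lemma coeff_line_poly_swap:
  assumes p: "homog d p"
  shows "coeff (line_poly p v w) k = (if k \<le> d then coeff (line_poly p w v) (d - k) else 0)"
proof -
  let ?L = "line_poly p v w" and ?L' = "line_poly p w v"
  let ?D = "degree ?L'"
  have "monom 1 ?D * ?L = monom 1 d * reflect_poly ?L'"
  proof (rule poly_eq_if_eq_nonzero)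
    fix t :: complex assume "t \<noteq> 0"
    then have "v + t *s w = t *s (w + inverse t *s v)" by (simp add: vec_eq_iff algebra_simps)
    then have "poly ?L t = t ^ d * poly ?L' (inverse t)"
      using p by (simp only: poly_line_poly homog_polys homog_scale)
    then show "poly (monom 1 ?D * ?L) t = poly (monom 1 d * reflect_poly ?L') t"
      using \<open>t \<noteq> 0\<close> by (simp add: poly_monom poly_reflect_poly_nz)
  qed
  then have "coeff (monom 1 ?D * ?L) (k + ?D) = coeff (monom 1 d * reflect_poly ?L') (k + ?D)" by simp
  then show ?thesis
    by (auto simp: coeff_monom_one_mult coeff_reflect_poly coeff_eq_0 split: if_splits)
qed

lemma degree_line_poly: "homog d p \<Longrightarrow> degree (line_poly p v w) \<le> d"
  by (rule degree_le) (auto simp: coeff_line_poly_swap[where p = p and v = v])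

lemma coeff_line_poly_top: "homog d p \<Longrightarrow> coeff (line_poly p v w) d = p w"
  using coeff_line_poly_swap[of d p v w d] coeff_line_poly_0[of p w v] homog_polys[of d p] by simp

text \<open>On the line through \<open>v\<close> in its own direction, \<open>p\<close> restricts to
  \<open>(1 + t) ^ d * p v\<close>, whose derivative at \<open>0\<close> is explicit.\<close>

lemma euler:
  assumes p: "homog d p" shows "dir_deriv p v v = of_nat d * p v"
proof -
  have "line_poly p v v = smult (p v) ([:1, 1:] ^ d)"
  proof (rule line_poly_eqI)
    fix t
    have "v + t *s v = (1 + t) *s v" by (simp add: vec_eq_iff algebra_simps)
    then show "poly (smult (p v) ([:1, 1:] ^ d)) t = p (v + t *s v)"
      using p by (simp only: homog_scale) (simp add: poly_power)
  qed
  moreover have "dir_deriv p v v = poly (pderiv (line_poly p v v)) 0"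
    by (simp add: dir_deriv_line_poly homog_polys[OF p] poly_0_coeff_0 coeff_pderiv)
  ultimately show ?thesis
    by (simp add: pderiv_smult pderiv_power pderiv_pCons poly_power)
qed

text \<open>The component of degree \<open>k\<close>, isolated as the coefficient of
  \<open>t ^ k\<close> in \<open>p (t *s v)\<close>.\<close>

definition hom_part :: "(complex^'n \<Rightarrow> complex) \<Rightarrow> nat \<Rightarrow> complex^'n \<Rightarrow> complex" where
  "hom_part p k v = coeff (line_poly p 0 v) k"

lemma homog_hom_part:
  assumes "p \<in> polys" shows "homog k (hom_part p k)"
proof -
  have "(\<lambda>v. coeff (line_poly p 0 v) k) \<in> polys"
    using pair_polys_at_fst[OF coeff_line_poly_pair_polys[OF assms, of k], of 0] by simp
  then show ?thesis by (auto simp: homog_def hom_part_def[abs_def] coeff_line_poly_scale_snd[OF assms])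
qed

lemma sum_hom_part:
  assumes "p \<in> polys" shows "\<exists>M. \<forall>v. p v = (\<Sum>k\<le>M. hom_part p k v)"
proof -
  obtain M where "\<And>s. degree (line_poly p (fst s) (snd s)) \<le> M"
    using line_poly_pfam(1)[OF assms] by (auto simp: pfam_def)
  then have M: "degree (line_poly p 0 v) \<le> M" for v by (metis fst_conv snd_conv)
  have "p v = (\<Sum>k\<le>M. hom_part p k v)" for v
    using poly_eq_sum[OF M, of v 1] by (simp add: poly_line_poly[OF assms] hom_part_def)
  then show ?thesis by blast
qed

lemma nonzero_point_on_line:
  fixes v w :: "complex^'n"
  assumes p: "p \<in> polys" "p v \<noteq> 0" and q: "q \<in> polys" "q w \<noteq> 0"
  shows "\<exists>t. p (v + t *s (w - v)) * q (v + t *s (w - v)) \<noteq> 0"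
proof -
  have "poly (line_poly p v (w - v)) 0 \<noteq> 0" "poly (line_poly q v (w - v)) 1 \<noteq> 0"
    using assms by (auto simp: poly_line_poly)
  then have "line_poly p v (w - v) * line_poly q v (w - v) \<noteq> 0" by auto
  then obtain t where "poly (line_poly p v (w - v) * line_poly q v (w - v)) t \<noteq> 0" 
    using poly_all_0_iff_0 by blast
  then show ?thesis using assms by (auto simp: poly_line_poly)
qed

text \<open>On a set closed under joining lines, two polynomials that are somewhere nonzero stay
  nonzero on the line joining the two witnesses, hence have a common nonzero point there.
  \<open>T\<close> will be the whole space or a tangent space.\<close>

lemma polys_mult_eq_0:
  fixes p q :: "complex^'n \<Rightarrow> complex"
  assumes p: "p \<in> polys" and q: "q \<in> polys"
    and T: "\<And>v w t. v \<in> T \<Longrightarrow> w \<in> T \<Longrightarrow> v + t *s (w - v) \<in> T"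
    and pq: "\<And>v. v \<in> T \<Longrightarrow> p v * q v = 0" and v: "v \<in> T" "p v \<noteq> 0" and w: "w \<in> T"
  shows "q w = 0"
  using nonzero_point_on_line[OF p v(2) q, of w] T[OF v(1) w] pq by blast

section \<open>Regular sequences of coordinates\<close>

definition coord_dir :: "(complex^'n \<Rightarrow> complex) \<Rightarrow> complex^'n \<Rightarrow> bool" where
  "coord_dir l u \<longleftrightarrow> l \<in> polys \<and> (\<forall>v t. l (v + t *s u) = l v + t)"

definition invariant :: "complex^'n \<Rightarrow> ((complex^'n) \<times> (complex^'n) \<Rightarrow> complex) \<Rightarrow> bool" where
  "invariant u q \<longleftrightarrow> (\<forall>v w t. q (v + t *s u, w) = q (v, w))"

text \<open>For a coordinate \<open>l\<close> along \<open>u\<close> this is the expansion of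
  \<open>p\<close> in powers of \<open>l\<close>: the first vector is moved along \<open>u\<close>
  to the point where \<open>l\<close> takes the value \<open>t\<close>, and
  \<open>t = l (fst s)\<close> gives \<open>p s\<close> back.\<close>

definition dir_poly :: "(complex^'n \<Rightarrow> complex) \<Rightarrow> complex^'n \<Rightarrow>
    ((complex^'n) \<times> (complex^'n) \<Rightarrow> complex) \<Rightarrow> (complex^'n) \<times> (complex^'n) \<Rightarrow> complex poly" where
  "dir_poly l u p s = (THE P. \<forall>t. poly P t = p (fst s + (t - l (fst s)) *s u, snd s))"

lemma dir_poly_eqI:
  assumes "\<And>t. poly P t = p (fst s + (t - l (fst s)) *s u, snd s)"
  shows "dir_poly l u p s = P"
  unfolding dir_poly_def using assms by (intro the_equality) (auto intro: polyI)

lemma dir_poly_pfam: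
  fixes p :: "(complex^'n) \<times> (complex^'n) \<Rightarrow> complex"
  assumes p: "p \<in> pair_polys" and l: "l \<in> polys"
  shows "pfam pair_coords (dir_poly l u p)"
    and "poly (dir_poly l u p s) t = p (fst s + (t - l (fst s)) *s u, snd s)"
proof -
  have "\<exists>P. pfam pair_coords P \<and> (\<forall>t s. poly (P s) t = p (fst s + (t - l (fst s)) *s u, snd s))"
    using p unfolding pair_polys_def
  proof (rule alg_gen_pfam)
    fix b :: "(complex^'n) \<times> (complex^'n) \<Rightarrow> complex" assume "b \<in> pair_coords"
    then consider i where "b = (\<lambda>p. fst p $ i)" | i where "b = (\<lambda>p. snd p $ i)" by auto
    then show "\<exists>f g. f \<in> alg_gen pair_coords \<and> g \<in> alg_gen pair_coords \<and>
        (\<forall>t s. b (fst s + (t - l (fst s)) *s u, snd s) = f s + t * g s)"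
    proof cases
      case (1 i)
      have "(\<lambda>s. fst s $ i - l (fst s) * u $ i) \<in> pair_polys"
        by (intro pair_polys_intros pair_polys_fst polys_comp_fst l)
      then show ?thesis
        unfolding pair_polys_def 1
        by (intro exI[of _ "\<lambda>s. fst s $ i - l (fst s) * u $ i"] exI[of _ "\<lambda>_. u $ i"])
           (auto simp: algebra_simps intro: alg_gen.const)
    next
      case (2 i)
      then show ?thesis
        by (intro exI[of _ "\<lambda>s. snd s $ i"] exI[of _ "\<lambda>_. 0"]) (auto intro: alg_gen.intros)
    qed
  qed
  then obtain P where P: "pfam pair_coords P"
    "\<And>t s. poly (P s) t = p (fst s + (t - l (fst s)) *s u, snd s)" by blast
  have eq: "dir_poly l u p = P" by (rule ext, rule dir_poly_eqI) (use P in simp)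
  then show "pfam pair_coords (dir_poly l u p)" using P(1) by simp
  show "poly (dir_poly l u p s) t = p (fst s + (t - l (fst s)) *s u, snd s)" using eq P(2) by simp
qed

lemma coord_dir_polys: "coord_dir l u \<Longrightarrow> l \<in> polys"
  by (simp add: coord_dir_def)

lemma poly_dir_poly_self: "p \<in> pair_polys \<Longrightarrow> l \<in> polys \<Longrightarrow> poly (dir_poly l u p s) (l (fst s)) = p s"
  by (simp add: dir_poly_pfam)

lemma dir_poly_coeff: "p \<in> pair_polys \<Longrightarrow> l \<in> polys \<Longrightarrow> (\<lambda>s. coeff (dir_poly l u p s) k) \<in> pair_polys"
  unfolding pair_polys_def by (rule pfamD[OF dir_poly_pfam(1)]) (auto simp: pair_polys_def)

lemma dir_poly_add:
  "p \<in> pair_polys \<Longrightarrow> q \<in> pair_polys \<Longrightarrow> l \<in> polys \<Longrightarrow>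
    dir_poly l u (\<lambda>s. p s + q s) s = dir_poly l u p s + dir_poly l u q s"
  by (rule dir_poly_eqI) (simp add: dir_poly_pfam)

lemma dir_poly_diff:
  "p \<in> pair_polys \<Longrightarrow> q \<in> pair_polys \<Longrightarrow> l \<in> polys \<Longrightarrow>
    dir_poly l u (\<lambda>s. p s - q s) s = dir_poly l u p s - dir_poly l u q s"
  by (rule dir_poly_eqI) (simp add: dir_poly_pfam)

lemma dir_poly_mult:
  "p \<in> pair_polys \<Longrightarrow> q \<in> pair_polys \<Longrightarrow> l \<in> polys \<Longrightarrow>
    dir_poly l u (\<lambda>s. p s * q s) s = dir_poly l u p s * dir_poly l u q s"
  by (rule dir_poly_eqI) (simp add: dir_poly_pfam)

lemma dir_poly_invariant:
  assumes "invariant u y" shows "dir_poly l u y s = [:y s:]"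
proof (rule dir_poly_eqI)
  fix t
  have "y (fst s + (t - l (fst s)) *s u, snd s) = y (fst s, snd s)"
    using assms unfolding invariant_def by blast
  then show "poly [:y s:] t = y (fst s + (t - l (fst s)) *s u, snd s)" by (simp only:) simp
qed

lemma dir_poly_mult_invariant:
  assumes "invariant u y" "y \<in> pair_polys" "p \<in> pair_polys" "l \<in> polys"
  shows "dir_poly l u (\<lambda>s. y s * p s) s = smult (y s) (dir_poly l u p s)"
  using assms by (simp add: dir_poly_mult dir_poly_invariant)

lemma dir_poly_mult_power:
  assumes l: "coord_dir l u" and p: "p \<in> pair_polys"
  shows "dir_poly l u (\<lambda>s. l (fst s) ^ K * p s) s = monom 1 K * dir_poly l u p s"
proof (rule dir_poly_eqI)
  fix t
  have "l (fst s + (t - l (fst s)) *s u) = t"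
    using l unfolding coord_dir_def by (metis add_diff_cancel_left' diff_add_cancel add.commute)
  then show "poly (monom 1 K * dir_poly l u p s) t
      = l (fst (fst s + (t - l (fst s)) *s u, snd s)) ^ K * p (fst s + (t - l (fst s)) *s u, snd s)"
    using l p by (simp only: fst_conv poly_mult poly_monom dir_poly_pfam coord_dir_def) simp
qed

lemma dir_poly_zero: "dir_poly l u (\<lambda>_. 0) s = 0"
  by (rule dir_poly_eqI) simp

text \<open>Division by \<open>l ^ K\<close>: the finitely many coefficients below \<open>K\<close>
  decide whether \<open>p\<close> lies in an ideal that contains \<open>l ^ K\<close>.\<close>

lemma split_low:
  assumes p: "p \<in> pair_polys" and l: "l \<in> polys"
  shows "\<exists>r\<in>pair_polys. \<forall>s. p s = (\<Sum>k<K. coeff (dir_poly l u p s) k * l (fst s) ^ k) + l (fst s) ^ K * r s"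
proof -
  obtain M where M: "\<And>s. degree (dir_poly l u p s) \<le> M"
    using dir_poly_pfam(1)[OF p l] unfolding pfam_def by blast
  define r where "r = (\<lambda>s. \<Sum>k\<in>{K..M}. coeff (dir_poly l u p s) k * l (fst s) ^ (k - K))"
  have r: "r \<in> pair_polys"
    unfolding r_def by (intro pair_polys_intros dir_poly_coeff polys_comp_fst p l)
  have "p s = (\<Sum>k<K. coeff (dir_poly l u p s) k * l (fst s) ^ k) + l (fst s) ^ K * r s" for s
  proof -
    have "degree (dir_poly l u p s) \<le> max M K" using M by (meson max.coboundedI1)
    then have "p s = (\<Sum>k\<le>max M K. coeff (dir_poly l u p s) k * l (fst s) ^ k)"
      using poly_eq_sum poly_dir_poly_self[OF p l] by metis
    also have "{..max M K} = {..<K} \<union> {K..max M K}" by auto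
    also have "(\<Sum>k\<in>\<dots>. coeff (dir_poly l u p s) k * l (fst s) ^ k)
      = (\<Sum>k<K. coeff (dir_poly l u p s) k * l (fst s) ^ k)
        + (\<Sum>k\<in>{K..max M K}. coeff (dir_poly l u p s) k * l (fst s) ^ k)"
      by (rule sum.union_disjoint) auto
    also have "(\<Sum>k\<in>{K..max M K}. coeff (dir_poly l u p s) k * l (fst s) ^ k)
      = (\<Sum>k\<in>{K..M}. coeff (dir_poly l u p s) k * l (fst s) ^ k)"
      using M[of s] by (intro sum.mono_neutral_right) (auto simp: coeff_eq_0)
    also have "\<dots> = l (fst s) ^ K * r s"
      unfolding r_def sum_distrib_left
      by (intro sum.cong) (auto simp: mult.left_commute simp flip: power_add)
    finally show ?thesis .
  qed
  with r show ?thesis by blast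
qed

definition nzd :: "((complex^'n) \<times> (complex^'n) \<Rightarrow> complex) \<Rightarrow> bool" where
  "nzd y \<longleftrightarrow> (\<forall>p\<in>pair_polys. (\<forall>s. y s * p s = 0) \<longrightarrow> (\<forall>s. p s = 0))"

lemma nzd_power:
  assumes l: "coord_dir l u" shows "nzd (\<lambda>s. l (fst s) ^ K)"
  unfolding nzd_def
proof (intro ballI impI allI)
  fix p s assume p: "p \<in> pair_polys" "\<forall>s. l (fst s) ^ K * p s = 0"
  then have "(\<lambda>s. l (fst s) ^ K * p s) = (\<lambda>_. 0)" by (intro ext) blast
  then have "monom 1 K * dir_poly l u p s = 0"
    using dir_poly_mult_power[OF l p(1), of K s] by (simp only: dir_poly_zero)
  then have "dir_poly l u p s = 0" by simp
  then show "p s = 0" using poly_dir_poly_self[OF p(1) coord_dir_polys[OF l]] by (metis poly_0)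
qed

text \<open>Expand in powers of \<open>l\<close>. As \<open>y\<close> is constant along
  \<open>u\<close>, it multiplies each coefficient separately, while the right side has none below
  \<open>K\<close>; so \<open>y\<close> stays a nonzerodivisor modulo \<open>l ^ K\<close>.\<close>

lemma regular2:
  assumes l: "coord_dir l u" and y: "y \<in> pair_polys" "invariant u y" "nzd y"
    and p: "p \<in> pair_polys" and q: "q \<in> pair_polys"
    and eq: "\<And>s. y s * p s = l (fst s) ^ K * q s"
  shows "\<exists>r\<in>pair_polys. \<forall>s. p s = l (fst s) ^ K * r s"
proof -
  note l_pol = coord_dir_polys[OF l]
  have "coeff (dir_poly l u p s) k = 0" if "k < K" for k s
  proof -
    have "smult (y s) (dir_poly l u p s) = monom 1 K * dir_poly l u q s" for s
      using dir_poly_mult_invariant[OF y(2,1) p l_pol, of s] dir_poly_mult_power[OF l q, of K s] eq by simp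
    then have "y s * coeff (dir_poly l u p s) k = 0" for s
      using that by (metis coeff_monom_one_mult coeff_smult)
    then show ?thesis
      using y(3)[unfolded nzd_def, rule_format, OF dir_poly_coeff[OF p l_pol, of u k]] by blast
  qed
  then show ?thesis using split_low[OF p l_pol, where K = K and u = u] by simp
qed

text \<open>The coefficients below \<open>K\<close> lose the term with \<open>p\<close> and satisfy
  the hypothesis of \<open>regular2\<close> for \<open>l'\<close>. Thus \<open>y\<close> is a
  nonzerodivisor modulo \<open>l ^ K\<close> and \<open>l' ^ K\<close>.\<close>

lemma regular3:
  assumes l: "coord_dir l u" and l': "coord_dir l' u'"
    and y: "y \<in> pair_polys" "invariant u y" "invariant u' y" "nzd y"
    and inv: "invariant u (\<lambda>s. l' (fst s) ^ K)"
    and p: "p \<in> pair_polys" and q: "q \<in> pair_polys" and b: "b \<in> pair_polys"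
    and eq: "\<And>s. y s * b s = l (fst s) ^ K * p s + l' (fst s) ^ K * q s"
  shows "\<exists>r\<in>pair_polys. \<exists>r'\<in>pair_polys. \<forall>s. b s = l (fst s) ^ K * r s + l' (fst s) ^ K * r' s"
proof -
  note l_pol = coord_dir_polys[OF l]
  have l'K: "(\<lambda>s. l' (fst s) ^ K) \<in> pair_polys"
    by (intro pair_polys_intros polys_comp_fst coord_dir_polys[OF l'])
  have "\<exists>r\<in>pair_polys. \<forall>s. coeff (dir_poly l u b s) k = l' (fst s) ^ K * r s" if "k < K" for k
  proof (rule regular2[OF l' y(1,3,4) dir_poly_coeff[OF b l_pol] dir_poly_coeff[OF q l_pol]])
    fix s
    have lK: "(\<lambda>s. l (fst s) ^ K) \<in> pair_polys"
      by (intro pair_polys_intros polys_comp_fst l_pol)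
    have "smult (y s) (dir_poly l u b s) = monom 1 K * dir_poly l u p s + smult (l' (fst s) ^ K) (dir_poly l u q s)"
      using dir_poly_mult_invariant[OF y(2,1) b l_pol, of s] dir_poly_mult_power[OF l p, of K s]
        dir_poly_mult_invariant[OF inv l'K q l_pol, of s] eq
        dir_poly_add[OF pair_polys_intros(3)[OF lK p] pair_polys_intros(3)[OF l'K q] l_pol, of u s] by simp
    then have "coeff (smult (y s) (dir_poly l u b s)) k
      = coeff (monom 1 K * dir_poly l u p s + smult (l' (fst s) ^ K) (dir_poly l u q s)) k" by simp
    then show "y s * coeff (dir_poly l u b s) k = l' (fst s) ^ K * coeff (dir_poly l u q s) k"
      using that by (simp add: coeff_monom_one_mult)
  qed
  then obtain r where r: "\<And>k. k < K \<Longrightarrow> r k \<in> pair_polys"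
    "\<And>k s. k < K \<Longrightarrow> coeff (dir_poly l u b s) k = l' (fst s) ^ K * r k s" by metis
  obtain r0 where r0: "r0 \<in> pair_polys"
    "\<And>s. b s = (\<Sum>k<K. coeff (dir_poly l u b s) k * l (fst s) ^ k) + l (fst s) ^ K * r0 s"
    using split_low[OF b l_pol, where K = K and u = u] by blast
  define r' where "r' = (\<lambda>s. \<Sum>k<K. r k s * l (fst s) ^ k)"
  have "r' \<in> pair_polys"
    unfolding r'_def using r(1) by (intro pair_polys_intros polys_comp_fst l_pol) auto
  moreover have "b s = l (fst s) ^ K * r0 s + l' (fst s) ^ K * r' s" for s
    by (simp add: r0(2)[of s] r(2) r'_def sum_distrib_left mult.assoc)
  ultimately show ?thesis using r0(1) by blast
qed

section \<open>Reduction modulo a polynomial that is monic in one direction\<close>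

text \<open>Long division only divides by the leading coefficient of \<open>Q s\<close>. That is a
  constant \<open>c\<close>, so every step stays in the algebra of coefficients, and the number of
  steps is bounded uniformly.\<close>

lemma pfam_mod:
  fixes P Q :: "'a \<Rightarrow> complex poly"
  assumes P: "pfam B P" and Q: "pfam B Q" and d: "\<And>s. degree (Q s) = d"
    and c: "\<And>s. coeff (Q s) d = c" "c \<noteq> 0"
  shows "pfam B (\<lambda>s. P s mod Q s)"
proof -
  obtain M where "\<And>s. degree (P s) \<le> M" using P by (auto simp: pfam_def)
  with P show ?thesis
  proof (induction M arbitrary: P)
    case 0
    show ?case
    proof (cases "d = 0")
      case True
      then have "P s mod Q s = 0" for s
        using d[of s] c(1)[of s] c(2) degree_mod_less'[of "Q s" "P s"] by fastforce
      then show ?thesis using pfam_const[OF alg_gen.const[of 0]] by simp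
    next
      case False
      then show ?thesis using 0 d by (simp add: mod_poly_less)
    qed
  next
    case (Suc M)
    show ?case
    proof (cases "Suc M < d")
      case True
      then have "P s mod Q s = P s" for s
        using Suc.prems(2)[of s] d[of s] by (intro mod_poly_less) simp
      then show ?thesis using Suc.prems by simp
    next
      case False
      define m where "m = (\<lambda>s. monom (coeff (P s) (Suc M) / c) (Suc M - d))"
      have m: "pfam B m"
        unfolding m_def divide_inverse using Suc.prems(1)
        by (intro pfam_monom alg_gen.mult alg_gen.const pfamD)
      have "degree (P s - m s * Q s) \<le> M" for s
      proof (rule degree_le, intro allI impI)
        fix i assume i: "M < i"
        show "coeff (P s - m s * Q s) i = 0"
        proof (cases "i = Suc M")
          case True
          then show ?thesis using False c by (simp add: m_def coeff_monom_mult)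
        next
          case False
          then have "Suc M < i" using i by simp
          then have "coeff (P s) i = 0" "coeff (Q s) (i - (Suc M - d)) = 0"
            using Suc.prems(2)[of s] d[of s] \<open>\<not> Suc M < d\<close> by (auto intro!: coeff_eq_0)
          then show ?thesis by (simp add: m_def coeff_monom_mult)
        qed
      qed
      then have "pfam B (\<lambda>s. (P s - m s * Q s) mod Q s)"
        using Suc.prems(1) m Q by (intro Suc.IH pfam_diff pfam_mult)
      moreover have "(P s - m s * Q s) mod Q s = P s mod Q s" for s
        by (simp add: poly_mod_diff_left)
      ultimately show ?thesis by simp
    qed
  qed
qed

section \<open>Smooth hypersurfaces\<close>

lemma mem_span1: "w \<in> vec.span {v} \<longleftrightarrow> (\<exists>c. w = c *s v)"
  by (auto simp: vec.span_singleton)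

lemma span1_self: "v \<in> vec.span {v}"
  by (simp add: vec.span_base)

lemma span1_eq: "c \<noteq> 0 \<Longrightarrow> vec.span {c *s v} = vec.span {v::complex^'n}"
proof (intro subset_antisym subsetI)
  fix w assume "c \<noteq> 0" "w \<in> vec.span {v}"
  then obtain b where "w = b *s v" by (auto simp: mem_span1)
  then have "w = (b / c) *s (c *s v)" using \<open>c \<noteq> 0\<close> by simp
  then show "w \<in> vec.span {c *s v}" unfolding mem_span1 by blast
next
  fix w assume "w \<in> vec.span {c *s v}"
  then obtain b where "w = (b * c) *s v" by (auto simp: mem_span1)
  then show "w \<in> vec.span {v}" unfolding mem_span1 by blast
qed

lemma proj_space_span1: "v \<noteq> 0 \<Longrightarrow> vec.span {v} \<in> proj_space"
  by (auto simp: proj_space_def)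

lemma proj_space_eq_span1:
  assumes "x \<in> proj_space" "v \<in> x" "v \<noteq> 0" shows "x = vec.span {v}"
proof -
  obtain u where u: "x = vec.span {u}" "u \<noteq> 0" using assms(1) by (auto simp: proj_space_def)
  then obtain c where "v = c *s u" using assms(2) by (auto simp: mem_span1)
  then show ?thesis using span1_eq[of c u] assms(3) u by auto
qed

text \<open>On the ray \<open>t *s v\<close> the right side is divisible by \<open>t ^ d\<close>,
  whereas the left side is a multiple of \<open>t ^ e\<close> with \<open>e < d\<close>.\<close>

lemma homog_degree_less_eq_0:
  assumes q: "homog e q" and F: "homog d F" and G: "G \<in> polys" and ed: "e < d"
    and eq: "\<And>v. q v = F v * G v"
  shows "q v = 0"
proof -
  have "monom (q v) e = monom 1 d * smult (F v) (line_poly G 0 v)"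
  proof (rule polyI)
    fix t
    have "t ^ e * q v = t ^ d * F v * G (t *s v)"
      using homog_scale[OF q, of t v] homog_scale[OF F, of t v] eq[of "t *s v"] by simp
    then show "poly (monom (q v) e) t = poly (monom 1 d * smult (F v) (line_poly G 0 v)) t"
      by (simp add: poly_monom poly_line_poly[OF G] mult.commute)
  qed
  then have "coeff (monom (q v) e) e = coeff (monom 1 d * smult (F v) (line_poly G 0 v)) e" by simp
  then show ?thesis using ed by (simp add: coeff_monom_one_mult)
qed

text \<open>
  \<open>F\<close> is monic up to a constant in the direction \<open>e\<close>; \<open>i0\<close> serves as coordinate along \<open>e\<close>, and
  \<open>i1, i2, i3\<close> give three coordinates that are constant along \<open>e\<close>.
\<close>

locale smooth_hypersurface =
  fixes X :: "(complex^'n::finite) set set" and F :: "complex^'n \<Rightarrow> complex" and d :: nat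
    and e :: "complex^'n" and i0 i1 i2 i3 :: 'n
  assumes homF: "homog d F"
    and X_eq: "X = {x \<in> proj_space. vanishes_on F {x}}"
    and generates: "\<And>k H. homog k H \<Longrightarrow> vanishes_on H X \<Longrightarrow> \<exists>G\<in>polys. \<forall>v. H v = F v * G v"
    and d2: "d \<ge> 2" and smooth: "smooth_variety X"
    and Fe: "F e \<noteq> 0" and e0: "e $ i0 = 1" and dist: "distinct [i0, i1, i2, i3]"
begin

text \<open>The punctured affine cone over \<open>X\<close>; computations take place on its vectors
  instead of on points of projective space.\<close>

definition Xh :: "(complex^'n) set" where
  "Xh = {v. v \<noteq> 0 \<and> F v = 0}"

lemma F_polys: "F \<in> polys"
  using homF by (rule homog_polys)

lemma F_scale: "F (c *s v) = c ^ d * F v"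
  by (rule homog_scale[OF homF])

lemma Xh_scale: "v \<in> Xh \<Longrightarrow> c \<noteq> 0 \<Longrightarrow> c *s v \<in> Xh"
  by (simp add: Xh_def F_scale)

lemma F_0: "F 0 = 0"
  using F_scale[of 0 0] d2 by (auto simp: power_0_left)

lemma span1_in_X: "v \<in> Xh \<Longrightarrow> vec.span {v} \<in> X"
  by (auto simp: X_eq Xh_def vanishes_on_def mem_span1 F_scale intro: proj_space_span1)

lemma X_Xh: "x \<in> X \<Longrightarrow> v \<in> x - {0} \<Longrightarrow> v \<in> Xh \<and> x = vec.span {v}"
  using proj_space_eq_span1[of x v] by (auto simp: X_eq vanishes_on_def Xh_def)

lemma X_cases:
  assumes "x \<in> X" obtains v where "v \<in> Xh" "x = vec.span {v}" "v \<in> x - {0}"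
proof -
  obtain v where v: "x = vec.span {v}" "v \<noteq> 0" using assms by (auto simp: X_eq proj_space_def)
  then have "v \<in> x - {0}" by (auto intro: vec.span_base)
  then show ?thesis using that X_Xh[OF assms] by blast
qed

lemma irreducible: "irreducible_variety X"
  using smooth by (simp add: smooth_variety_def)

lemma Xh_nonempty: "\<exists>v. v \<in> Xh"
  using irreducible X_cases by (metis all_not_in_conv irreducible_variety_def)

lemma vanishes_on_X:
  assumes H: "homog k H" shows "vanishes_on H X \<longleftrightarrow> (\<forall>v\<in>Xh. H v = 0)"
proof
  assume "vanishes_on H X"
  then show "\<forall>v\<in>Xh. H v = 0" using span1_in_X span1_self unfolding vanishes_on_def by blast
next
  assume *: "\<forall>v\<in>Xh. H v = 0"
  obtain u where "u \<in> Xh" using Xh_nonempty by blast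
  then have "H u = 0" using * by blast
  \<comment> \<open>Scaling \<open>u\<close> by \<open>0\<close> also settles \<open>k = 0\<close>,
    where \<open>H\<close> is a constant that vanishes at \<open>u\<close>.\<close>
  then have "H 0 = 0" using homog_scale[OF H, of 0 u] by simp
  show "vanishes_on H X"
    unfolding vanishes_on_def
  proof (intro ballI)
    fix x v assume "x \<in> X" "v \<in> x"
    then show "H v = 0" using \<open>H 0 = 0\<close> * X_Xh[of x v] by (cases "v = 0") auto
  qed
qed

lemma hom_part_vanish:
  assumes p: "p \<in> polys" and v: "\<And>v. v \<in> Xh \<Longrightarrow> p v = 0" and "v \<in> Xh"
  shows "hom_part p k v = 0"
proof -
  have "line_poly p 0 v = 0"
    by (rule poly_eq_if_eq_nonzero) (use assms Xh_scale in \<open>simp add: poly_line_poly[OF p]\<close>)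
  then show ?thesis by (simp add: hom_part_def)
qed

text \<open>The defining property of \<open>F\<close> speaks of homogeneous equations only. The cone
  is stable under scaling, so the homogeneous components of \<open>p\<close> vanish on it too and
  are divided one by one.\<close>

lemma divisible:
  assumes p: "p \<in> polys" and v: "\<And>v. v \<in> Xh \<Longrightarrow> p v = 0"
  shows "\<exists>G\<in>polys. \<forall>v. p v = F v * G v"
proof -
  have "\<exists>G\<in>polys. \<forall>v. hom_part p k v = F v * G v" for k
    using generates[OF homog_hom_part[OF p]] vanishes_on_X[OF homog_hom_part[OF p]] hom_part_vanish[OF assms] by blast
  then obtain G where G: "\<And>k. G k \<in> polys" "\<And>k v. hom_part p k v = F v * G k v" by metis
  obtain M where M: "\<And>v. p v = (\<Sum>k\<le>M. hom_part p k v)" using sum_hom_part[OF p] by blast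
  have "p v = F v * (\<Sum>k\<le>M. G k v)" for v by (simp add: M G(2) sum_distrib_left)
  moreover have "(\<lambda>v. \<Sum>k\<le>M. G k v) \<in> polys" using G by (intro polys_intros)
  ultimately show ?thesis by (intro bexI[of _ "\<lambda>v. \<Sum>k\<le>M. G k v"]) auto
qed

lemma zariski_closed_zeros: "homog k p \<Longrightarrow> zariski_closed {x \<in> proj_space. vanishes_on p {x}}"
  unfolding zariski_closed_def by (intro exI[of _ "{p}"]) auto

lemma irreducible_homog:
  assumes p: "homog k p" and q: "homog l q" and pq: "\<And>v. v \<in> Xh \<Longrightarrow> p v * q v = 0"
  shows "(\<forall>v\<in>Xh. p v = 0) \<or> (\<forall>v\<in>Xh. q v = 0)"
proof -
  define Z where "Z = (\<lambda>p. {x \<in> proj_space. vanishes_on p {x}} :: (complex^'n) set set)"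
  have van: "vanishes_on p {vec.span {v}}" if "homog k p" "p v = 0" for p v k
    using that by (auto simp: vanishes_on_def mem_span1 homog_scale)
  have "X \<subseteq> Z p \<union> Z q"
  proof
    fix x assume x: "x \<in> X"
    then obtain v where v: "v \<in> Xh" "x = vec.span {v}" using X_cases by metis
    then have "p v = 0 \<or> q v = 0" using pq by force
    then show "x \<in> Z p \<union> Z q"
      using van[OF p] van[OF q] x v by (auto simp: Z_def X_eq)
  qed
  then have "X \<subseteq> Z p \<or> X \<subseteq> Z q"
    using irreducible zariski_closed_zeros[OF p] zariski_closed_zeros[OF q]
    unfolding irreducible_variety_def Z_def by blast
  moreover have "p v = 0" if "X \<subseteq> Z p" "v \<in> Xh" for p v
    using that span1_in_X[of v] span1_self[of v] by (auto simp: Z_def vanishes_on_def)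
  ultimately show ?thesis by blast
qed

text \<open>Since \<open>q\<close> is homogeneous, the components of the product are those of
  \<open>p\<close> times \<open>q\<close>, shifted by \<open>l\<close>; irreducibility applies to
  each of them.\<close>

lemma irreducible_mult:
  assumes p: "p \<in> polys" and q: "homog l q" and pq: "\<And>v. v \<in> Xh \<Longrightarrow> p v * q v = 0"
    and u: "u \<in> Xh" "q u \<noteq> 0" and v: "v \<in> Xh"
  shows "p v = 0"
proof -
  have comp: "hom_part p k v * q v = 0" if "v \<in> Xh" for k v
  proof -
    have "hom_part (\<lambda>v. p v * q v) (k + l) v = 0"
      using p q pq that by (intro hom_part_vanish polys_intros) (auto simp: homog_polys)
    moreover have "line_poly (\<lambda>v. p v * q v) 0 v = line_poly p 0 v * monom (q v) l"
      by (rule line_poly_eqI) (use p q in \<open>simp add: poly_line_poly poly_monom homog_scale mult_ac\<close>)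
    then have "line_poly (\<lambda>v. p v * q v) 0 v = monom (q v) l * line_poly p 0 v" by (simp only: mult.commute)
    ultimately show ?thesis by (auto simp: hom_part_def coeff_monom_mult)
  qed
  have "hom_part p k v = 0" for k
    using irreducible_homog[OF homog_hom_part[OF p] q comp] u v by blast
  then show ?thesis using sum_hom_part[OF p] by fastforce
qed

text \<open>Every homogeneous equation of \<open>X\<close> has the form \<open>F * G\<close>. On the
  cone, where \<open>F\<close> vanishes, the product rule makes its differential a multiple of that
  of \<open>F\<close>.\<close>

lemma tangent_cone_iff:
  assumes v: "v \<in> Xh" shows "w \<in> tangent_cone X (vec.span {v}) \<longleftrightarrow> dir_deriv F v w = 0"
proof
  assume "w \<in> tangent_cone X (vec.span {v})"
  moreover have "vanishes_on F X" by (simp add: X_eq vanishes_on_def)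
  moreover have "v \<in> vec.span {v} - {0}" using v by (auto simp: Xh_def intro: vec.span_base)
  ultimately show "dir_deriv F v w = 0" using homF unfolding tangent_cone_def by blast
next
  assume w: "dir_deriv F v w = 0"
  show "w \<in> tangent_cone X (vec.span {v})"
    unfolding tangent_cone_def
  proof (intro CollectI allI impI ballI)
    fix k H u assume H: "homog k H \<and> vanishes_on H X" and u: "u \<in> vec.span {v} - {0}"
    obtain G where G: "G \<in> polys" "H = (\<lambda>v. F v * G v)" using generates H by fastforce
    obtain c where c: "u = c *s v" using u by (auto simp: mem_span1)
    have "dir_deriv F u w = 0"
      using homog_scale[OF homog_dir_deriv[OF homF], of c v w] d2 w by (simp add: c)
    moreover have "F u = 0" using v by (simp add: c F_scale Xh_def)
    ultimately show "dir_deriv H u w = 0" by (simp add: G dir_deriv_mult[OF F_polys G(1)])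
  qed
qed

text \<open>Smoothness compares dimensions only: if one tangent space were everything, all would be.
  Then each partial derivative of \<open>F\<close> would vanish on \<open>X\<close>, hence be a
  multiple of \<open>F\<close> of smaller degree, hence zero, against Euler's formula at
  \<open>e\<close>.\<close>

lemma nonsingular:
  assumes v: "v \<in> Xh" shows "\<exists>w. dir_deriv F v w \<noteq> 0"
proof (rule ccontr)
  assume "\<not> ?thesis"
  then have full: "tangent_cone X (vec.span {v}) = UNIV" using tangent_cone_iff[OF v] by blast
  have "dir_deriv F u w = 0" if u: "u \<in> Xh" for u w
  proof -
    let ?T = "tangent_cone X (vec.span {u})"
    have "vec.dim (UNIV :: (complex^'n) set) \<le> vec.dim ?T"
      using smooth span1_in_X[OF u] span1_in_X[OF v] full
      unfolding smooth_variety_def smooth_locus_def by (metis (no_types, lifting) mem_Collect_eq)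
    moreover have "vec.subspace ?T"
      unfolding vec.subspace_def
      by (auto simp: tangent_cone_iff[OF u] dir_deriv_add[OF F_polys] dir_deriv_scale[OF F_polys])
         (metis F_polys dir_deriv_scale mult_zero_left vector_smult_lzero)
    ultimately have "?T = UNIV"
      using vec.subspace_dim_equal[of ?T UNIV] vec.subspace_UNIV by blast
    then show ?thesis using tangent_cone_iff[OF u] by blast
  qed
  then have "\<exists>G\<in>polys. \<forall>v. dir_deriv F v w = F v * G v" for w
    by (intro divisible dir_deriv_polys F_polys)
  then have "dir_deriv F v w = 0" for v w
    using homog_degree_less_eq_0[OF homog_dir_deriv[OF homF, of w] homF] d2 by force
  then show False using euler[OF homF, of e] Fe d2 by simp
qed

section \<open>Reduction modulo the equation\<close>

definition tau :: "complex^'n \<Rightarrow> complex" where "tau v = v $ i0"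

text \<open>The multiple of \<open>v $ i0\<close> is subtracted to make this linear form constant
  along \<open>e\<close>, using \<open>e $ i0 = 1\<close>.\<close>

definition xc :: "'n \<Rightarrow> complex^'n \<Rightarrow> complex" where "xc i v = v $ i - v $ i0 * e $ i"

lemma xc_homog: "homog 1 (xc i)"
  unfolding homog_def xc_def[abs_def] by (auto intro!: polys_intros polys_coord simp: algebra_simps)

lemma xc_polys: "xc i \<in> polys"
  using xc_homog by (rule homog_polys)

lemma tau_polys: "tau \<in> polys"
  unfolding tau_def[abs_def] by (rule polys_coord)

lemma coord_dir_x: "i \<noteq> i0 \<Longrightarrow> coord_dir (xc i) (axis i 1)"
  using xc_polys by (simp add: coord_dir_def) (simp add: xc_def axis_def)

lemma xc_invariant_e: "invariant e (\<lambda>s. xc i (fst s) ^ K)"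
  using e0 by (simp add: invariant_def xc_def algebra_simps)

lemma xc_invariant_axis: "i \<noteq> j \<Longrightarrow> j \<noteq> i0 \<Longrightarrow> invariant (axis j 1) (\<lambda>s. xc i (fst s) ^ K)"
  by (simp add: invariant_def xc_def axis_def)

lemma xc_power_polys: "(\<lambda>s. xc i (fst s) ^ K) \<in> pair_polys"
  by (intro pair_polys_intros polys_comp_fst xc_polys)

lemma xc_nzd: "i \<noteq> i0 \<Longrightarrow> nzd (\<lambda>s. xc i (fst s) ^ K)"
  by (rule nzd_power[OF coord_dir_x])

definition Fp :: "(complex^'n) \<times> (complex^'n) \<Rightarrow> complex poly" where
  "Fp = dir_poly tau e (\<lambda>s. F (fst s))"

lemma F_fst: "(\<lambda>s. F (fst s)) \<in> pair_polys"
  by (rule polys_comp_fst[OF F_polys])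

text \<open>As a polynomial in \<open>tau\<close>, \<open>F\<close> is its restriction to a line in
  direction \<open>e\<close>, so its top coefficient is the nonzero constant \<open>F e\<close>.
  This is what \<open>pfam_mod\<close> asks for.\<close>

lemma Fp_top: "coeff (Fp s) d = F e" and Fp_degree: "degree (Fp s) = d"
proof -
  have "Fp s = line_poly F (fst s - tau (fst s) *s e) e"
    unfolding Fp_def
    by (rule dir_poly_eqI) (simp add: poly_line_poly[OF F_polys] algebra_simps)
  then show "coeff (Fp s) d = F e" and "degree (Fp s) = d"
    using coeff_line_poly_top[OF homF] degree_line_poly[OF homF] Fe by (auto intro!: antisym le_degree)
qed

text \<open>A normal form modulo \<open>F\<close>: its coefficients are the coordinates with respect
  to the basis of powers of \<open>tau\<close> below \<open>d\<close>.\<close>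

definition remainder :: "((complex^'n) \<times> (complex^'n) \<Rightarrow> complex) \<Rightarrow> (complex^'n) \<times> (complex^'n) \<Rightarrow> complex poly" where
  "remainder p s = dir_poly tau e p s mod Fp s"

lemma remainder_coeff: "p \<in> pair_polys \<Longrightarrow> (\<lambda>s. coeff (remainder p s) k) \<in> pair_polys"
  unfolding remainder_def pair_polys_def Fp_def
  by (rule pfamD, rule pfam_mod[where d = d and c = "F e"])
     (use Fe F_fst tau_polys Fp_degree Fp_top in \<open>auto simp: pair_polys_def[symmetric] Fp_def intro: dir_poly_pfam(1)\<close>)

lemma remainder_eq_0:
  assumes p: "p \<in> pair_polys" and 0: "\<And>v w. v \<in> Xh \<Longrightarrow> p (v, w) = 0"
  shows "remainder p s = 0"
proof -
  obtain v w where s: "s = (v, w)" by force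
  \<comment> \<open>\<open>G\<close> may depend on \<open>w\<close> in an uncontrolled way; that is
    harmless because the remainder is computed at one \<open>s\<close> at a time.\<close>
  obtain G where G: "G \<in> polys" "\<And>v. p (v, w) = F v * G v"
    using divisible[OF pair_polys_at[OF p], of w] 0 by blast
  have "dir_poly tau e p s = Fp s * dir_poly tau e (\<lambda>s. G (fst s)) s"
    by (rule dir_poly_eqI)
       (simp add: s G(2) Fp_def dir_poly_pfam[OF F_fst tau_polys] dir_poly_pfam[OF polys_comp_fst[OF G(1)] tau_polys])
  then show ?thesis by (simp add: remainder_def)
qed

lemma remainder_add: "p \<in> pair_polys \<Longrightarrow> q \<in> pair_polys \<Longrightarrow> remainder (\<lambda>s. p s + q s) s = remainder p s + remainder q s"
  by (simp add: remainder_def dir_poly_add tau_polys poly_mod_add_left)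

lemma remainder_diff: "p \<in> pair_polys \<Longrightarrow> q \<in> pair_polys \<Longrightarrow> remainder (\<lambda>s. p s - q s) s = remainder p s - remainder q s"
  by (simp add: remainder_def dir_poly_diff tau_polys poly_mod_diff_left)

lemma remainder_mult_x: "p \<in> pair_polys \<Longrightarrow> remainder (\<lambda>s. xc i (fst s) ^ K * p s) s = smult (xc i (fst s) ^ K) (remainder p s)"
  by (simp add: remainder_def dir_poly_mult_invariant[OF xc_invariant_e xc_power_polys] tau_polys mod_smult_left)

lemma remainder_cong:
  assumes "p \<in> pair_polys" "q \<in> pair_polys" "\<And>v w. v \<in> Xh \<Longrightarrow> p (v, w) = q (v, w)"
  shows "remainder p s = remainder q s"
proof -
  have "remainder (\<lambda>s. p s - q s) s = 0"
    using assms by (intro remainder_eq_0 pair_polys_intros) auto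
  then show ?thesis using assms by (simp add: remainder_diff)
qed

lemma remainder_eval:
  assumes p: "p \<in> pair_polys" and v: "v \<in> Xh"
  shows "p (v, w) = (\<Sum>k<d. coeff (remainder p (v, w)) k * tau v ^ k)"
proof -
  have "Fp (v, w) \<noteq> 0" using Fp_degree[of "(v, w)"] d2 by auto
  then have "degree (remainder p (v, w)) < d"
    using degree_mod_less'[of "Fp (v, w)" "dir_poly tau e p (v, w)"] Fp_degree[of "(v, w)"] d2
    by (cases "remainder p (v, w) = 0") (auto simp: remainder_def)
  then have deg: "degree (remainder p (v, w)) \<le> d - 1" by simp
  have "{..d - 1} = {..<d}" using d2 by auto
  then have "poly (remainder p (v, w)) (tau v) = (\<Sum>k<d. coeff (remainder p (v, w)) k * tau v ^ k)"
    using poly_eq_sum[OF deg] by simp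
  moreover have "poly (Fp (v, w)) (tau v) = 0"
    using poly_dir_poly_self[OF F_fst tau_polys, of e "(v, w)"] v by (simp add: Fp_def Xh_def)
  then have "poly (dir_poly tau e p (v, w)) (tau v) = poly (remainder p (v, w)) (tau v)"
    by (simp add: remainder_def poly_mod)
  ultimately show ?thesis using poly_dir_poly_self[OF p tau_polys, of e "(v, w)"] by simp
qed

lemma remainder_sum_polys:
  "(\<And>k. k < d \<Longrightarrow> r k \<in> pair_polys) \<Longrightarrow> (\<lambda>s. \<Sum>k<d. r k s * tau (fst s) ^ k) \<in> pair_polys"
  by (intro pair_polys_intros polys_comp_fst tau_polys) auto

text \<open>Multiplication by \<open>xc i\<close>, which is constant along \<open>e\<close>, acts on
  each coefficient of the normal form. Regularity thus passes from the polynomial ring to the cone,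
  here and in the next two lemmas.\<close>

lemma regular1_X:
  assumes i: "i \<noteq> i0" and p: "p \<in> pair_polys"
    and eq: "\<And>v w. v \<in> Xh \<Longrightarrow> xc i v ^ K * p (v, w) = 0" and v: "v \<in> Xh"
  shows "p (v, w) = 0"
proof -
  have "(\<lambda>s. xc i (fst s) ^ K * p s) \<in> pair_polys" by (rule pair_polys_intros(3)[OF xc_power_polys p])
  then have "remainder (\<lambda>s. xc i (fst s) ^ K * p s) s = 0" for s by (rule remainder_eq_0) (use eq in simp)
  then have "xc i (fst s) ^ K * coeff (remainder p s) k = 0" for k s
    using remainder_mult_x[OF p, of i K s] by (metis coeff_0 coeff_smult)
  then have "coeff (remainder p s) k = 0" for k s
    using xc_nzd[OF i, of K, unfolded nzd_def, rule_format, OF remainder_coeff[OF p, of k]] by blast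
  then show ?thesis using remainder_eval[OF p v] by simp
qed

lemma regular2_X:
  assumes ij: "i \<noteq> i0" "j \<noteq> i0" "i \<noteq> j" and p: "p \<in> pair_polys" and q: "q \<in> pair_polys"
    and eq: "\<And>v w. v \<in> Xh \<Longrightarrow> xc i v ^ K * p (v, w) = xc j v ^ K * q (v, w)"
  shows "\<exists>r\<in>pair_polys. \<forall>v\<in>Xh. \<forall>w. p (v, w) = xc j v ^ K * r (v, w)"
proof -
  have "(\<lambda>s. xc i (fst s) ^ K * p s) \<in> pair_polys" "(\<lambda>s. xc j (fst s) ^ K * q s) \<in> pair_polys"
    by (rule pair_polys_intros(3)[OF xc_power_polys p], rule pair_polys_intros(3)[OF xc_power_polys q])
  then have "remainder (\<lambda>s. xc i (fst s) ^ K * p s) s = remainder (\<lambda>s. xc j (fst s) ^ K * q s) s" for s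
    by (rule remainder_cong) (use eq in simp)
  then have eq': "xc i (fst s) ^ K * coeff (remainder p s) k = xc j (fst s) ^ K * coeff (remainder q s) k" for k s
    using remainder_mult_x[OF p, of i K s] remainder_mult_x[OF q, of j K s] by (metis coeff_smult)
  have "\<exists>r\<in>pair_polys. \<forall>s. coeff (remainder p s) k = xc j (fst s) ^ K * r s" for k
    by (rule regular2[OF coord_dir_x[OF ij(2)] xc_power_polys xc_invariant_axis[OF ij(3,2)] xc_nzd[OF ij(1)]
          remainder_coeff[OF p] remainder_coeff[OF q] eq'])
  then obtain r where r: "\<And>k. r k \<in> pair_polys" "\<And>k s. coeff (remainder p s) k = xc j (fst s) ^ K * r k s"
    by metis
  show ?thesis
    using remainder_sum_polys[of r] r remainder_eval[OF p]
    by (intro bexI[of _ "\<lambda>s. \<Sum>k<d. r k s * tau (fst s) ^ k"]) (auto simp: sum_distrib_left mult.assoc)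
qed

lemma regular3_X:
  assumes ij: "i \<noteq> i0" "j \<noteq> i0" "k \<noteq> i0" "i \<noteq> j" "i \<noteq> k" "j \<noteq> k"
    and b: "b \<in> pair_polys" and p: "p \<in> pair_polys" and q: "q \<in> pair_polys"
    and eq: "\<And>v w. v \<in> Xh \<Longrightarrow> xc k v ^ K * b (v, w) = xc i v ^ K * p (v, w) + xc j v ^ K * q (v, w)"
  shows "\<exists>r\<in>pair_polys. \<exists>r'\<in>pair_polys. \<forall>v\<in>Xh. \<forall>w. b (v, w) = xc i v ^ K * r (v, w) + xc j v ^ K * r' (v, w)"
proof -
  note pp = pair_polys_intros(3)[OF xc_power_polys b, of k K] pair_polys_intros(3)[OF xc_power_polys p, of i K]
    pair_polys_intros(3)[OF xc_power_polys q, of j K]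
  have "remainder (\<lambda>s. xc k (fst s) ^ K * b s) s = remainder (\<lambda>s. xc i (fst s) ^ K * p s + xc j (fst s) ^ K * q s) s" for s
    by (rule remainder_cong[OF pp(1) pair_polys_intros(2)[OF pp(2,3)]]) (use eq in simp)
  then have "smult (xc k (fst s) ^ K) (remainder b s)
      = smult (xc i (fst s) ^ K) (remainder p s) + smult (xc j (fst s) ^ K) (remainder q s)" for s
    by (simp add: remainder_add[OF pp(2,3)] remainder_mult_x b p q)
  then have eq': "xc k (fst s) ^ K * coeff (remainder b s) l
      = xc i (fst s) ^ K * coeff (remainder p s) l + xc j (fst s) ^ K * coeff (remainder q s) l" for l s
    by (metis coeff_add coeff_smult)
  have "\<exists>r\<in>pair_polys. \<exists>r'\<in>pair_polys. \<forall>s. coeff (remainder b s) l = xc i (fst s) ^ K * r s + xc j (fst s) ^ K * r' s" for l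
    by (rule regular3[OF coord_dir_x[OF ij(1)] coord_dir_x[OF ij(2)] xc_power_polys
          xc_invariant_axis xc_invariant_axis xc_nzd[OF ij(3)] xc_invariant_axis
          remainder_coeff[OF p] remainder_coeff[OF q] remainder_coeff[OF b] eq']) (use ij in auto)
  then obtain r r' where r: "\<And>l. r l \<in> pair_polys" "\<And>l. r' l \<in> pair_polys"
    "\<And>l s. coeff (remainder b s) l = xc i (fst s) ^ K * r l s + xc j (fst s) ^ K * r' l s"
    by metis
  show ?thesis
    using remainder_sum_polys[of r] remainder_sum_polys[of r'] r remainder_eval[OF b]
    by (intro bexI[of _ "\<lambda>s. \<Sum>k<d. r k s * tau (fst s) ^ k"] bexI[of _ "\<lambda>s. \<Sum>k<d. r' k s * tau (fst s) ^ k"])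
       (auto simp: sum_distrib_left sum.distrib algebra_simps)
qed

end

context smooth_hypersurface
begin

section \<open>Functions on the tangent bundle\<close>

abbreviation DF :: "complex^'n \<Rightarrow> complex^'n \<Rightarrow> complex" where "DF \<equiv> dir_deriv F"

lemma DF_pair_polys: "(\<lambda>s. DF (fst s) (snd s)) \<in> pair_polys"
  by (rule dir_deriv_pair_polys[OF F_polys])

lemma DF_polys: "(\<lambda>v. DF v w) \<in> polys" "(\<lambda>w. DF v w) \<in> polys"
  using pair_polys_at[OF DF_pair_polys, of w] pair_polys_at_fst[OF DF_pair_polys, of v] by simp_all

lemma homog_DF: "homog (d - 1) (\<lambda>v. DF v w)"
  using homog_dir_deriv[OF homF] d2 by simp

text \<open>At every point of the cone \<open>DF v\<close> is a nonzero linear form, and polynomials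
  in \<open>w\<close> form an integral domain.\<close>

lemma DF_cancel:
  assumes g: "g \<in> pair_polys" and eq: "\<And>v w. v \<in> Xh \<Longrightarrow> DF v w * g (v, w) = 0" and v: "v \<in> Xh"
  shows "g (v, w) = 0"
proof -
  obtain u where u: "DF v u \<noteq> 0" using nonsingular[OF v] by blast
  show ?thesis
    by (rule polys_mult_eq_0[OF DF_polys(2) pair_polys_at_fst[OF g], where T = UNIV and v = u])
       (use eq v u in auto)
qed

text \<open>Trades local denominators for global ones: together with \<open>F\<close>, the
  homogeneous elements of \<open>J\<close> have no common zero but the origin. The sum of the
  finitely many exponents serves all \<open>i\<close>.\<close>

lemma xc_power_in_ideal:
  assumes J: "pideal J" "F \<in> J"
    and G: "\<And>v. v \<in> Xh \<Longrightarrow> \<exists>g\<in>J. (\<exists>D. homog D g) \<and> g v \<noteq> 0"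
  shows "\<exists>K. \<forall>i. (\<lambda>v. xc i v ^ K) \<in> J"
proof -
  have "\<exists>K. (\<lambda>v. xc i v ^ K) \<in> J" for i
  proof (rule homogeneous_nullstellensatz[where G = "{g \<in> J. \<exists>D. homog D g}", OF _ _ J(1) _ xc_homog])
    fix v :: "complex^'n" assume "v \<noteq> 0"
    then show "\<exists>g\<in>{g \<in> J. \<exists>D. homog D g}. g v \<noteq> 0"
      using G[of v] J(2) homF by (cases "F v = 0") (auto simp: Xh_def)
  qed auto
  then obtain K where K: "\<And>i. (\<lambda>v. xc i v ^ K i) \<in> J" by metis
  have "(\<lambda>v. xc i v ^ (\<Sum>i\<in>UNIV. K i)) \<in> J" for i
  proof -
    have "(\<lambda>v. xc i v ^ (\<Sum>i\<in>UNIV - {i}. K i) * xc i v ^ K i) \<in> J"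
      by (intro pideal_mult[OF J(1) _ K] polys_intros xc_polys)
    moreover have "(\<Sum>i\<in>UNIV. K i) = (\<Sum>i\<in>UNIV - {i}. K i) + K i"
      by (simp add: sum.remove[of UNIV i])
    ultimately show ?thesis by (simp add: power_add)
  qed
  then show ?thesis by blast
qed

text \<open>Where the partial derivative in direction \<open>j\<close> is nonzero, \<open>w\<close>
  becomes tangent after subtracting a multiple of the axis vector. Expanding \<open>g\<close> along
  this axis and clearing denominators leaves \<open>g\<close> itself plus terms that contain
  \<open>DF v w\<close>.\<close>

lemma partial_power_divides:
  assumes g: "g \<in> pair_polys" and 0: "\<And>v w. v \<in> Xh \<Longrightarrow> DF v w = 0 \<Longrightarrow> g (v, w) = 0"
  shows "\<exists>M. \<exists>b\<in>pair_polys. \<forall>v\<in>Xh. \<forall>w. DF v (axis j 1) ^ Suc M * g (v, w) = DF v w * b (v, w)"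
proof -
  let ?f = "\<lambda>v. DF v (axis j 1)"
  have "\<exists>P. pfam pair_coords P \<and> (\<forall>t s. poly (P s) t = g (fst s, snd s + t *s axis j 1))"
    using g unfolding pair_polys_def
  proof (rule alg_gen_pfam)
    fix b :: "(complex^'n) \<times> (complex^'n) \<Rightarrow> complex" assume "b \<in> pair_coords"
    then consider i where "b = (\<lambda>p. fst p $ i)" | i where "b = (\<lambda>p. snd p $ i)" by auto
    then show "\<exists>f g. f \<in> alg_gen pair_coords \<and> g \<in> alg_gen pair_coords \<and>
        (\<forall>t s. b (fst s, snd s + t *s axis j 1) = f s + t * g s)"
    proof cases
      case (1 i)
      then show ?thesis
        by (intro exI[of _ "\<lambda>s. fst s $ i"] exI[of _ "\<lambda>_. 0"]) (auto intro: alg_gen.intros)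
    next
      case (2 i)
      then show ?thesis
        by (intro exI[of _ "\<lambda>s. snd s $ i"] exI[of _ "\<lambda>_. axis j 1 $ i"]) (auto intro: alg_gen.intros)
    qed
  qed
  then obtain P where P: "pfam pair_coords P" "\<And>t s. poly (P s) t = g (fst s, snd s + t *s axis j 1)"
    by blast
  then obtain M where M: "\<And>s. degree (P s) \<le> M" by (auto simp: pfam_def)
  define c where "c = (\<lambda>k s. coeff (P s) k)"
  have c: "c k \<in> pair_polys" for k
    unfolding c_def pair_polys_def by (rule pfamD[OF P(1)])
  \<comment> \<open>The terms of positive index with one factor \<open>DF\<close> removed. The
    leading factor matches the exponent \<open>Suc M\<close> and makes the claim trivial where the
    partial derivative vanishes.\<close>
  define b where "b = (\<lambda>s. - (?f (fst s) * (\<Sum>k=1..M. c k s * ?f (fst s) ^ (M - k) * ((-1) ^ k * DF (fst s) (snd s) ^ (k - 1)))))"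
  have b: "b \<in> pair_polys"
    unfolding b_def by (intro pair_polys_intros c polys_comp_fst DF_polys DF_pair_polys)
  have "?f v ^ Suc M * g (v, w) = DF v w * b (v, w)" if v: "v \<in> Xh" for v w
  proof (cases "?f v = 0")
    case False
    define a where "a = - (DF v w / ?f v)"
    have "DF v (w + a *s axis j 1) = 0"
      using False unfolding dir_deriv_add[OF F_polys] dir_deriv_scale[OF F_polys] by (simp add: a_def)
    then have "0 = poly (P (v, w)) a" using 0[OF v] by (simp add: P(2))
    also have "\<dots> = (\<Sum>k\<le>M. c k (v, w) * a ^ k)" unfolding c_def by (rule poly_eq_sum[OF M])
    finally have "0 = ?f v ^ M * (\<Sum>k\<le>M. c k (v, w) * a ^ k)" by simp
    also have "\<dots> = (\<Sum>k\<le>M. c k (v, w) * ?f v ^ (M - k) * ((-1) ^ k * DF v w ^ k))"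
      unfolding sum_distrib_left
    proof (rule sum.cong)
      fix k assume "k \<in> {..M}"
      then have "?f v ^ M = ?f v ^ (M - k) * ?f v ^ k" by (simp flip: power_add)
      then show "?f v ^ M * (c k (v, w) * a ^ k) = c k (v, w) * ?f v ^ (M - k) * ((-1) ^ k * DF v w ^ k)"
        using False by (simp add: a_def power_minus[of "DF v w / _"] power_divide)
    qed auto
    also have "{..M} = insert 0 {1..M}" by auto
    also have "(\<Sum>k\<in>\<dots>. c k (v, w) * ?f v ^ (M - k) * ((-1) ^ k * DF v w ^ k))
      = c 0 (v, w) * ?f v ^ M + (\<Sum>k=1..M. c k (v, w) * ?f v ^ (M - k) * ((-1) ^ k * DF v w ^ k))"
      by (subst sum.insert) auto
    also have "c 0 (v, w) = g (v, w)" using P(2)[of "(v, w)" 0] by (simp add: c_def poly_0_coeff_0)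
    also have "(\<Sum>k=1..M. c k (v, w) * ?f v ^ (M - k) * ((-1) ^ k * DF v w ^ k))
      = DF v w * (\<Sum>k=1..M. c k (v, w) * ?f v ^ (M - k) * ((-1) ^ k * DF v w ^ (k - 1)))"
      unfolding sum_distrib_left
      by (intro sum.cong) (auto simp: power_eq_if[of "DF v w"])
    finally have *: "g (v, w) * ?f v ^ M
        = - (DF v w * (\<Sum>k=1..M. c k (v, w) * ?f v ^ (M - k) * ((-1) ^ k * DF v w ^ (k - 1))))"
      by (simp add: eq_neg_iff_add_eq_0)
    have "?f v ^ Suc M * g (v, w) = ?f v * (g (v, w) * ?f v ^ M)" by simp
    also have "\<dots> = DF v w * b (v, w)" unfolding * by (simp add: b_def)
    finally show ?thesis .
  qed (simp add: b_def)
  with b show ?thesis by blast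
qed

text \<open>A colon ideal: \<open>R\<close> stands for a module of functions over the polynomials,
  and the polynomials that carry \<open>g\<close> into it are collected.\<close>

lemma pideal_quotients:
  fixes R :: "(complex^'n \<Rightarrow> complex^'n \<Rightarrow> complex) \<Rightarrow> bool"
  assumes "R (\<lambda>_ _. 0)"
    and "\<And>f g. R f \<Longrightarrow> R g \<Longrightarrow> R (\<lambda>v w. f v w + g v w)"
    and "\<And>a f. a \<in> polys \<Longrightarrow> R f \<Longrightarrow> R (\<lambda>v w. a v * f v w)"
  shows "pideal {p \<in> polys. R (\<lambda>v w. p v * g v w)}"
proof (rule pidealI)
  fix p q assume "p \<in> {p \<in> polys. R (\<lambda>v w. p v * g v w)}" "q \<in> {p \<in> polys. R (\<lambda>v w. p v * g v w)}"
  then have "R (\<lambda>v w. p v * g v w + q v * g v w)" "(\<lambda>v. p v + q v) \<in> polys"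
    using assms(2) polys_intros(2) by blast+
  then show "(\<lambda>v. p v + q v) \<in> {p \<in> polys. R (\<lambda>v w. p v * g v w)}"
    by (simp add: distrib_right)
next
  fix a p :: "complex^'n \<Rightarrow> complex" assume "a \<in> polys" "p \<in> {p \<in> polys. R (\<lambda>v w. p v * g v w)}"
  then have "R (\<lambda>v w. a v * (p v * g v w))" "(\<lambda>v. a v * p v) \<in> polys"
    using assms(3) polys_intros(3) by blast+
  then show "(\<lambda>v. a v * p v) \<in> {p \<in> polys. R (\<lambda>v w. p v * g v w)}"
    unfolding mem_Collect_eq mult.assoc by blast
next
  show "(\<lambda>_. 0) \<in> {p \<in> polys. R (\<lambda>v w. p v * g v w)}" using assms(1) polys_intros(1)[of 0] by simp
qed auto

text \<open>Some partial derivative is nonzero at each point, so its powers, and then powers of the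
  \<open>xc i\<close>, give local quotients by \<open>DF\<close>. After cancelling \<open>DF\<close>
  these agree for \<open>i1\<close> and \<open>i2\<close>, and regularity of the two coordinates
  glues them.\<close>

lemma tangent_divisible:
  assumes g: "g \<in> pair_polys" and 0: "\<And>v w. v \<in> Xh \<Longrightarrow> DF v w = 0 \<Longrightarrow> g (v, w) = 0"
  shows "\<exists>b\<in>pair_polys. \<forall>v\<in>Xh. \<forall>w. g (v, w) = DF v w * b (v, w)"
proof -
  define R where "R f \<longleftrightarrow> (\<exists>b\<in>pair_polys. \<forall>v\<in>Xh. \<forall>w. f v w = DF v w * b (v, w))" for f
  define J where "J = {p \<in> polys. R (\<lambda>v w. p v * g (v, w))}"
  have "pideal J"
    unfolding J_def
  proof (rule pideal_quotients)
    show "R (\<lambda>_ _. 0)" unfolding R_def by (intro bexI[of _ "\<lambda>_. 0"]) (auto intro: pair_polys_intros)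
  next
    fix f h assume "R f" "R h"
    then obtain b c where "b \<in> pair_polys" "c \<in> pair_polys" "\<forall>v\<in>Xh. \<forall>w. f v w = DF v w * b (v, w)"
      "\<forall>v\<in>Xh. \<forall>w. h v w = DF v w * c (v, w)" by (auto simp: R_def)
    then show "R (\<lambda>v w. f v w + h v w)"
      unfolding R_def
      by (intro bexI[of _ "\<lambda>s. b s + c s"]) (auto simp: algebra_simps intro: pair_polys_intros)
  next
    fix a :: "complex^'n \<Rightarrow> complex" and f assume "a \<in> polys" "R f"
    then obtain b where "b \<in> pair_polys" "\<forall>v\<in>Xh. \<forall>w. f v w = DF v w * b (v, w)" by (auto simp: R_def)
    then show "R (\<lambda>v w. a v * f v w)"
      unfolding R_def using \<open>a \<in> polys\<close>
      by (intro bexI[of _ "\<lambda>s. a (fst s) * b s"]) (auto intro: pair_polys_intros polys_comp_fst)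
  qed
  moreover have "F \<in> J"
    unfolding J_def R_def using F_polys
    by (auto intro!: bexI[of _ "\<lambda>_. 0"] pair_polys_intros simp: Xh_def)
  moreover have "\<exists>q\<in>J. (\<exists>D. homog D q) \<and> q v \<noteq> 0" if v: "v \<in> Xh" for v
  proof -
    obtain w where "DF v w \<noteq> 0" using nonsingular[OF v] by blast
    then have "(\<Sum>j\<in>UNIV. DF v (axis j 1) * w $ j) \<noteq> 0"
      using dir_deriv_sum_axis[OF F_polys, of v w] by simp
    then obtain j where "DF v (axis j 1) * w $ j \<noteq> 0" by (rule sum.not_neutral_contains_not_neutral)
    then have j: "DF v (axis j 1) \<noteq> 0" by simp
    obtain M b where "b \<in> pair_polys"
      "\<forall>v\<in>Xh. \<forall>w. DF v (axis j 1) ^ Suc M * g (v, w) = DF v w * b (v, w)"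
      using partial_power_divides[OF g 0, of j] by blast
    then have "(\<lambda>v. DF v (axis j 1) ^ Suc M) \<in> J"
      unfolding J_def R_def by (intro CollectI conjI polys_intros(6) DF_polys) blast
    moreover have "homog ((d - 1) * Suc M) (\<lambda>v. DF v (axis j 1) ^ Suc M)"
      unfolding homog_def
      by (intro conjI polys_intros(6) DF_polys)
         (simp only: homog_scale[OF homog_DF] power_mult_distrib power_mult, simp)
    ultimately show ?thesis using j by (intro bexI[of _ "\<lambda>v. DF v (axis j 1) ^ Suc M"]) auto
  qed
  ultimately obtain K where K: "\<And>i. (\<lambda>v. xc i v ^ K) \<in> J" using xc_power_in_ideal by blast
  then have "R (\<lambda>v w. xc i v ^ K * g (v, w))" for i by (simp add: J_def)
  then obtain b where b: "\<And>i. b i \<in> pair_polys"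
    "\<And>i v w. v \<in> Xh \<Longrightarrow> xc i v ^ K * g (v, w) = DF v w * b i (v, w)"
    unfolding R_def by metis
  have "xc i2 v ^ K * b i1 (v, w) - xc i1 v ^ K * b i2 (v, w) = 0" if "v \<in> Xh" for v w
  proof -
    define h where "h = (\<lambda>s. xc i2 (fst s) ^ K * b i1 s - xc i1 (fst s) ^ K * b i2 s)"
    have "h \<in> pair_polys" unfolding h_def by (intro pair_polys_intros(5) pair_polys_intros(3) xc_power_polys b)
    moreover have "DF v w * h (v, w) = 0" if "v \<in> Xh" for v w
    proof -
      have "DF v w * h (v, w) = xc i2 v ^ K * (DF v w * b i1 (v, w)) - xc i1 v ^ K * (DF v w * b i2 (v, w))"
        by (simp add: h_def algebra_simps)
      then show ?thesis by (simp only: b(2)[OF that, symmetric]) simp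
    qed
    ultimately show ?thesis using DF_cancel[of h v w] \<open>v \<in> Xh\<close> by (simp add: h_def)
  qed
  then have "\<exists>r\<in>pair_polys. \<forall>v\<in>Xh. \<forall>w. b i1 (v, w) = xc i1 v ^ K * r (v, w)"
    using dist by (intro regular2_X[of i2 i1 "b i1" "b i2"] b) auto
  then obtain r where r: "r \<in> pair_polys" "\<And>v w. v \<in> Xh \<Longrightarrow> b i1 (v, w) = xc i1 v ^ K * r (v, w)" by blast
  have "g (v, w) - DF v w * r (v, w) = 0" if "v \<in> Xh" for v w
  proof -
    have "(\<lambda>s. g s - DF (fst s) (snd s) * r s) \<in> pair_polys"
      by (intro pair_polys_intros(5) pair_polys_intros(3) g r DF_pair_polys)
    moreover have "xc i1 v ^ K * (g (v, w) - DF v w * r (v, w)) = 0" if "v \<in> Xh" for v w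
      using b(2)[OF that, of i1 w] r(2)[OF that, of w] by (simp add: right_diff_distrib)
    ultimately show ?thesis
      using regular1_X[of i1 "\<lambda>s. g s - DF (fst s) (snd s) * r s" K v w] dist that by auto
  qed
  then show ?thesis using r(1) by (intro bexI[of _ r]) auto
qed

text \<open>
  The function has numerators over powers of each of \<open>xc i1, xc i2, xc i3\<close>. On the hypersurface, two of
  them differ by a multiple of \<open>DF\<close> after cross-multiplication; the multipliers form a Cech cocycle,
  which splits because the three coordinates form a regular sequence. This is the
  vanishing of \<open>H\<^sup>1(X, O(k))\<close> for \<open>dim X \<ge> 2\<close>.
\<close>

lemma tangent_function_polynomial:
  assumes "\<And>v. v \<in> Xh \<Longrightarrow> \<exists>g D. homog D g \<and> g v \<noteq> 0 \<and>
      (\<exists>A\<in>pair_polys. \<forall>v\<in>Xh. \<forall>w. DF v w = 0 \<longrightarrow> g v * \<sigma> v w = A (v, w))"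
  shows "\<exists>P\<in>pair_polys. \<forall>v\<in>Xh. \<forall>w. DF v w = 0 \<longrightarrow> xc i1 v \<noteq> 0 \<longrightarrow> \<sigma> v w = P (v, w)"
proof -
  define R where "R f \<longleftrightarrow> (\<exists>A\<in>pair_polys. \<forall>v\<in>Xh. \<forall>w. DF v w = 0 \<longrightarrow> f v w = A (v, w))" for f
  define J where "J = {p \<in> polys. R (\<lambda>v w. p v * \<sigma> v w)}"
  have "pideal J"
    unfolding J_def
  proof (rule pideal_quotients)
    show "R (\<lambda>_ _. 0)" unfolding R_def by (intro bexI[of _ "\<lambda>_. 0"]) (auto intro: pair_polys_intros)
  next
    fix f h assume "R f" "R h"
    then obtain b c where "b \<in> pair_polys" "c \<in> pair_polys"
      "\<forall>v\<in>Xh. \<forall>w. DF v w = 0 \<longrightarrow> f v w = b (v, w)"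
      "\<forall>v\<in>Xh. \<forall>w. DF v w = 0 \<longrightarrow> h v w = c (v, w)" by (auto simp: R_def)
    then show "R (\<lambda>v w. f v w + h v w)"
      unfolding R_def
      by (intro bexI[of _ "\<lambda>s. b s + c s"]) (auto intro: pair_polys_intros)
  next
    fix a :: "complex^'n \<Rightarrow> complex" and f assume "a \<in> polys" "R f"
    then obtain b where "b \<in> pair_polys" "\<forall>v\<in>Xh. \<forall>w. DF v w = 0 \<longrightarrow> f v w = b (v, w)" by (auto simp: R_def)
    then show "R (\<lambda>v w. a v * f v w)"
      unfolding R_def using \<open>a \<in> polys\<close>
      by (intro bexI[of _ "\<lambda>s. a (fst s) * b s"]) (auto intro: pair_polys_intros polys_comp_fst)
  qed
  moreover have "F \<in> J"
    unfolding J_def R_def using F_polys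
    by (auto intro!: bexI[of _ "\<lambda>_. 0"] pair_polys_intros simp: Xh_def)
  moreover have "\<exists>q\<in>J. (\<exists>D. homog D q) \<and> q v \<noteq> 0" if v: "v \<in> Xh" for v
  proof -
    obtain g D where g: "homog D g" "g v \<noteq> 0"
      "\<exists>A\<in>pair_polys. \<forall>v\<in>Xh. \<forall>w. DF v w = 0 \<longrightarrow> g v * \<sigma> v w = A (v, w)"
      using assms[OF v] by blast
    then have "g \<in> J" unfolding J_def R_def using homog_polys[OF g(1)] by blast
    then show ?thesis using g(1,2) by blast
  qed
  ultimately obtain K where K: "\<And>i. (\<lambda>v. xc i v ^ K) \<in> J" using xc_power_in_ideal by blast
  then have "R (\<lambda>v w. xc i v ^ K * \<sigma> v w)" for i by (simp add: J_def)
  then obtain A where A: "\<And>i. A i \<in> pair_polys"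
    "\<And>i v w. v \<in> Xh \<Longrightarrow> DF v w = 0 \<Longrightarrow> xc i v ^ K * \<sigma> v w = A i (v, w)"
    unfolding R_def by metis
  have "\<exists>b. b \<in> pair_polys \<and>
      (\<forall>v\<in>Xh. \<forall>w. xc j v ^ K * A i (v, w) - xc i v ^ K * A j (v, w) = DF v w * b (v, w))" for i j
  proof -
    let ?h = "\<lambda>s. xc j (fst s) ^ K * A i s - xc i (fst s) ^ K * A j s"
    have h: "?h \<in> pair_polys" by (intro pair_polys_intros(5) pair_polys_intros(3) xc_power_polys A)
    have "?h (v, w) = 0" if "v \<in> Xh" "DF v w = 0" for v w
      using A(2)[OF that, of i] A(2)[OF that, of j] by (simp add: mult.left_commute flip: A(2)[OF that])
    then show ?thesis using tangent_divisible[OF h] by auto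
  qed
  note ex = this
  define b where "b i j = (SOME b. b \<in> pair_polys \<and>
      (\<forall>v\<in>Xh. \<forall>w. xc j v ^ K * A i (v, w) - xc i v ^ K * A j (v, w) = DF v w * b (v, w)))" for i j
  have b: "b i j \<in> pair_polys"
    "v \<in> Xh \<Longrightarrow> xc j v ^ K * A i (v, w) - xc i v ^ K * A j (v, w) = DF v w * b i j (v, w)" for i j v w
    using someI_ex[OF ex[of j i], folded b_def] by blast+
  have cocycle: "xc i3 v ^ K * b i1 i2 (v, w) = xc i1 v ^ K * (- b i2 i3 (v, w)) + xc i2 v ^ K * (- b i3 i1 (v, w))"
    if "v \<in> Xh" for v w
  proof -
    define h where "h = (\<lambda>s. xc i3 (fst s) ^ K * b i1 i2 s + xc i1 (fst s) ^ K * b i2 i3 s + xc i2 (fst s) ^ K * b i3 i1 s)"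
    have "h \<in> pair_polys" unfolding h_def by (intro pair_polys_intros(2) pair_polys_intros(3) xc_power_polys b)
    moreover have "DF v w * h (v, w) = 0" if "v \<in> Xh" for v w
    proof -
      have "DF v w * h (v, w) = xc i3 v ^ K * (DF v w * b i1 i2 (v, w))
          + xc i1 v ^ K * (DF v w * b i2 i3 (v, w)) + xc i2 v ^ K * (DF v w * b i3 i1 (v, w))"
        by (simp add: h_def algebra_simps)
      then show ?thesis by (simp only: b(2)[OF that, symmetric]) (simp add: algebra_simps)
    qed
    ultimately have "h (v, w) = 0" using DF_cancel[of h v w] \<open>v \<in> Xh\<close> by simp
    then show ?thesis by (simp add: h_def algebra_simps eq_neg_iff_add_eq_0)
  qed
  have "\<exists>r\<in>pair_polys. \<exists>r'\<in>pair_polys. \<forall>v\<in>Xh. \<forall>w.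
      b i1 i2 (v, w) = xc i1 v ^ K * r (v, w) + xc i2 v ^ K * r' (v, w)"
    using dist cocycle
    by (intro regular3_X[of i1 i2 i3 "b i1 i2" "\<lambda>s. - b i2 i3 s" "\<lambda>s. - b i3 i1 s"] b pair_polys_intros(4)) auto
  then obtain r r' where r: "r \<in> pair_polys" "r' \<in> pair_polys"
    "\<And>v w. v \<in> Xh \<Longrightarrow> b i1 i2 (v, w) = xc i1 v ^ K * r (v, w) + xc i2 v ^ K * r' (v, w)" by blast
  \<comment> \<open>Both numerators are changed by multiples of \<open>DF\<close>, so they still
    represent the function on tangent pairs; with the splitting of \<open>b i1 i2\<close> they now
    agree on the whole cone after cross-multiplication.\<close>
  define B where "B = (\<lambda>s. A i1 s - DF (fst s) (snd s) * r' s)"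
  define C where "C = (\<lambda>s. A i2 s + DF (fst s) (snd s) * r s)"
  have BC: "B \<in> pair_polys" "C \<in> pair_polys"
    unfolding B_def C_def by (intro pair_polys_intros(5,2) pair_polys_intros(3) A r DF_pair_polys)+
  have "xc i2 v ^ K * B (v, w) = xc i1 v ^ K * C (v, w)" if "v \<in> Xh" for v w
  proof -
    have "xc i2 v ^ K * B (v, w) - xc i1 v ^ K * C (v, w) = (xc i2 v ^ K * A i1 (v, w) - xc i1 v ^ K * A i2 (v, w))
        - DF v w * (xc i1 v ^ K * r (v, w) + xc i2 v ^ K * r' (v, w))"
      by (simp add: B_def C_def algebra_simps)
    also have "\<dots> = 0" by (simp add: b(2)[OF that] r(3)[OF that])
    finally show ?thesis by simp
  qed
  then have "\<exists>P\<in>pair_polys. \<forall>v\<in>Xh. \<forall>w. B (v, w) = xc i1 v ^ K * P (v, w)"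
    using dist by (intro regular2_X[of i2 i1 B C] BC) auto
  then obtain P where P: "P \<in> pair_polys" "\<And>v w. v \<in> Xh \<Longrightarrow> B (v, w) = xc i1 v ^ K * P (v, w)" by blast
  have "\<sigma> v w = P (v, w)" if "v \<in> Xh" "DF v w = 0" "xc i1 v \<noteq> 0" for v w
    using A(2)[OF that(1,2), of i1] P(2)[OF that(1), of w] that by (simp add: B_def)
  with P(1) show ?thesis by blast
qed

text \<open>If the polar of \<open>z\<close> missed \<open>X\<close>, the form \<open>DF v z\<close>
  would be invertible on the cone: the Nullstellensatz inverts it up to powers of coordinates, and
  regularity removes these. A form of positive degree \<open>d - 1\<close> vanishes at the origin,
  so the constant term contradicts this.\<close>

lemma polar_nonempty: "\<exists>v\<in>Xh. DF v z = 0"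
proof (rule ccontr)
  assume *: "\<not> ?thesis"
  define R where "R f \<longleftrightarrow> (\<exists>b\<in>polys. \<forall>v\<in>Xh. \<forall>w::complex^'n. f v w = DF v z * b v)" for f
  define J where "J = {p \<in> polys. R (\<lambda>v w. p v * 1)}"
  have "pideal J"
    unfolding J_def
  proof (rule pideal_quotients)
    show "R (\<lambda>_ _. 0)" unfolding R_def by (intro bexI[of _ "\<lambda>_. 0"]) (auto intro: polys_intros)
  next
    fix f h assume "R f" "R h"
    then obtain b c where "b \<in> polys" "c \<in> polys" "\<forall>v\<in>Xh. \<forall>w. f v w = DF v z * b v"
      "\<forall>v\<in>Xh. \<forall>w. h v w = DF v z * c v" by (auto simp: R_def)
    then show "R (\<lambda>v w. f v w + h v w)"
      unfolding R_def
      by (intro bexI[of _ "\<lambda>s. b s + c s"]) (auto simp: algebra_simps intro: polys_intros)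
  next
    fix a :: "complex^'n \<Rightarrow> complex" and f assume "a \<in> polys" "R f"
    then obtain b where "b \<in> polys" "\<forall>v\<in>Xh. \<forall>w. f v w = DF v z * b v" by (auto simp: R_def)
    then show "R (\<lambda>v w. a v * f v w)"
      unfolding R_def using \<open>a \<in> polys\<close>
      by (intro bexI[of _ "\<lambda>s. a s * b s"]) (auto intro: polys_intros)
  qed
  moreover have "F \<in> J"
    unfolding J_def R_def using F_polys
    by (auto intro!: bexI[of _ "\<lambda>_. 0"] polys_intros simp: Xh_def)
  moreover have "(\<lambda>v. DF v z) \<in> J"
    unfolding J_def R_def by (auto intro!: bexI[of _ "\<lambda>_. 1"] polys_intros DF_polys)
  then have "\<exists>q\<in>J. (\<exists>D. homog D q) \<and> q v \<noteq> 0" if v: "v \<in> Xh" for v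
    using homog_DF[of z] * that by blast
  ultimately obtain K where K: "\<And>i. (\<lambda>v. xc i v ^ K) \<in> J" using xc_power_in_ideal by blast
  then have "R (\<lambda>v w. xc i v ^ K)" for i by (simp add: J_def)
  then obtain b where b: "\<And>i. b i \<in> polys" "\<And>i v. v \<in> Xh \<Longrightarrow> xc i v ^ K = DF v z * b i v"
    unfolding R_def by metis
  have "xc i2 v ^ K * b i1 v = xc i1 v ^ K * b i2 v" if "v \<in> Xh" for v
    by (simp add: b(2)[OF that])
  then have "\<exists>r\<in>pair_polys. \<forall>v\<in>Xh. \<forall>w. b i1 (fst (v, w)) = xc i1 v ^ K * r (v, w)"
    using dist by (intro regular2_X[of i2 i1 "\<lambda>s. b i1 (fst s)" "\<lambda>s. b i2 (fst s)"] polys_comp_fst b) auto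
  then obtain r where r: "r \<in> pair_polys" "\<And>v w. v \<in> Xh \<Longrightarrow> b i1 v = xc i1 v ^ K * r (v, w)" by auto
  define p where "p = (\<lambda>v. 1 - DF v z * r (v, 0))"
  have p: "p \<in> polys"
    unfolding p_def by (intro polys_intros DF_polys pair_polys_at r)
  have "xc i1 v ^ K * p v = 0" if "v \<in> Xh" for v
    using b(2)[OF that, of i1] r(2)[OF that, of 0] by (simp add: p_def right_diff_distrib mult.left_commute)
  then have "p v = 0" if "v \<in> Xh" for v
    using regular1_X[of i1 "\<lambda>s. p (fst s)" K v 0] dist that polys_comp_fst[OF p] by auto
  \<comment> \<open>The origin is not in \<open>Xh\<close>; the constant component of
    \<open>p\<close> reaches it.\<close>
  then have "hom_part p 0 v = 0" if "v \<in> Xh" for v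
    using hom_part_vanish[OF p] that by blast
  moreover have "hom_part p 0 v = p 0" for v by (simp add: hom_part_def coeff_line_poly_0[OF p])
  moreover have "DF 0 z = 0" using homog_scale[OF homog_DF, of 0 0 z] d2 by (simp add: power_0_left)
  ultimately show False using Xh_nonempty by (auto simp: p_def)
qed

end

section \<open>Twisted symmetric differentials in coordinates\<close>

lemma dir_deriv_quotient:
  assumes p: "p \<in> polys" and q: "q \<in> polys" and v: "q v \<noteq> 0"
  shows "dir_deriv (\<lambda>u. p u / q u) v w = (dir_deriv p v w * q v - p v * dir_deriv q v w) / (q v)\<^sup>2"
proof -
  let ?P = "line_poly p v w" and ?Q = "line_poly q v w"
  have "((\<lambda>t. poly ?P t / poly ?Q t) has_field_derivative
      (poly (pderiv ?P) 0 * poly ?Q 0 - poly ?P 0 * poly (pderiv ?Q) 0) / (poly ?Q 0 * poly ?Q 0)) (at 0)"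
    using v by (intro DERIV_divide poly_DERIV) (simp add: poly_line_poly[OF q])
  then have "deriv (\<lambda>t. p (v + t *s w) / q (v + t *s w)) 0
      = (poly (pderiv ?P) 0 * poly ?Q 0 - poly ?P 0 * poly (pderiv ?Q) 0) / (poly ?Q 0 * poly ?Q 0)"
    by (simp add: DERIV_imp_deriv poly_line_poly[OF p] poly_line_poly[OF q])
  moreover have "poly (pderiv ?P) 0 = dir_deriv p v w" "poly (pderiv ?Q) 0 = dir_deriv q v w"
    by (simp_all add: dir_deriv_line_poly p q poly_0_coeff_0 coeff_pderiv)
  ultimately show ?thesis
    by (simp add: dir_deriv_def[of "\<lambda>u. p u / q u"] poly_line_poly[OF p] poly_line_poly[OF q] power2_eq_square)
qed

text \<open>The factor \<open>c\<close> on the left avoids an exponent \<open>k - 1\<close>, which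
  would be wrong for \<open>k = 0\<close>.\<close>

lemma dir_deriv_scale_point:
  assumes p: "homog k p"
  shows "c * dir_deriv p (c *s v) (b *s w + l *s v) = c ^ k * (b * dir_deriv p v w + l * of_nat k * p v)"
proof -
  note pp = homog_polys[OF p]
  have "c * dir_deriv p (c *s v) u = c ^ k * dir_deriv p v u" for u
    using line_poly_homog_scale[OF p, of c v u] coeff_line_poly_scale_snd[OF pp, of "c *s v" c u 1]
    by (simp add: dir_deriv_line_poly[OF pp])
  then show ?thesis
    by (simp only:) (simp add: dir_deriv_add[OF pp] dir_deriv_scale[OF pp] euler[OF p])
qed

text \<open>Numerator and denominator have equal degree, so their Euler terms cancel: the
  differential sees only the tangent vector of projective space that \<open>w\<close> represents,
  not the multiple of \<open>v\<close> added to it.\<close>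

lemma dir_deriv_quotient_scale:
  assumes p: "homog k p" and q: "homog k q" and v: "q v \<noteq> 0" and c: "c \<noteq> 0"
  shows "c * dir_deriv (\<lambda>u. p u / q u) (c *s v) (b *s w + l *s v) = b * dir_deriv (\<lambda>u. p u / q u) v w"
proof -
  note pp = homog_polys[OF p] homog_polys[OF q]
  have "q (c *s v) \<noteq> 0" using v c homog_scale[OF q] by simp
  then have "c * dir_deriv (\<lambda>u. p u / q u) (c *s v) (b *s w + l *s v)
    = ((c * dir_deriv p (c *s v) (b *s w + l *s v)) * q (c *s v)
      - p (c *s v) * (c * dir_deriv q (c *s v) (b *s w + l *s v))) / (q (c *s v))\<^sup>2"
    by (simp add: dir_deriv_quotient[OF pp] algebra_simps)
  also have "\<dots> = ((c ^ k * (b * dir_deriv p v w + l * of_nat k * p v)) * (c ^ k * q v)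
      - (c ^ k * p v) * (c ^ k * (b * dir_deriv q v w + l * of_nat k * q v))) / (c ^ k * q v)\<^sup>2"
    by (simp only: dir_deriv_scale_point[OF p] dir_deriv_scale_point[OF q] homog_scale[OF p] homog_scale[OF q])
  also have "\<dots> = ((c ^ k)\<^sup>2 * (b * (dir_deriv p v w * q v - p v * dir_deriv q v w))) / ((c ^ k)\<^sup>2 * (q v)\<^sup>2)"
    by (simp add: algebra_simps power2_eq_square)
  also have "\<dots> = b * ((dir_deriv p v w * q v - p v * dir_deriv q v w) / (q v)\<^sup>2)"
    using c by simp
  finally show ?thesis by (simp only: dir_deriv_quotient[OF pp v])
qed

context smooth_hypersurface
begin

lemma tangent_pairs_iff:
  assumes "U \<subseteq> X"
  shows "(v, w) \<in> tangent_pairs X U \<longleftrightarrow> v \<in> Xh \<and> vec.span {v} \<in> U \<and> DF v w = 0"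
proof
  assume "(v, w) \<in> tangent_pairs X U"
  then obtain y where "y \<in> U" "v \<in> y - {0}" "w \<in> tangent_cone X y" by (auto simp: tangent_pairs_def)
  then show "v \<in> Xh \<and> vec.span {v} \<in> U \<and> DF v w = 0"
    using X_Xh[of y v] tangent_cone_iff[of v w] assms by auto
next
  assume "v \<in> Xh \<and> vec.span {v} \<in> U \<and> DF v w = 0"
  then show "(v, w) \<in> tangent_pairs X U"
    using tangent_cone_iff[of v w] span1_self[of v] by (auto simp: tangent_pairs_def Xh_def)
qed

text \<open>Regularity near \<open>v0\<close> in global terms: the denominator depends on
  \<open>v\<close> alone, and the equation is required on the whole cone, also where
  \<open>g\<close> vanishes. This is the form that \<open>tangent_function_polynomial\<close>
  consumes.\<close>

definition loc :: "(complex^'n \<Rightarrow> complex^'n \<Rightarrow> complex) \<Rightarrow> complex^'n \<Rightarrow> bool" where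
  "loc \<sigma> v0 \<longleftrightarrow> (\<exists>g D. homog D g \<and> g v0 \<noteq> 0 \<and>
     (\<exists>A\<in>pair_polys. \<forall>v\<in>Xh. \<forall>w. DF v w = 0 \<longrightarrow> g v * \<sigma> v w = A (v, w)))"

lemma locI:
  assumes "homog D g" "g v0 \<noteq> 0" "A \<in> pair_polys"
    "\<And>v w. v \<in> Xh \<Longrightarrow> DF v w = 0 \<Longrightarrow> g v * \<sigma> v w = A (v, w)"
  shows "loc \<sigma> v0"
  using assms unfolding loc_def by blast

lemma locE:
  assumes "loc \<sigma> v0"
  obtains g D A where "homog D g" "g v0 \<noteq> 0" "A \<in> pair_polys"
    "\<And>v w. v \<in> Xh \<Longrightarrow> DF v w = 0 \<Longrightarrow> g v * \<sigma> v w = A (v, w)"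
  using assms unfolding loc_def by blast

text \<open>Multiplying by an equation \<open>H\<close> that vanishes off \<open>W\<close> but not
  at \<open>v0\<close> makes a local identity hold everywhere on the cone.\<close>

lemma locI_open:
  assumes W: "open_in X W" "vec.span {v0} \<in> W" and g: "homog D g" "g v0 \<noteq> 0" and A: "A \<in> pair_polys"
    and eq: "\<And>v w. v \<in> Xh \<Longrightarrow> vec.span {v} \<in> W \<Longrightarrow> DF v w = 0 \<Longrightarrow> g v * \<sigma> v w = A (v, w)"
  shows "loc \<sigma> v0"
proof -
  obtain Z where Z: "zariski_closed Z" "W = X - Z" using W by (auto simp: open_in_def)
  then obtain S where S: "\<forall>H\<in>S. \<exists>d. homog d H" "Z = {x \<in> proj_space. \<forall>H\<in>S. vanishes_on H {x}}"
    by (auto simp: zariski_closed_def)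
  have "vec.span {v0} \<in> proj_space" using W(2) Z by (auto simp: X_eq)
  then obtain H where H: "H \<in> S" "\<not> vanishes_on H {vec.span {v0}}" using W(2) Z S by auto
  then obtain k where k: "homog k H" using S by auto
  obtain c where "H (c *s v0) \<noteq> 0" using H(2) by (auto simp: vanishes_on_def mem_span1)
  then have Hv0: "H v0 \<noteq> 0" using homog_scale[OF k] by auto
  have "(H v * g v) * \<sigma> v w = H v * A (v, w)" if v: "v \<in> Xh" "DF v w = 0" for v w
  proof (cases "vec.span {v} \<in> W")
    case True
    then show ?thesis using eq[OF v(1) True v(2)] by simp
  next
    case False
    then have "vec.span {v} \<in> Z" using span1_in_X[OF v(1)] Z by auto
    then have "H v = 0" using S H(1) span1_self[of v] by (auto simp: vanishes_on_def)
    then show ?thesis by simp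
  qed
  moreover have "(\<lambda>s. H (fst s) * A s) \<in> pair_polys"
    by (intro pair_polys_intros(3) polys_comp_fst homog_polys[OF k] A)
  ultimately show ?thesis
    using homog_mult[OF k g(1)] Hv0 g(2)
    by (intro locI[of "k + D" "\<lambda>v. H v * g v" v0 "\<lambda>s. H (fst s) * A s"]) auto
qed

lemma loc_cong_open:
  assumes W: "open_in X W" "vec.span {v0} \<in> W" and \<sigma>': "loc \<sigma>' v0"
    and eq: "\<And>v w. v \<in> Xh \<Longrightarrow> vec.span {v} \<in> W \<Longrightarrow> DF v w = 0 \<Longrightarrow> \<sigma> v w = \<sigma>' v w"
  shows "loc \<sigma> v0"
  using \<sigma>'
proof (rule locE)
  fix g D A assume "homog D g" "g v0 \<noteq> 0" "A \<in> pair_polys"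
    "\<And>v w. v \<in> Xh \<Longrightarrow> DF v w = 0 \<Longrightarrow> g v * \<sigma>' v w = A (v, w)"
  then show "loc \<sigma> v0" using eq by (intro locI_open[OF W]) auto
qed

lemma loc_const: "loc (\<lambda>_ _. c) v0"
  by (rule locI[where g = "\<lambda>_. 1" and D = 0 and A = "\<lambda>_. c"]) (auto intro: homog_const pair_polys_intros(1))

lemma loc_add: assumes "loc \<sigma> v0" "loc \<rho> v0" shows "loc (\<lambda>v w. \<sigma> v w + \<rho> v w) v0"
proof -
  obtain g D A h E B where *: "homog D g" "g v0 \<noteq> 0" "A \<in> pair_polys" "homog E h" "h v0 \<noteq> 0" "B \<in> pair_polys"
    "\<And>v w. v \<in> Xh \<Longrightarrow> DF v w = 0 \<Longrightarrow> g v * \<sigma> v w = A (v, w)"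
    "\<And>v w. v \<in> Xh \<Longrightarrow> DF v w = 0 \<Longrightarrow> h v * \<rho> v w = B (v, w)"
    using assms by (elim locE) blast
  have "(g v * h v) * (\<sigma> v w + \<rho> v w) = h v * A (v, w) + g v * B (v, w)" if "v \<in> Xh" "DF v w = 0" for v w
    unfolding *(7)[OF that, symmetric] *(8)[OF that, symmetric] by (simp add: algebra_simps)
  moreover have "(\<lambda>s. h (fst s) * A s + g (fst s) * B s) \<in> pair_polys"
    by (intro pair_polys_intros(2,3) polys_comp_fst homog_polys[OF *(1)] homog_polys[OF *(4)] *(3,6))
  ultimately show ?thesis
    using * by (intro locI[OF homog_mult[OF *(1,4)], of _ "\<lambda>s. h (fst s) * A s + g (fst s) * B s"]) auto
qed

lemma loc_mult: assumes "loc \<sigma> v0" "loc \<rho> v0" shows "loc (\<lambda>v w. \<sigma> v w * \<rho> v w) v0"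
proof -
  obtain g D A h E B where *: "homog D g" "g v0 \<noteq> 0" "A \<in> pair_polys" "homog E h" "h v0 \<noteq> 0" "B \<in> pair_polys"
    "\<And>v w. v \<in> Xh \<Longrightarrow> DF v w = 0 \<Longrightarrow> g v * \<sigma> v w = A (v, w)"
    "\<And>v w. v \<in> Xh \<Longrightarrow> DF v w = 0 \<Longrightarrow> h v * \<rho> v w = B (v, w)"
    using assms by (elim locE) blast
  have "(g v * h v) * (\<sigma> v w * \<rho> v w) = A (v, w) * B (v, w)" if "v \<in> Xh" "DF v w = 0" for v w
    unfolding *(7)[OF that, symmetric] *(8)[OF that, symmetric] by (simp add: algebra_simps)
  moreover have "(\<lambda>s. A s * B s) \<in> pair_polys" by (intro pair_polys_intros(3) *(3,6))
  ultimately show ?thesis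
    using * by (intro locI[OF homog_mult[OF *(1,4)], of _ "\<lambda>s. A s * B s"]) auto
qed

lemma loc_sum: "(\<And>k. k \<in> I \<Longrightarrow> loc (\<sigma> k) v0) \<Longrightarrow> loc (\<lambda>v w. \<Sum>k\<in>I. \<sigma> k v w) v0"
  by (induction I rule: infinite_finite_induct) (auto intro: loc_const loc_add)

lemma loc_prod: "(\<And>k. k \<in> I \<Longrightarrow> loc (\<sigma> k) v0) \<Longrightarrow> loc (\<lambda>v w. \<Prod>k\<in>I. \<sigma> k v w) v0"
  by (induction I rule: infinite_finite_induct) (auto intro: loc_const loc_mult)

lemma O_sections_local:
  assumes s: "s \<in> O_sections k X U" and v0: "v0 \<in> Xh" "vec.span {v0} \<in> U"
  shows "loc (\<lambda>v w. s v) v0" and "c \<noteq> 0 \<Longrightarrow> s (c *s v0) = c ^ k * s v0"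
proof -
  obtain W D p q where W: "open_in X W" "vec.span {v0} \<in> W" "homog (D + k) p" "homog D q"
    "\<And>y v. y \<in> W \<Longrightarrow> v \<in> y - {0} \<Longrightarrow> q v \<noteq> 0 \<and> s v = p v / q v"
    using s v0 unfolding O_sections_def by blast
  have W': "q v \<noteq> 0 \<and> s v = p v / q v" if "v \<in> Xh" "vec.span {v} \<in> W" for v
    using W(5)[OF that(2), of v] that(1) span1_self[of v] by (auto simp: Xh_def)
  show "loc (\<lambda>v w. s v) v0"
    by (rule locI_open[OF W(1,2,4), of "\<lambda>s. p (fst s)"])
       (use W' v0 W(2) in \<open>auto intro: polys_comp_fst homog_polys[OF W(3)]\<close>)
  assume c: "c \<noteq> 0"
  have "s v0 = p v0 / q v0" "s (c *s v0) = p (c *s v0) / q (c *s v0)"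
    using W'[OF v0(1) W(2)] W'[OF Xh_scale[OF v0(1) c]] W(2) by (simp_all add: span1_eq[OF c])
  then show "s (c *s v0) = c ^ k * s v0"
    using c by (simp add: homog_scale[OF W(3)] homog_scale[OF W(4)] power_add)
qed

lemma DF_scale: 
  assumes "v \<in> Xh" "DF v w = 0" "c \<noteq> 0" shows "DF (c *s v) (b *s w + l *s v) = 0"
proof -
  have "c * DF (c *s v) (b *s w + l *s v) = 0"
    using assms unfolding dir_deriv_scale_point[OF homF] by (simp add: Xh_def)
  then show ?thesis using assms(3) by simp
qed

text \<open>In the rescaling rule the coefficient from O(1) contributes \<open>c\<close> and the
  differential contributes \<open>b / c\<close>, so no power of \<open>c\<close> survives.\<close>

lemma Omega1_sections_local:
  assumes \<omega>: "\<omega> \<in> Omega1_sections X U" and U: "U \<subseteq> X" and v0: "v0 \<in> Xh" "vec.span {v0} \<in> U"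
  shows "loc \<omega> v0"
    and "DF v0 w = 0 \<Longrightarrow> c \<noteq> 0 \<Longrightarrow> \<omega> (c *s v0) (b *s w + l *s v0) = b * \<omega> v0 w"
proof -
  obtain W r a D p q where W: "open_in X W" "vec.span {v0} \<in> W" "W \<subseteq> U" and
    apq: "\<And>k. k < (r::nat) \<Longrightarrow> a k \<in> O_sections 1 X W \<and> homog (D k) (p k) \<and> homog (D k) (q k) \<and>
           (\<forall>y\<in>W. \<forall>v\<in>y - {0}. q k v \<noteq> 0)" and
    eq: "\<forall>(v, w)\<in>tangent_pairs X W. \<omega> v w = (\<Sum>k<r. a k v * dir_deriv (\<lambda>u. p k u / q k u) v w)"
    using \<omega> v0 unfolding Omega1_sections_def by blast
  have q: "q k v \<noteq> 0" if "k < r" "v \<in> Xh" "vec.span {v} \<in> W" for k v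
    using apq[OF that(1)] that(2,3) span1_self[of v] by (auto simp: Xh_def)
  have eq': "\<omega> v w = (\<Sum>k<r. a k v * dir_deriv (\<lambda>u. p k u / q k u) v w)"
    if "v \<in> Xh" "vec.span {v} \<in> W" "DF v w = 0" for v w
    using eq that tangent_pairs_iff[of W v w] W(3) U by auto
  have dloc: "loc (\<lambda>v w. dir_deriv (\<lambda>u. p k u / q k u) v w) v0" if k: "k < r" for k
  proof -
    have pq: "homog (D k) (p k)" "homog (D k) (q k)" using apq[OF k] by auto
    note pp = homog_polys[OF pq(1)] homog_polys[OF pq(2)]
    let ?A = "\<lambda>s. dir_deriv (p k) (fst s) (snd s) * q k (fst s) - p k (fst s) * dir_deriv (q k) (fst s) (snd s)"
    have "?A \<in> pair_polys"
      by (intro pair_polys_intros(5) pair_polys_intros(3) dir_deriv_pair_polys polys_comp_fst pp)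
    then show ?thesis
      using q[OF k] v0 W(2)
      by (intro locI_open[OF W(1,2) homog_mult[OF pq(2,2)]])
         (auto simp: dir_deriv_quotient[OF pp] power2_eq_square)
  qed
  have "loc (\<lambda>v w. \<Sum>k<r. a k v * dir_deriv (\<lambda>u. p k u / q k u) v w) v0"
  proof (rule loc_sum, rule loc_mult)
    fix k assume "k \<in> {..<r}"
    then have k: "k < r" by simp
    show "loc (\<lambda>v w. a k v) v0" using O_sections_local(1)[of "a k" 1 W] apq[OF k] v0(1) W(2) by blast
    show "loc (\<lambda>v w. dir_deriv (\<lambda>u. p k u / q k u) v w) v0" by (rule dloc[OF k])
  qed
  then show "loc \<omega> v0"
    by (rule loc_cong_open[OF W(1,2)]) (rule eq')
  assume w: "DF v0 w = 0" and c: "c \<noteq> 0"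
  have "\<omega> (c *s v0) (b *s w + l *s v0)
      = (\<Sum>k<r. a k (c *s v0) * dir_deriv (\<lambda>u. p k u / q k u) (c *s v0) (b *s w + l *s v0))"
    using Xh_scale[OF v0(1) c] W(2) DF_scale[OF v0(1) w c] by (intro eq') (simp_all add: span1_eq[OF c])
  also have "\<dots> = (\<Sum>k<r. b * (a k v0 * dir_deriv (\<lambda>u. p k u / q k u) v0 w))"
  proof (rule sum.cong)
    fix k assume "k \<in> {..<r}"
    then have k: "k < r" by simp
    have "a k (c *s v0) = c * a k v0"
      using O_sections_local(2)[of "a k" 1 W v0 c] apq[OF k] v0 W(2) c by simp
    then have "a k (c *s v0) * dir_deriv (\<lambda>u. p k u / q k u) (c *s v0) (b *s w + l *s v0)
        = a k v0 * (c * dir_deriv (\<lambda>u. p k u / q k u) (c *s v0) (b *s w + l *s v0))" by simp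
    also have "c * dir_deriv (\<lambda>u. p k u / q k u) (c *s v0) (b *s w + l *s v0)
        = b * dir_deriv (\<lambda>u. p k u / q k u) v0 w"
      using apq[OF k] q[OF k v0(1) W(2)] c by (intro dir_deriv_quotient_scale[of "D k"]) auto
    finally show "a k (c *s v0) * dir_deriv (\<lambda>u. p k u / q k u) (c *s v0) (b *s w + l *s v0)
        = b * (a k v0 * dir_deriv (\<lambda>u. p k u / q k u) v0 w)" by simp
  qed auto
  also have "\<dots> = b * \<omega> v0 w" by (simp add: eq'[OF v0(1) W(2) w] sum_distrib_left)
  finally show "\<omega> (c *s v0) (b *s w + l *s v0) = b * \<omega> v0 w" .
qed

lemma H0_local:
  assumes \<sigma>: "\<sigma> \<in> H0_Sym_Omega1 m X" and v0: "v0 \<in> Xh"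
  shows "loc \<sigma> v0"
    and "DF v0 w = 0 \<Longrightarrow> c \<noteq> 0 \<Longrightarrow> \<sigma> (c *s v0) (b *s w + l *s v0) = b ^ m * \<sigma> v0 w"
proof -
  obtain W r f \<omega> where W: "open_in X W" "vec.span {v0} \<in> W" "W \<subseteq> X" and
    f: "\<And>k. k < (r::nat) \<Longrightarrow> f k \<in> O_sections 0 X W \<and> (\<forall>i<m. \<omega> k i \<in> Omega1_sections X W)" and
    eq: "\<forall>(v, w)\<in>tangent_pairs X W. \<sigma> v w = (\<Sum>k<r. f k v * (\<Prod>i<m. \<omega> k i v w))"
    using \<sigma> span1_in_X[OF v0] unfolding H0_Sym_Omega1_def Sym_Omega1_sections_def by blast
  have eq': "\<sigma> v w = (\<Sum>k<r. f k v * (\<Prod>i<m. \<omega> k i v w))"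
    if "v \<in> Xh" "vec.span {v} \<in> W" "DF v w = 0" for v w
    using eq that tangent_pairs_iff[of W v w] W(3) by auto
  have "loc (\<lambda>v w. \<Sum>k<r. f k v * (\<Prod>i<m. \<omega> k i v w)) v0"
  proof (rule loc_sum, rule loc_mult)
    fix k assume "k \<in> {..<r}"
    then have k: "k < r" by simp
    show "loc (\<lambda>v w. f k v) v0" using O_sections_local(1)[of "f k" 0 W] f[OF k] v0 W(2) by blast
    show "loc (\<lambda>v w. \<Prod>i<m. \<omega> k i v w) v0"
      using f[OF k] Omega1_sections_local(1)[OF _ W(3) v0 W(2)] by (intro loc_prod) auto
  qed
  then show "loc \<sigma> v0"
    by (rule loc_cong_open[OF W(1,2)]) (rule eq')
  assume w: "DF v0 w = 0" and c: "c \<noteq> 0"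
  have "\<sigma> (c *s v0) (b *s w + l *s v0)
      = (\<Sum>k<r. f k (c *s v0) * (\<Prod>i<m. \<omega> k i (c *s v0) (b *s w + l *s v0)))"
    using Xh_scale[OF v0 c] W(2) DF_scale[OF v0 w c] by (intro eq') (simp_all add: span1_eq[OF c])
  also have "\<dots> = (\<Sum>k<r. b ^ m * (f k v0 * (\<Prod>i<m. \<omega> k i v0 w)))"
  proof (rule sum.cong)
    fix k assume "k \<in> {..<r}"
    then have k: "k < r" by simp
    have "f k (c *s v0) = f k v0"
      using O_sections_local(2)[of "f k" 0 W v0 c] f[OF k] v0 W(2) c by simp
    moreover have "(\<Prod>i<m. \<omega> k i (c *s v0) (b *s w + l *s v0)) = (\<Prod>i<m. b * \<omega> k i v0 w)"
      using f[OF k] W(2,3) v0 w c by (intro prod.cong Omega1_sections_local(2)) auto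
    ultimately show "f k (c *s v0) * (\<Prod>i<m. \<omega> k i (c *s v0) (b *s w + l *s v0))
        = b ^ m * (f k v0 * (\<Prod>i<m. \<omega> k i v0 w))" by (simp add: prod.distrib)
  qed auto
  also have "\<dots> = b ^ m * \<sigma> v0 w" by (simp add: eq'[OF v0 W(2) w] sum_distrib_left)
  finally show "\<sigma> (c *s v0) (b *s w + l *s v0) = b ^ m * \<sigma> v0 w" .
qed

lemma H0_outside:
  assumes "\<sigma> \<in> H0_Sym_Omega1 m X" "v \<notin> Xh \<or> DF v w \<noteq> 0" shows "\<sigma> v w = 0"
proof -
  have "(v, w) \<notin> tangent_pairs X X" using assms(2) tangent_pairs_iff[of X v w] by blast
  then show ?thesis using assms(1) unfolding H0_Sym_Omega1_def Sym_Omega1_sections_def by blast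
qed

lemma open_in_X: "open_in X X"
proof -
  have "zariski_closed {}"
    unfolding zariski_closed_def
    by (rule exI[of _ "{\<lambda>_. 1}"])
       (auto simp: vanishes_on_def proj_space_def intro: homog_const vec.span_zero)
  then show ?thesis unfolding open_in_def by (intro exI[of _ "{}"]) auto
qed

lemma H0_zero: "(\<lambda>_ _. 0) \<in> H0_Sym_Omega1 m X"
  unfolding H0_Sym_Omega1_def Sym_Omega1_sections_def
proof (intro CollectI conjI ballI)
  fix y assume "y \<in> X"
  then show "\<exists>W r f \<omega>. open_in X W \<and> y \<in> W \<and> W \<subseteq> X \<and>
      (\<forall>k<r::nat. f k \<in> O_sections 0 X W \<and> (\<forall>i<m. \<omega> k i \<in> Omega1_sections X W)) \<and>
      (\<forall>(v, w)\<in>tangent_pairs X W. 0 = (\<Sum>k<r. f k v * (\<Prod>i<m. \<omega> k i v w)))"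
    using open_in_X by (intro exI[of _ X] exI[of _ "0::nat"] exI[of _ undefined]) simp
qed simp

lemma H0_polynomial:
  assumes \<sigma>: "\<sigma> \<in> H0_Sym_Omega1 m X"
  shows "\<exists>p\<in>polys. \<forall>v\<in>Xh. \<forall>w. DF v w = 0 \<longrightarrow> xc i1 v \<noteq> 0 \<longrightarrow> \<sigma> v w = p w"
proof -
  obtain P where P: "P \<in> pair_polys" "\<And>v w. v \<in> Xh \<Longrightarrow> DF v w = 0 \<Longrightarrow> xc i1 v \<noteq> 0 \<Longrightarrow> \<sigma> v w = P (v, w)"
    using tangent_function_polynomial[of \<sigma>] H0_local(1)[OF \<sigma>] unfolding loc_def by blast
  have "\<sigma> v w = P (0, w)" if v: "v \<in> Xh" "DF v w = 0" "xc i1 v \<noteq> 0" for v w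
  proof -
    note Pw = pair_polys_at[OF P(1), of w]
    \<comment> \<open>By the rescaling rule \<open>P\<close> is constant in \<open>v\<close> along
      the punctured ray, hence also at the origin, although the origin is off the cone.\<close>
    have "line_poly (\<lambda>v. P (v, w)) 0 v = [:\<sigma> v w:]"
    proof (rule poly_eq_if_eq_nonzero)
      fix t :: complex assume t: "t \<noteq> 0"
      have "\<sigma> (t *s v) (1 *s w + 0 *s v) = 1 ^ m * \<sigma> v w" by (rule H0_local(2)[OF \<sigma> v(1,2) t])
      moreover have "\<sigma> (t *s v) w = P (t *s v, w)"
        using Xh_scale[OF v(1) t] DF_scale[OF v(1,2) t, of 1 0] v(3) t homog_scale[OF xc_homog, of i1 t v]
        by (intro P(2)) auto
      ultimately show "poly (line_poly (\<lambda>v. P (v, w)) 0 v) t = poly [:\<sigma> v w:] t" by (simp add: poly_line_poly[OF Pw])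
    qed
    then have "poly (line_poly (\<lambda>v. P (v, w)) 0 v) 0 = \<sigma> v w" by simp
    then show ?thesis by (simp add: poly_line_poly[OF Pw])
  qed
  then show ?thesis using pair_polys_at_fst[OF P(1), of 0] by (intro bexI[of _ "\<lambda>w. P (0, w)"]) auto
qed

end

lemma poly_root_exists:
  fixes P :: "complex poly"
  assumes "degree P \<noteq> 0" shows "\<exists>t. poly P t = 0"
  using fundamental_theorem_of_algebra[of P] assms by (simp add: constant_degree)

context smooth_hypersurface
begin

section \<open>Tangent lines\<close>

abbreviation F2 :: "complex^'n \<Rightarrow> complex^'n \<Rightarrow> complex" where "F2 v w \<equiv> coeff (line_poly F v w) 2"

lemma exists_outside_plane: "\<exists>b::complex^'n. b \<notin> vec.span {v, a}"
proof (rule ccontr)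
  assume "\<not> ?thesis"
  then have "vec.span {v, a} = UNIV" by blast
  then have "vec.dim (UNIV :: (complex^'n) set) \<le> card {v, a}"
    by (metis vec.dim_le_card finite.emptyI finite.insertI subset_UNIV)
  also have "\<dots> \<le> 2" by (simp add: card_insert_if)
  finally have "CARD('n) \<le> 2" by (simp add: card_cart_basis vec.dim_UNIV)
  moreover have "card (set [i0, i1, i2, i3]) \<le> CARD('n)" by (rule card_mono) auto
  ultimately show False using distinct_card[OF dist] by simp
qed

text \<open>If \<open>F\<close> vanishes on the tangent hyperplane then a zero there of the normal derivative is singular.\<close>

lemma F_nonzero_on_tangent:
  assumes v: "v \<in> Xh" shows "\<exists>w. DF v w = 0 \<and> F w \<noteq> 0"
proof (rule ccontr)
  assume "\<not> ?thesis"
  then have F0: "F w = 0" if "DF v w = 0" for w using that by blast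
  obtain a where a: "DF v a \<noteq> 0" using nonsingular[OF v] by blast
  have vv: "DF v v = 0" using euler[OF homF, of v] v by (simp add: Xh_def)
  obtain b where b: "b \<notin> vec.span {v, a}" using exists_outside_plane by blast
  define u where "u = b - (DF v b / DF v a) *s a"
  have u: "DF v u = 0"
    unfolding u_def dir_deriv_diff[OF F_polys] dir_deriv_scale[OF F_polys] using a by simp
  have uv: "u \<noteq> c *s v" for c
  proof
    assume "u = c *s v"
    then have "b = c *s v + (DF v b / DF v a) *s a" by (simp add: u_def algebra_simps)
    moreover have "\<dots> \<in> vec.span {v, a}"
      by (intro vec.span_add vec.span_scale vec.span_base) auto
    ultimately show False using b by simp
  qed
  \<comment> \<open>A form of positive degree \<open>d - 1\<close> has a zero on the projective line
    through \<open>v\<close> and \<open>u\<close>, which lies in the tangent hyperplane: either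
    \<open>u\<close> itself or some \<open>v + t *s u\<close>.\<close>
  have "\<exists>w0. w0 \<noteq> 0 \<and> DF v w0 = 0 \<and> DF w0 a = 0"
  proof (cases "DF u a = 0")
    case True
    then show ?thesis using u uv[of 0] by auto
  next
    case False
    let ?L = "line_poly (\<lambda>w. DF w a) v u"
    have "coeff ?L (d - 1) \<noteq> 0" using coeff_line_poly_top[OF homog_DF, of a v u] False by simp
    then have "degree ?L \<noteq> 0" using le_degree[of ?L "d - 1"] d2 by auto
    then obtain t where "poly ?L t = 0" using poly_root_exists by blast
    then have t: "DF (v + t *s u) a = 0" by (simp add: poly_line_poly[OF DF_polys(1)])
    have "v + t *s u \<noteq> 0"
    proof
      assume z: "v + t *s u = 0"
      then have "t \<noteq> 0" using v by (auto simp: Xh_def)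
      have "u = (1 / t) *s (t *s u)" using \<open>t \<noteq> 0\<close> by simp
      also have "t *s u = (- 1) *s v" using z by (simp add: add_eq_0_iff)
      finally show False using uv by (metis vector_smult_assoc)
    qed
    moreover have "DF v (v + t *s u) = 0"
      unfolding dir_deriv_add[OF F_polys] dir_deriv_scale[OF F_polys] using u vv by simp
    ultimately show ?thesis using t by blast
  qed
  then obtain w0 where w0: "w0 \<noteq> 0" "DF v w0 = 0" "DF w0 a = 0" by blast
  then have "w0 \<in> Xh" using F0 by (simp add: Xh_def)
  moreover have "DF w0 w = 0" for w
  proof -
    define c where "c = DF v w / DF v a"
    have "DF v (w - c *s a) = 0"
      unfolding dir_deriv_diff[OF F_polys] dir_deriv_scale[OF F_polys] c_def using a by simp
    then have "F (w0 + t *s (w - c *s a)) = 0" for t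
      using w0(2) by (intro F0) (simp only: dir_deriv_add[OF F_polys] dir_deriv_scale[OF F_polys], simp)
    then have "line_poly F w0 (w - c *s a) = 0" by (intro line_poly_eqI) simp
    then have "DF w0 (w - c *s a) = 0" by (simp only: dir_deriv_line_poly[OF F_polys] coeff_0)
    then show ?thesis using w0(3) by (simp only: dir_deriv_diff[OF F_polys] dir_deriv_scale[OF F_polys]) simp
  qed
  ultimately show False using nonsingular by blast
qed

text \<open>
  If the second fundamental form vanished identically, then \<open>L t = F (v + t w)\<close> would satisfy
  a linear differential equation of order two with zero initial values along each tangent line.
\<close>

lemma second_fundamental_form_nonzero: "\<exists>v\<in>Xh. \<exists>w. DF v w = 0 \<and> F2 v w \<noteq> 0"
proof (rule ccontr)
  assume "\<not> ?thesis"
  then have *: "F2 v w = 0" if "v \<in> Xh" "DF v w = 0" for v w using that by blast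
  have "\<exists>b\<in>pair_polys. \<forall>v\<in>Xh. \<forall>w. F2 (fst (v, w)) (snd (v, w)) = DF v w * b (v, w)"
    by (rule tangent_divisible[OF coeff_line_poly_pair_polys[OF F_polys]]) (use * in simp)
  then obtain b where b: "b \<in> pair_polys" "\<And>v w. v \<in> Xh \<Longrightarrow> F2 v w = DF v w * b (v, w)" by auto
  obtain v where v: "v \<in> Xh" using Xh_nonempty by blast
  \<comment> \<open>The top coefficient of \<open>L\<close> will be \<open>F w\<close>; this choice
    makes it nonzero.\<close>
  obtain w where w: "DF v w = 0" "F w \<noteq> 0" using F_nonzero_on_tangent[OF v] by blast
  have F2w: "(\<lambda>v. F2 v w) \<in> polys"
    using pair_polys_at[OF coeff_line_poly_pair_polys[OF F_polys, of 2], of w] by simp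
  have bw: "(\<lambda>v. b (v, w)) \<in> polys" by (rule pair_polys_at[OF b(1)])
  have "(\<lambda>v. F2 v w - DF v w * b (v, w)) \<in> polys"
    by (intro polys_intros(5) polys_intros(3) F2w bw DF_polys)
  then obtain G where G: "G \<in> polys" "\<And>u. F2 u w - DF u w * b (u, w) = F u * G u"
    using divisible[of "\<lambda>v. F2 v w - DF v w * b (v, w)"] b(2) by auto
  define L where "L = line_poly F v w"
  define \<beta> where "\<beta> = line_poly (\<lambda>v. b (v, w)) v w"
  define \<gamma> where "\<gamma> = line_poly G v w"
  have shift: "line_poly F (v + t *s w) w = pcompose L [:t, 1:]" for t
    by (rule line_poly_eqI) (simp add: L_def poly_pcompose poly_line_poly[OF F_polys] algebra_simps)
  have 1: "DF (v + t *s w) w = poly (pderiv L) t" for t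
  proof -
    have "DF (v + t *s w) w = poly (pderiv (pcompose L [:t, 1:])) 0"
      by (simp add: dir_deriv_line_poly[OF F_polys] shift poly_0_coeff_0 coeff_pderiv)
    then show ?thesis by (simp add: pderiv_pcompose poly_pcompose pderiv_pCons)
  qed
  have 2: "2 * F2 (v + t *s w) w = poly (pderiv (pderiv L)) t" for t
  proof -
    have "2 * F2 (v + t *s w) w = poly (pderiv (pderiv (pcompose L [:t, 1:]))) 0"
      by (simp add: shift poly_0_coeff_0 coeff_pderiv numeral_2_eq_2)
    then show ?thesis by (simp add: pderiv_pcompose poly_pcompose pderiv_pCons)
  qed
  have ode: "pderiv (pderiv L) = smult 2 (pderiv L * \<beta> + L * \<gamma>)"
  proof (rule polyI)
    fix t
    have "F2 (v + t *s w) w = DF (v + t *s w) w * b (v + t *s w, w) + F (v + t *s w) * G (v + t *s w)"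
      using G(2)[of "v + t *s w"] by (simp add: algebra_simps)
    then have "2 * F2 (v + t *s w) w = 2 * (poly (pderiv L) t * poly \<beta> t + poly L t * poly \<gamma> t)"
      by (simp add: 1 L_def \<beta>_def \<gamma>_def poly_line_poly F_polys G(1) bw)
    then show "poly (pderiv (pderiv L)) t = poly (smult 2 (pderiv L * \<beta> + L * \<gamma>)) t"
      by (simp add: 2)
  qed
  have "coeff L k = 0" for k
  proof (induction k rule: less_induct)
    case (less k)
    consider "k = 0" | "k = 1" | j where "k = Suc (Suc j)" by (metis One_nat_def not0_implies_Suc)
    then show ?case
    proof cases
      case 1
      then show ?thesis using v by (simp add: L_def coeff_line_poly_0[OF F_polys] Xh_def)
    next
      case 2
      then show ?thesis using w(1) dir_deriv_line_poly[OF F_polys, of v w] by (simp add: L_def)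
    next
      case (3 j)
      \<comment> \<open>On the right only coefficients of \<open>L\<close> up to index
        \<open>Suc j\<close> occur, and they vanish by induction; on the left stands a nonzero
        multiple of the coefficient at \<open>k\<close>.\<close>
      have "coeff (pderiv (pderiv L)) j = coeff (smult 2 (pderiv L * \<beta> + L * \<gamma>)) j" using ode by simp
      also have "\<dots> = 0"
        unfolding coeff_smult coeff_add coeff_mult coeff_pderiv using less.IH 3 by simp
      finally show ?thesis using 3 by (simp add: coeff_pderiv del: of_nat_Suc)
    qed
  qed
  then have "F w = 0" using coeff_line_poly_top[OF homF, of v w] by (simp add: L_def)
  then show False using w by simp
qed

lemma F2_self: "v \<in> Xh \<Longrightarrow> F2 v (c *s v) = 0"
proof -
  assume v: "v \<in> Xh"
  have "line_poly F v (c *s v) = 0"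
  proof (rule line_poly_eqI)
    fix t
    have "v + t *s (c *s v) = (1 + t * c) *s v" by (simp add: algebra_simps)
    then show "poly 0 t = F (v + t *s (c *s v))" using v by (simp only: F_scale) (simp add: Xh_def)
  qed
  then show ?thesis by simp
qed

text \<open>The line has contact of order exactly two at \<open>v\<close>, so in
  \<open>F (w + s *s v)\<close> the power \<open>s ^ (d - 2)\<close> has the nonzero coefficient
  \<open>F2 v w\<close>. For \<open>d \<ge> 3\<close> the polynomial is not constant and has a
  root.\<close>

lemma tangent_line_meets:
  assumes d3: "d \<ge> 3" and v: "v \<in> Xh" and w: "DF v w = 0" "F2 v w \<noteq> 0"
  shows "\<exists>s. w + s *s v \<in> Xh"
proof -
  let ?L = "line_poly F w v"
  have "coeff ?L (d - 2) \<noteq> 0" using coeff_line_poly_swap[OF homF, of v w 2] d2 w(2) by simp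
  then have "degree ?L \<noteq> 0" using le_degree[of ?L "d - 2"] d3 by auto
  then obtain s where "poly ?L s = 0" using poly_root_exists by blast
  then have "F (w + s *s v) = 0" by (simp add: poly_line_poly[OF F_polys])
  moreover have "w + s *s v \<noteq> 0"
  proof
    assume "w + s *s v = 0"
    then have "w = (- s) *s v" by (simp add: add_eq_0_iff)
    then show False using F2_self[OF v] w(2) by metis
  qed
  ultimately show ?thesis by (auto simp: Xh_def)
qed

lemma tangent_add: "v \<in> Xh \<Longrightarrow> DF v w = 0 \<Longrightarrow> DF v (w + s *s v) = 0"
  using euler[OF homF, of v] by (simp add: dir_deriv_add[OF F_polys] dir_deriv_scale[OF F_polys] Xh_def)

text \<open>Up to the factor \<open>DF v a\<close>, the projection of \<open>w\<close> to the
  tangent space along \<open>a\<close>. It spreads one tangent vector to a polynomial family over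
  the cone, so that statements about pairs become statements about \<open>v\<close>, to which
  irreducibility applies.\<close>

definition tvec :: "complex^'n \<Rightarrow> complex^'n \<Rightarrow> complex^'n \<Rightarrow> complex^'n" where
  "tvec a w v = DF v a *s w - DF v w *s a"

lemma DF_tvec: "DF v (tvec a w v) = 0"
  by (simp add: tvec_def dir_deriv_diff[OF F_polys] dir_deriv_scale[OF F_polys])

lemma tvec_tangent: "DF v w = 0 \<Longrightarrow> tvec a w v = DF v a *s w"
  by (simp add: tvec_def)

lemma tvec_polys: "(\<lambda>v. tvec a w v $ i) \<in> polys"
proof -
  have "(\<lambda>v. DF v a * w $ i - DF v w * a $ i) \<in> polys" by (intro polys_intros DF_polys)
  then show ?thesis by (simp add: tvec_def)
qed

lemma pair_polys_tvec: "A \<in> pair_polys \<Longrightarrow> (\<lambda>v. A (v, tvec a w v)) \<in> polys"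
  unfolding polys_def
  by (rule pair_polys_subst) (auto intro: alg_gen.gen tvec_polys[unfolded polys_def])

lemma tvec_scale: "tvec a w (c *s v) = c ^ (d - 1) *s tvec a w v"
  by (simp add: tvec_def homog_scale[OF homog_DF] vec_eq_iff algebra_simps)

text \<open>\<open>F2\<close> has degree \<open>d - 2\<close> in the point and is quadratic in the
  direction, which itself has degree \<open>d - 1\<close> in \<open>v\<close>.\<close>

lemma homog_F2_tvec: "homog (d - 2 + 2 * (d - 1)) (\<lambda>v. F2 v (tvec a w v))"
  unfolding homog_def
proof (intro conjI allI)
  show "(\<lambda>v. F2 v (tvec a w v)) \<in> polys"
    using pair_polys_tvec[OF coeff_line_poly_pair_polys[OF F_polys, of 2]] by simp
  fix c v
  have "F2 (c *s v) (tvec a w (c *s v)) = (c ^ (d - 1))\<^sup>2 * (c ^ (d - 2) * F2 v (tvec a w v))"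
    unfolding tvec_scale coeff_line_poly_scale_snd[OF F_polys] coeff_line_poly_scale_fst[OF homF d2] by simp
  then show "F2 (c *s v) (tvec a w (c *s v)) = c ^ (d - 2 + 2 * (d - 1)) * F2 v (tvec a w v)"
    by (simp add: power_add mult.commute[of 2] power_mult)
qed

lemma xc_nonzero: "\<exists>u\<in>Xh. xc i1 u \<noteq> 0"
proof (rule ccontr)
  assume "\<not> ?thesis"
  then obtain G where G: "G \<in> polys" "\<And>v. xc i1 v = F v * G v" using divisible[OF xc_polys, of i1] by blast
  have "xc i1 (axis i1 1) = 0" using homog_degree_less_eq_0[OF xc_homog homF G(1) _ G(2)] d2 by simp
  then show False using dist by (auto simp: xc_def axis_def)
qed

text \<open>A density argument: \<open>xc i1\<close> times the second fundamental form along a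
  family \<open>tvec\<close> is a form not vanishing identically on \<open>X\<close>. Where it is
  nonzero the hypothesis applies, and irreducibility extends the vanishing to all
  \<open>v\<close>.\<close>

lemma tangent_vanishing_extends:
  assumes A: "A \<in> pair_polys"
    and 0: "\<And>v w u. v \<in> Xh \<Longrightarrow> xc i1 v \<noteq> 0 \<Longrightarrow> DF v u = 0 \<Longrightarrow> F2 v u \<noteq> 0 \<Longrightarrow> DF v w = 0 \<Longrightarrow> A (v, w) = 0"
    and v: "v \<in> Xh" and w: "DF v w = 0"
  shows "A (v, w) = 0"
proof -
  obtain v2 w2 where 2: "v2 \<in> Xh" "DF v2 w2 = 0" "F2 v2 w2 \<noteq> 0"
    using second_fundamental_form_nonzero by blast
  obtain a2 where a2: "DF v2 a2 \<noteq> 0" using nonsingular[OF 2(1)] by blast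
  obtain a where a: "DF v a \<noteq> 0" using nonsingular[OF v] by blast
  let ?h = "\<lambda>v. F2 v (tvec a2 w2 v)"
  have "?h v2 \<noteq> 0"
    using 2 a2 by (simp add: tvec_tangent coeff_line_poly_scale_snd[OF F_polys])
  then obtain u where u: "u \<in> Xh" "xc i1 u * ?h u \<noteq> 0"
    using irreducible_homog[OF xc_homog homog_F2_tvec] xc_nonzero 2(1) by blast
  \<comment> \<open>Rescaled so that the family \<open>tvec a w'\<close> passes through
    \<open>w\<close> itself at \<open>v\<close>.\<close>
  define w' where "w' = (1 / DF v a) *s w"
  have w': "DF v w' = 0" unfolding w'_def by (simp add: dir_deriv_scale[OF F_polys] w)
  have "(\<lambda>v. A (v, tvec a w' v)) v = 0"
  proof (rule irreducible_mult[OF pair_polys_tvec[OF A] homog_mult[OF xc_homog homog_F2_tvec] _ u v])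
    fix v assume "v \<in> Xh"
    then show "A (v, tvec a w' v) * (xc i1 v * ?h v) = 0"
      using 0[of v "tvec a2 w2 v" "tvec a w' v"] DF_tvec by auto
  qed
  moreover have "tvec a w' v = w" unfolding tvec_tangent[OF w'] using a by (simp add: w'_def)
  ultimately show ?thesis by simp
qed

lemma tangent_space_line: "DF v a = 0 \<Longrightarrow> DF v b = 0 \<Longrightarrow> DF v (a + t *s (b - a)) = 0"
  by (simp add: dir_deriv_add[OF F_polys] dir_deriv_scale[OF F_polys] dir_deriv_diff[OF F_polys])

text \<open>The tangent space at a fixed \<open>v\<close> is linear, so vectors on which a nonzero
  second fundamental form does not vanish are dense in it.\<close>

lemma F2_cancel:
  assumes p: "p \<in> polys" and 0: "\<And>w. DF v w = 0 \<Longrightarrow> F2 v w \<noteq> 0 \<Longrightarrow> p w = 0"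
    and u: "DF v u = 0" "F2 v u \<noteq> 0" and w: "DF v w = 0"
  shows "p w = 0"
proof -
  have "(\<lambda>w. F2 v w) \<in> polys"
    using pair_polys_at_fst[OF coeff_line_poly_pair_polys[OF F_polys, of 2], of v] by simp
  then show ?thesis
    by (rule polys_mult_eq_0[OF _ p, where T = "{w. DF v w = 0}" and v = u])
       (use 0 u w tangent_space_line in auto)
qed

section \<open>Hypersurfaces of degree at least three\<close>

lemma H0_vanishes:
  assumes d3: "d \<ge> 3" and m: "m \<ge> 1" and \<sigma>: "\<sigma> \<in> H0_Sym_Omega1 m X"
  shows "\<sigma> v w = 0"
proof -
  obtain p where p: "p \<in> polys" "\<And>v w. v \<in> Xh \<Longrightarrow> DF v w = 0 \<Longrightarrow> xc i1 v \<noteq> 0 \<Longrightarrow> \<sigma> v w = p w"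
    using H0_polynomial[OF \<sigma>] by blast
  have vv: "DF v v = 0" if "v \<in> Xh" for v using euler[OF homF, of v] that by (simp add: Xh_def)
  \<comment> \<open>\<open>v\<close> represents the zero tangent vector. The rescaling rule with
    \<open>b = 0\<close> gives the factor \<open>0 ^ m\<close>, which is zero because
    \<open>m \<ge> 1\<close>.\<close>
  have \<sigma>vv: "\<sigma> v v = 0" if "v \<in> Xh" for v
    using H0_local(2)[OF \<sigma> that vv[OF that], of 1 0 1] m by (simp add: power_0_left)
  obtain u where u: "u \<in> Xh" "xc i1 u \<noteq> 0" using xc_nonzero by blast
  have pX: "p v = 0" if "v \<in> Xh" for v
  proof (rule irreducible_mult[OF p(1) xc_homog _ u that])
    fix v assume "v \<in> Xh"
    then show "p v * xc i1 v = 0" using p(2)[of v v] vv[of v] \<sigma>vv[of v] by auto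
  qed
  have generic: "\<sigma> v w = 0"
    if v: "v \<in> Xh" "xc i1 v \<noteq> 0" and u: "DF v u = 0" "F2 v u \<noteq> 0" and w: "DF v w = 0" for v u w
  proof -
    have "p w = 0" if w: "DF v w = 0" "F2 v w \<noteq> 0" for w
    proof -
      obtain s where s: "w + s *s v \<in> Xh" using tangent_line_meets[OF d3 v(1) w] by blast
      have "p w = \<sigma> v w" using p(2) v w by simp
      also have "\<dots> = \<sigma> v (w + s *s v)" using H0_local(2)[OF \<sigma> v(1) w(1), of 1 1 s] by simp
      also have "\<dots> = p (w + s *s v)" using p(2) v tangent_add[OF v(1) w(1)] by simp
      also have "\<dots> = 0" by (rule pX[OF s])
      finally show ?thesis .
    qed
    then have "p w = 0" using F2_cancel[OF p(1) _ u w] by blast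
    then show ?thesis using p(2) v w by simp
  qed
  show ?thesis
  proof (cases "v \<in> Xh \<and> DF v w = 0")
    case True
    then have "loc \<sigma> v" using H0_local(1)[OF \<sigma>] by blast
    then obtain g D A where A: "homog D g" "g v \<noteq> 0" "A \<in> pair_polys"
      "\<And>v w. v \<in> Xh \<Longrightarrow> DF v w = 0 \<Longrightarrow> g v * \<sigma> v w = A (v, w)"
      unfolding loc_def by blast
    \<comment> \<open>\<open>p\<close> describes the section only where \<open>xc i1\<close> is
      nonzero; the local numerator \<open>A\<close> carries the vanishing over to the remaining
      points.\<close>
    have "A (v, w) = 0"
    proof (rule tangent_vanishing_extends[OF A(3)])
      fix v w u assume vwu: "v \<in> Xh" "xc i1 v \<noteq> 0" "DF v u = 0" "F2 v u \<noteq> 0" "DF v w = 0"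
      then have "\<sigma> v w = 0" by (rule generic)
      then show "A (v, w) = 0" using A(4)[OF vwu(1,5)] by simp
    qed (use True in auto)
    then have "g v * \<sigma> v w = 0" using A(4)[of v w] True by simp
    then show ?thesis using A(2) by simp
  qed (use H0_outside[OF \<sigma>] in blast)
qed

lemma smooth_locus_X: "smooth_locus X = X"
  using smooth by (simp add: smooth_variety_def)

lemma proj_tangent_iff:
  assumes v: "v \<in> Xh" and u: "u \<noteq> 0"
  shows "vec.span {u} \<in> proj_tangent X (vec.span {v}) \<longleftrightarrow> DF v u = 0"
proof
  assume "vec.span {u} \<in> proj_tangent X (vec.span {v})"
  then have "u \<in> tangent_cone X (vec.span {v})" using span1_self[of u] by (auto simp: proj_tangent_def)
  then show "DF v u = 0" by (simp add: tangent_cone_iff[OF v])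
next
  assume "DF v u = 0"
  then show "vec.span {u} \<in> proj_tangent X (vec.span {v})"
    using proj_space_span1[OF u]
    by (auto simp: proj_tangent_def mem_span1 tangent_cone_iff[OF v] dir_deriv_scale[OF F_polys])
qed

lemma t_trisecant_variety_eq_proj_space:
  assumes d3: "d \<ge> 3"
  shows "t_trisecant_variety X = proj_space"
proof
  show "t_trisecant_variety X \<subseteq> proj_space"
    by (auto simp: t_trisecant_variety_def tangent_secant_variety_def tangent_secant_pairs_def)
next
  define S where "S = {(x, z). x \<in> smooth_locus X \<and> (\<exists>y \<in> X \<inter> proj_tangent X x. y \<noteq> x \<and> z \<in> proj_line x y)}"
  have S: "(vec.span {v}, vec.span {w}) \<in> S" if v: "v \<in> Xh" and w: "DF v w = 0" "F2 v w \<noteq> 0" for v w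
  proof -
    obtain s where s: "w + s *s v \<in> Xh" using tangent_line_meets[OF d3 v w] by blast
    let ?y = "vec.span {w + s *s v}"
    have w_not: "w \<noteq> c *s v" for c using F2_self[OF v, of c] w(2) by auto
    have "?y \<in> X \<inter> proj_tangent X (vec.span {v})"
      using span1_in_X[OF s] proj_tangent_iff[OF v, of "w + s *s v"] tangent_add[OF v w(1)] s
      by (auto simp: Xh_def)
    moreover have "?y \<noteq> vec.span {v}"
    proof
      assume "?y = vec.span {v}"
      then obtain c where "w + s *s v = c *s v" using span1_self[of "w + s *s v"] by (auto simp: mem_span1)
      then have "w = (c - s) *s v" by (simp add: algebra_simps)
      then show False using w_not by blast
    qed
    moreover have "vec.span {w} \<in> proj_line (vec.span {v}) ?y"
    proof -
      have "w \<in> vec.span (vec.span {v} \<union> ?y)"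
      proof -
        have "(w + s *s v) - s *s v \<in> vec.span (vec.span {v} \<union> ?y)"
          by (intro vec.span_diff vec.span_scale vec.span_base) (auto intro: span1_self)
        then show ?thesis by simp
      qed
      then have "vec.span {w} \<subseteq> vec.span (vec.span {v} \<union> ?y)"
        by (auto simp: mem_span1 intro: vec.span_scale)
      then show ?thesis using proj_space_span1[of w] w_not[of 0] by (auto simp: proj_line_def)
    qed
    ultimately show ?thesis
      unfolding S_def smooth_locus_X using span1_in_X[OF v] by auto
  qed
  show "proj_space \<subseteq> t_trisecant_variety X"
  proof
    fix z :: "(complex^'n) set" assume z: "z \<in> proj_space"
    then obtain w where w: "z = vec.span {w}" "w \<noteq> 0" by (auto simp: proj_space_def)
    obtain v where v: "v \<in> Xh" "DF v w = 0" using polar_nonempty by blast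
    have "(vec.span {v}, z) \<in> prod_closure S"
      unfolding prod_closure_def
    proof (intro CollectI case_prodI conjI allI impI ballI SigmaI)
      show "vec.span {v} \<in> proj_space" "z \<in> proj_space"
        using span1_in_X[OF v(1)] z by (auto simp: X_eq)
      fix d' e' G v' w'
      assume G: "bihomog d' e' G \<and> (\<forall>(x', z')\<in>S. \<forall>v\<in>x'. \<forall>w\<in>z'. G (v, w) = 0)"
        and v': "v' \<in> vec.span {v}" and w': "w' \<in> z"
      have Gp: "G \<in> pair_polys" using G by (simp add: bihomog_def pair_polys_def)
      have G0: "G (v, w) = 0" if "v \<in> Xh" "DF v w = 0" "F2 v w \<noteq> 0" for v w
        using S[OF that] G span1_self[of v] span1_self[of w] by blast
      have "G (v, w) = 0"
      proof (rule tangent_vanishing_extends[OF Gp _ v])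
        fix v w u assume "v \<in> Xh" "DF v u = 0" "F2 v u \<noteq> 0" "DF v w = 0"
        \<comment> \<open>\<open>G0\<close> covers directions with nonzero \<open>F2\<close>; the
          other tangent vectors at the same \<open>v\<close> follow by density in the tangent
          space.\<close>
        then show "G (v, w) = 0"
          using F2_cancel[OF pair_polys_at_fst[OF Gp, of v], of v u w] G0 by blast
      qed
      moreover obtain c b where "v' = c *s v" "w' = b *s w" using v' w' w by (auto simp: mem_span1)
      ultimately show "G (v', w') = 0" using G by (simp add: bihomog_def)
    qed
    then have "(vec.span {v}, z) \<in> tangent_secant_pairs X X"
      using z span1_in_X[OF v(1)] by (simp add: tangent_secant_pairs_def S_def)
    then show "z \<in> t_trisecant_variety X"
      unfolding t_trisecant_variety_def tangent_secant_variety_def by (force intro: image_eqI[of _ snd])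
  qed
qed

end

section \<open>Quadrics\<close>

lemma O_sections_const: "open_in X U \<Longrightarrow> (\<lambda>_. c) \<in> O_sections 0 X U"
  unfolding O_sections_def
  by (intro CollectI ballI exI[of _ U] exI[of _ 0] exI[of _ "\<lambda>_. c"] exI[of _ "\<lambda>_. 1"])
     (auto intro: homog_const)

lemma O_sections_coord: "open_in X U \<Longrightarrow> (\<lambda>v. v $ j) \<in> O_sections 1 X U"
  unfolding O_sections_def
  by (intro CollectI ballI exI[of _ U] exI[of _ 0] exI[of _ "\<lambda>v. v $ j"] exI[of _ "\<lambda>_. 1"])
     (auto intro: homog_const homog_coord[unfolded One_nat_def])

lemma dir_deriv_coord: "dir_deriv (\<lambda>v. v $ i) v w = w $ i"
proof -
  have "line_poly (\<lambda>v. v $ i) v w = [:v $ i, w $ i:]" by (rule line_poly_eqI) simp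
  then show ?thesis by (simp add: dir_deriv_line_poly[OF polys_coord])
qed

context smooth_hypersurface
begin

text \<open>On a tangent line the terms of order zero and one at \<open>v\<close> vanish, which
  leaves only the quadratic one. So the line lies on \<open>X\<close> if \<open>u\<close> does, and
  \<open>F\<close> ignores multiples of \<open>v\<close> added to a tangent vector.\<close>

lemma quadric_line:
  assumes "d = 2" and v: "v \<in> Xh" and u: "DF v u = 0"
  shows "F (a *s v + b *s u) = b\<^sup>2 * F u"
proof (cases "a = 0")
  case True
  then show ?thesis using F_scale[of b u] assms(1) by simp
next
  case False
  have "line_poly F v u = monom (F u) 2"
  proof (rule poly_eqI)
    fix k :: nat
    consider "k = 0" | "k = 1" | "k = 2" | "k > 2" by linarith
    then show "coeff (line_poly F v u) k = coeff (monom (F u) 2) k"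
    proof cases
      case 1
      then show ?thesis using v by (simp add: coeff_line_poly_0[OF F_polys] Xh_def)
    next
      case 2
      then show ?thesis using u dir_deriv_line_poly[OF F_polys, of v u] by simp
    next
      case 3
      then show ?thesis using coeff_line_poly_top[OF homF, of v u] assms(1) by simp
    next
      case 4
      then show ?thesis using coeff_line_poly_swap[OF homF, of v u k] assms(1) by simp
    qed
  qed
  then have "poly (line_poly F v u) (b / a) = F u * (b / a)\<^sup>2" by (simp add: poly_monom)
  then have *: "F (v + (b / a) *s u) = F u * (b / a)\<^sup>2" by (simp add: poly_line_poly[OF F_polys])
  have "a *s v + b *s u = a *s (v + (b / a) *s u)" using False by (simp add: vec_eq_iff field_simps)
  then have "F (a *s v + b *s u) = a\<^sup>2 * F (v + (b / a) *s u)" by (simp only: F_scale assms(1))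
  then show ?thesis using False by (simp add: * power_divide)
qed

lemma quadric_t_trisecant_variety:
  assumes d: "d = 2"
  shows "t_trisecant_variety X \<noteq> proj_space"
proof -
  have "t_trisecant_variety X \<subseteq> X"
  proof
    fix z assume "z \<in> t_trisecant_variety X"
    then obtain y where y: "(y, z) \<in> tangent_secant_pairs X X"
      by (auto simp: t_trisecant_variety_def tangent_secant_variety_def)
    then have z: "z \<in> proj_space" by (simp add: tangent_secant_pairs_def)
    \<comment> \<open>The equation of \<open>X\<close> in the second factor is one of the forms that
      test membership in the closure.\<close>
    have bi: "bihomog 0 2 (\<lambda>s. F (snd s))"
      unfolding bihomog_def
    proof (intro conjI allI)
      show "(\<lambda>s. F (snd s)) \<in> alg_gen pair_coords"
        by (rule polys_subst[OF F_polys]) (auto intro: alg_gen.gen)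
    qed (simp add: F_scale d)
    have "F w = 0" if S: "x' \<in> smooth_locus X" "y' \<in> X \<inter> proj_tangent X x'" "z' \<in> proj_line x' y'"
      and w: "w \<in> z'" for x' y' z' w
    proof -
      obtain v where v: "v \<in> Xh" "x' = vec.span {v}" using S(1) smooth_locus_X X_cases by metis
      obtain u where u: "u \<in> Xh" "y' = vec.span {u}" using S(2) X_cases by (metis IntD1)
      have uv: "DF v u = 0" using proj_tangent_iff[OF v(1), of u] u S(2) v(2) by (auto simp: Xh_def)
      have "w \<in> vec.span (vec.span {v} \<union> vec.span {u})"
        using S(3) w by (auto simp: proj_line_def v u)
      then obtain a b where "w = a *s v + b *s u"
        by (auto simp: vec.span_Un vec.span_span mem_span1)
      then show ?thesis using quadric_line[OF d v(1) uv] u(1) by (simp add: Xh_def)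
    qed
    note key = this
    have "\<forall>v\<in>y. \<forall>w\<in>z. F (snd (v, w)) = 0"
    proof -
      have "(y, z) \<in> prod_closure {(x, z). x \<in> smooth_locus X \<and>
          (\<exists>y \<in> X \<inter> proj_tangent X x. y \<noteq> x \<and> z \<in> proj_line x y)}"
        using y by (simp add: tangent_secant_pairs_def)
      then have cl: "bihomog d e G \<Longrightarrow> (\<And>x' z' v w. x' \<in> smooth_locus X \<Longrightarrow>
            (\<exists>y \<in> X \<inter> proj_tangent X x'. y \<noteq> x' \<and> z' \<in> proj_line x' y) \<Longrightarrow>
            v \<in> x' \<Longrightarrow> w \<in> z' \<Longrightarrow> G (v, w) = 0) \<Longrightarrow> \<forall>v\<in>y. \<forall>w\<in>z. G (v, w) = 0" for d e G
        unfolding prod_closure_def by blast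
      show ?thesis
        by (rule cl[OF bi]) (use key in auto)
    qed
    moreover have "y \<in> X" using y by (simp add: tangent_secant_pairs_def)
    then obtain v where "v \<in> y" by (rule X_cases) auto
    ultimately show "z \<in> X" using z by (auto simp: X_eq vanishes_on_def)
  qed
  moreover have "vec.span {e} \<notin> X" using Fe span1_self[of e] by (auto simp: X_eq vanishes_on_def)
  moreover have "e \<noteq> 0" using Fe F_0 by auto
  ultimately show ?thesis using proj_space_span1 by blast
qed

text \<open>Euler's formula expresses \<open>F\<close> by its polar form. That form is bilinear,
  being linear in the direction and symmetric: in degree two, reversing the Taylor coefficients
  fixes the middle one.\<close>

lemma quadric_form:
  assumes d: "d = 2"
  shows "F u = (\<Sum>i\<in>UNIV. \<Sum>j\<in>UNIV. DF (axis i 1) (axis j 1) / 2 * (u $ i * u $ j))"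
proof -
  have sym: "DF v w = DF w v" for v w
    using coeff_line_poly_swap[OF homF, of v w 1] d by (simp add: dir_deriv_line_poly[OF F_polys])
  have "2 * F u = DF u u" using euler[OF homF, of u] d by simp
  also have "\<dots> = (\<Sum>i\<in>UNIV. DF (axis i 1) u * u $ i)"
    unfolding dir_deriv_sum_axis[OF F_polys, of u u] by (simp only: sym)
  also have "\<dots> = (\<Sum>i\<in>UNIV. \<Sum>j\<in>UNIV. DF (axis i 1) (axis j 1) * u $ j * u $ i)"
    by (subst dir_deriv_sum_axis[OF F_polys]) (simp add: sum_distrib_right)
  finally have "F u = (\<Sum>i\<in>UNIV. \<Sum>j\<in>UNIV. DF (axis i 1) (axis j 1) * u $ j * u $ i) / 2"
    by (metis nonzero_mult_div_cancel_left zero_neq_numeral)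
  then show ?thesis by (simp add: sum_divide_distrib mult_ac)
qed

text \<open>
  On \<open>v $ j \<noteq> 0\<close>, \<open>F w\<close> is the quadratic form \<open>F\<close> in the differentials \<open>v $ j * d (v $ i / v $ j)\<close>, because \<open>F\<close> does not
  change when a multiple of \<open>v\<close> is added to a tangent vector at \<open>v\<close>.
\<close>

lemma quadric_section:
  assumes d: "d = 2"
  shows "(\<lambda>v w. if (v, w) \<in> tangent_pairs X X then F w else 0) \<in> H0_Sym_Omega1 2 X"
  unfolding H0_Sym_Omega1_def Sym_Omega1_sections_def
proof (intro CollectI conjI ballI)
  fix y assume y: "y \<in> X"
  then obtain v0 where v0: "v0 \<in> Xh" "y = vec.span {v0}" using X_cases by metis
  then obtain j where j: "v0 $ j \<noteq> 0" by (auto simp: Xh_def vec_eq_iff)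
  define W where "W = X - {x \<in> proj_space. vanishes_on (\<lambda>v. v $ j) {x}}"
  have W: "open_in X W" "W \<subseteq> X"
    using zariski_closed_zeros[OF homog_coord, of j] by (auto simp: W_def open_in_def)
  have yW: "y \<in> W" using y j v0 span1_self[of v0] by (auto simp: W_def vanishes_on_def)
  have jW: "v $ j \<noteq> 0" if "z \<in> W" "v \<in> z - {0}" for z v
  proof
    assume "v $ j = 0"
    moreover have "z = vec.span {v}" using X_Xh that by (auto simp: W_def)
    ultimately show False using that(1) by (auto simp: W_def vanishes_on_def mem_span1 X_eq)
  qed
  have jW': "v $ j \<noteq> 0" if "(v, w) \<in> tangent_pairs X W" for v w
    using that jW by (auto simp: tangent_pairs_def)
  define \<omega> where "\<omega> i v w = (if (v, w) \<in> tangent_pairs X W then w $ i - w $ j * v $ i / v $ j else 0)"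
    for i v w
  have \<omega>: "\<omega> i \<in> Omega1_sections X W" for i
    unfolding Omega1_sections_def
  proof (intro CollectI conjI ballI allI impI)
    fix z assume z: "z \<in> W"
    have "\<omega> i v w = (\<Sum>k<1::nat. v $ j * dir_deriv (\<lambda>u. u $ i / u $ j) v w)"
      if "(v, w) \<in> tangent_pairs X W" for v w
      using that jW'[OF that]
      by (simp add: \<omega>_def dir_deriv_quotient[OF polys_coord polys_coord] dir_deriv_coord
          power2_eq_square field_simps)
    then show "\<exists>Wa r a d p q. open_in X Wa \<and> z \<in> Wa \<and> Wa \<subseteq> W \<and>
        (\<forall>k<r::nat. a k \<in> O_sections 1 X Wa \<and> homog (d k) (p k) \<and> homog (d k) (q k) \<and>
           (\<forall>y\<in>Wa. \<forall>v\<in>y - {0}. q k v \<noteq> 0)) \<and>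
        (\<forall>(v, w)\<in>tangent_pairs X Wa.
           \<omega> i v w = (\<Sum>k<r. a k v * dir_deriv (\<lambda>u. p k u / q k u) v w))"
      using z W jW O_sections_coord[OF W(1), of j] homog_coord[of i] homog_coord[of j]
      by (intro exI[of _ W] exI[of _ "1::nat"] exI[of _ "\<lambda>_ v. v $ j"] exI[of _ "\<lambda>_. 1"]
            exI[of _ "\<lambda>_ u. u $ i"] exI[of _ "\<lambda>_ u. u $ j"]) auto
  qed (simp add: \<omega>_def)
  \<comment> \<open>Sections are sums over \<open>k < r\<close>, so the index pairs of the quadratic
    form are enumerated by natural numbers.\<close>
  obtain \<phi> :: "nat \<Rightarrow> 'n \<times> 'n" where \<phi>: "bij_betw \<phi> {..<CARD('n \<times> 'n)} UNIV"
    using ex_bij_betw_nat_finite[of "UNIV :: ('n \<times> 'n) set"] by (auto simp: atLeast0LessThan)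
  have "F w = (\<Sum>k<CARD('n \<times> 'n). DF (axis (fst (\<phi> k)) 1) (axis (snd (\<phi> k)) 1) / 2 *
      (\<Prod>i<2. \<omega> (if i = (0::nat) then fst (\<phi> k) else snd (\<phi> k)) v w))"
    if vw: "(v, w) \<in> tangent_pairs X W" for v w
  proof -
    have v: "v \<in> Xh" "DF v w = 0" using vw tangent_pairs_iff[OF W(2)] by auto
    \<comment> \<open>\<open>w\<close> is shifted along \<open>v\<close> until its coordinate
      \<open>j\<close> is zero; the coordinates of the result are exactly the values of the
      differentials.\<close>
    define u where "u = (- (w $ j / v $ j)) *s v + 1 *s w"
    have u: "\<omega> i v w = u $ i" for i by (simp add: \<omega>_def vw u_def)
    have "F w = F u" unfolding u_def quadric_line[OF d v] by simp
    also have "\<dots> = (\<Sum>(i, l)\<in>UNIV. DF (axis i 1) (axis l 1) / 2 * (u $ i * u $ l))"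
      by (subst quadric_form[OF d]) (simp add: sum.cartesian_product)
    also have "\<dots> = (\<Sum>k<CARD('n \<times> 'n). (\<lambda>(i, l). DF (axis i 1) (axis l 1) / 2 * (u $ i * u $ l)) (\<phi> k))"
      by (rule sum.reindex_bij_betw[OF \<phi>, symmetric])
    finally show ?thesis by (simp add: u case_prod_beta numeral_2_eq_2)
  qed
  moreover have "(v, w) \<in> tangent_pairs X X" if "(v, w) \<in> tangent_pairs X W" for v w
    using that W(2) by (auto simp: tangent_pairs_def)
  ultimately show "\<exists>W r f \<omega>. open_in X W \<and> y \<in> W \<and> W \<subseteq> X \<and>
      (\<forall>k<r::nat. f k \<in> O_sections 0 X W \<and> (\<forall>i<2::nat. \<omega> k i \<in> Omega1_sections X W)) \<and>
      (\<forall>(v, w)\<in>tangent_pairs X W. (if (v, w) \<in> tangent_pairs X X then F w else 0) =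
         (\<Sum>k<r. f k v * (\<Prod>i<2. \<omega> k i v w)))"
    using W yW \<omega> O_sections_const[OF W(1)]
    by (intro exI[of _ W] exI[of _ "CARD('n \<times> 'n)"]
          exI[of _ "\<lambda>k _. DF (axis (fst (\<phi> k)) 1) (axis (snd (\<phi> k)) 1) / 2"]
          exI[of _ "\<lambda>k i. \<omega> (if i = 0 then fst (\<phi> k) else snd (\<phi> k))"]) auto
qed simp

lemma quadric_H0_nonzero:
  assumes d: "d = 2" shows "H0_Sym_Omega1 2 X \<noteq> {\<lambda>_ _. 0}"
proof
  assume "H0_Sym_Omega1 2 X = {\<lambda>_ _. 0}"
  then have eq: "(\<lambda>v w. if (v, w) \<in> tangent_pairs X X then F w else 0) = (\<lambda>_ _. 0)"
    using quadric_section[OF d] by auto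
  obtain v where v: "v \<in> Xh" using Xh_nonempty by blast
  obtain w where w: "DF v w = 0" "F w \<noteq> 0" using F_nonzero_on_tangent[OF v] by blast
  have "(v, w) \<in> tangent_pairs X X" using tangent_pairs_iff[of X v w] v w span1_in_X by auto
  then show False using fun_cong[OF fun_cong[OF eq, of v], of w] w by simp
qed

end

text \<open>Any vector off the cone serves as \<open>e\<close> after scaling one nonzero coordinate,
  taken as \<open>i0\<close>, to \<open>1\<close>; the dimension leaves three more indices.\<close>

lemma hypersurface_coordinates:
  fixes X :: "(complex^'n::finite) set set"
  assumes card: "CARD('n) \<ge> 4" and X: "hypersurface_deg d X" and d: "d \<ge> 2" and smooth: "smooth_variety X"
  shows "\<exists>F e i0 i1 i2 i3. smooth_hypersurface X F d e i0 i1 i2 i3"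
proof -
  obtain F where F: "homog d F" "F \<noteq> (\<lambda>_. 0)" "X = {x \<in> proj_space. vanishes_on F {x}}"
    "\<forall>e H. homog e H \<and> vanishes_on H X \<longrightarrow> (\<exists>G\<in>polys. \<forall>v. H v = F v * G v)"
    using X unfolding hypersurface_deg_def by blast
  obtain a where a: "F a \<noteq> 0" using F(2) by auto
  then have "a \<noteq> 0" using homog_scale[OF F(1), of 0 a] d by (auto simp: power_0_left)
  then obtain i0 where i0: "a $ i0 \<noteq> 0" by (auto simp: vec_eq_iff)
  have "card (UNIV - {i0}) \<ge> 3" using card by (simp add: card_Diff_singleton)
  then obtain T where T: "T \<subseteq> UNIV - {i0}" "card T = 3" by (meson obtain_subset_with_card_n)
  then obtain i1 i2 i3 where "T = {i1, i2, i3}" "distinct [i1, i2, i3]"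
    by (auto simp: card_3_iff)
  then have "distinct [i0, i1, i2, i3]" using T by auto
  then have "smooth_hypersurface X F d ((1 / a $ i0) *s a) i0 i1 i2 i3"
    using F a i0 d smooth by unfold_locales (auto simp: homog_scale[OF F(1)])
  then show ?thesis by blast
qed

theorem theoremB:
  fixes X :: "(complex^'n::finite) set set"
  assumes "CARD('n) \<ge> 4"
    and "hypersurface X" and "smooth_variety X" and "\<not> hyperplane X"
  shows "((\<forall>m\<ge>1. H0_Sym_Omega1 m X = {\<lambda>_ _. 0}) \<longleftrightarrow> t_trisecant_variety X = proj_space) \<and>
         (t_trisecant_variety X = proj_space \<longleftrightarrow> \<not> quadric X)"
proof (cases "quadric X")
  case True
  then obtain F e i0 i1 i2 i3 where "smooth_hypersurface X F 2 e i0 i1 i2 i3"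
    using hypersurface_coordinates[OF assms(1) _ _ assms(3), of 2] by (auto simp: quadric_def)
  then interpret smooth_hypersurface X F 2 e i0 i1 i2 i3 .
  have "\<not> (\<forall>m\<ge>1. H0_Sym_Omega1 m X = {\<lambda>_ _. 0})"
    using quadric_H0_nonzero by (intro notI) (drule spec[of _ 2], simp)
  then show ?thesis using quadric_t_trisecant_variety True by blast
next
  case False
  obtain d where d: "d \<ge> 1" "hypersurface_deg d X" using assms(2) by (auto simp: hypersurface_def)
  then have "d \<noteq> 1" "d \<noteq> 2" using assms(4) False by (auto simp: hyperplane_def quadric_def)
  then have d3: "d \<ge> 3" using d by linarith
  then obtain F e i0 i1 i2 i3 where "smooth_hypersurface X F d e i0 i1 i2 i3"
    using hypersurface_coordinates[OF assms(1) d(2) _ assms(3)] by auto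
  then interpret smooth_hypersurface X F d e i0 i1 i2 i3 .
  have "H0_Sym_Omega1 m X = {\<lambda>_ _. 0}" if "m \<ge> 1" for m
    using H0_zero H0_vanishes[OF d3 that] by (auto simp: fun_eq_iff)
  then show ?thesis using t_trisecant_variety_eq_proj_space[OF d3] False by blast
qed

end
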